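(* Let $q \ge 4$ be a prime power and let $V_2$ be a non-degenerate Hermitian surface in $\mathbb{P}^3$ over $\mathbb{F}_{q^2}$. Let $F \in \mathbb{F}_{q^2}[x_0,x_1,x_2,x_3]$ be a nonzero homogeneous polynomial of degree $3$ such that $|\mathsf{V}(F)\cap V_2| = 3(q^3+q^2-q)+1$. Then $V(F)$ is a union of three distinct planes $\Pi_1,\Pi_2,\Pi_3$ tangent to $V_2$ satisfying: (a) for $i\neq j$, the line $\ell_{ij}=\Pi_i\cap\Pi_j$ is a secant line; (b) $|\Pi_1\cap\Pi_2\cap\Pi_3\cap V_2|=1$.
   Context: A non-degenerate Hermitian surface $V_2$ is the zero set in $\mathbb{P}^3$ of $x^T A x^{(q)}$, where $x=(x_0,x_1,x_2,x_3)^T$, $x^{(q)}=(x_0^q,x_1^q,x_2^q,x_3^q)^T$, and $A=(a_{ij})$ is an invertible $4\times 4$ matrix over $\mathbb{F}_{q^2}$ with $A^T=A^{(q)}:=(a_{ij}^q)$. $V(F)$ is the zero set of $F$ in $\mathbb{P}^3$ over the algebraic closure $\overline{\mathbb{F}}_q$, and $\mathsf{V}(F)$ is its set of $\mathbb{F}_{q^2}$-rational points. In cardinalities, $V_2$ and planes are understood as their sets of $\mathbb{F}_{q^2}$-rational points. Planes and lines are defined over $\mathbb{F}_{q^2}$. A plane is tangent to $V_2$ if it is the tangent plane of $V_2$ at some $\mathbb{F}_{q^2}$-rational point of $V_2$. A line is a secant line if it meets $V_2$ in exactly $q+1$ $\mathbb{F}_{q^2}$-rational points. *)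

theory Defs
  imports
    "HOL-Analysis.Cartesian_Space"
    "HOL-Algebra.Algebraic_Closure_Type"
    "HOL-Number_Theory.Prime_Powers"
    "HOL-Library.Poly_Mapping"
begin

unbundle no fps_syntax

text \<open>
  Polynomials in four variables over \<open>'a\<close>: finitely supported maps from exponent vectors to
  coefficients. The variables are indexed by the four-element type \<open>4\<close>.
\<close>

type_synonym 'a poly4 = "(4 \<Rightarrow>\<^sub>0 nat) \<Rightarrow>\<^sub>0 'a"

definition homogeneous :: "nat \<Rightarrow> 'a::zero poly4 \<Rightarrow> bool" where
  "homogeneous d F \<longleftrightarrow> (\<forall>m\<in>Poly_Mapping.keys F. (\<Sum>i\<in>UNIV. Poly_Mapping.lookup m i) = d)"

text \<open>Value of a polynomial over \<open>'a\<close> at a vector over the algebraic closure of \<open>'a\<close>.\<close>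

definition eval_ac :: "'a::field poly4 \<Rightarrow> 'a alg_closure ^ 4 \<Rightarrow> 'a alg_closure" where
  "eval_ac F x = (\<Sum>m\<in>Poly_Mapping.keys F.
     to_ac (Poly_Mapping.lookup F m) * (\<Prod>i\<in>UNIV. x $ i ^ Poly_Mapping.lookup m i))"

definition partial_deriv :: "4 \<Rightarrow> 'a::field poly4 \<Rightarrow> 'a poly4" where
  "partial_deriv i F = (\<Sum>m\<in>Poly_Mapping.keys F.
     Poly_Mapping.single (m - Poly_Mapping.single i 1)
       (of_nat (Poly_Mapping.lookup m i) * Poly_Mapping.lookup F m))"

text \<open>
  All sets of points live in projective 3-space over the algebraic closure, a point being a
  one-dimensional subspace \<open>vec.span {x}\<close> with \<open>x \<noteq> 0\<close>. The set \<open>zero_set F\<close>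
  is meant for homogeneous \<open>F\<close>, for which the vanishing of \<open>F\<close> does not depend on the representative \<open>x\<close>.
\<close>

type_synonym 'a point3 = "('a alg_closure ^ 4) set"

definition zero_set :: "'a::field poly4 \<Rightarrow> 'a point3 set" where
  "zero_set F = {vec.span {x} | x. x \<noteq> 0 \<and> eval_ac F x = 0}"

definition embed_ac :: "'a::field ^ 4 \<Rightarrow> 'a alg_closure ^ 4" where
  "embed_ac x = (\<chi> i. to_ac (x $ i))"

definition rational_points :: "'a::field point3 set" where
  "rational_points = {vec.span {embed_ac x} | x. x \<noteq> 0}"

definition is_plane :: "'a::field point3 set \<Rightarrow> bool" where
  "is_plane E \<longleftrightarrow> (\<exists>L :: 'a poly4. L \<noteq> 0 \<and> homogeneous 1 L \<and> E = zero_set L)"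

text \<open>A line defined over \<open>'a\<close> is the join of two distinct \<open>'a\<close>-rational points.\<close>

definition is_line :: "'a::field point3 set \<Rightarrow> bool" where
  "is_line l \<longleftrightarrow> (\<exists>x y :: 'a ^ 4. x \<noteq> 0 \<and> y \<noteq> 0 \<and> vec.span {embed_ac x} \<noteq> vec.span {embed_ac y} \<and>
     l = {vec.span {z} | z. z \<noteq> 0 \<and> z \<in> vec.span {embed_ac x, embed_ac y}})"

text \<open>
  The (embedded) tangent space at \<open>P\<close> of the surface with homogeneous equation \<open>F\<close>, cut out by the
  linear form \<open>\<Sum>i. (\<partial>F/\<partial>x\<^sub>i)(P) * y\<^sub>i\<close>. Different nonzero representatives \<open>x \<in> P\<close> give proportional
  forms, and \<open>x = 0\<close> adds no further condition.
\<close>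

definition tangent_space :: "'a::field poly4 \<Rightarrow> 'a point3 \<Rightarrow> 'a point3 set" where
  "tangent_space F P =
     {vec.span {y} | y. y \<noteq> 0 \<and> (\<forall>x\<in>P. (\<Sum>i\<in>UNIV. eval_ac (partial_deriv i F) x * y $ i) = 0)}"

definition is_tangent_plane :: "'a::field poly4 \<Rightarrow> 'a point3 set \<Rightarrow> bool" where
  "is_tangent_plane F E \<longleftrightarrow>
     is_plane E \<and> (\<exists>P \<in> zero_set F \<inter> rational_points. E = tangent_space F P)"

definition hermitian_matrix :: "nat \<Rightarrow> 'a::field ^ 4 ^ 4 \<Rightarrow> bool" where
  "hermitian_matrix q A \<longleftrightarrow> transpose A = (\<chi> i j. (A $ i $ j) ^ q)"

text \<open>The polynomial \<open>x\<^sup>T A x\<^sup>(\<^sup>q\<^sup>) = \<Sum>i j. a\<^sub>i\<^sub>j * x\<^sub>i * x\<^sub>j ^ q\<close>.\<close>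

definition hermitian_poly :: "nat \<Rightarrow> 'a::field ^ 4 ^ 4 \<Rightarrow> 'a poly4" where
  "hermitian_poly q A = (\<Sum>i\<in>UNIV. \<Sum>j\<in>UNIV.
     Poly_Mapping.single (Poly_Mapping.single i 1 + Poly_Mapping.single j q) (A $ i $ j))"

definition is_secant_line :: "nat \<Rightarrow> 'a::field ^ 4 ^ 4 \<Rightarrow> 'a point3 set \<Rightarrow> bool" where
  "is_secant_line q A l \<longleftrightarrow>
     is_line l \<and> card (l \<inter> zero_set (hermitian_poly q A) \<inter> rational_points) = q + 1"

end

theory Submission
  imports Defs "HOL-Number_Theory.Residues"
begin

no_notation fps_nth (infixl \<open>$\<close> 75)

text \<open>
  The rational points of the Hermitian surface and the lines contained in it (the generators) form a
  generalized quadrangle of order \<open>(q\<^sup>2, q)\<close>. The tangent plane at a point \<open>P\<close> meets the surface in the points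
  collinear with \<open>P\<close>, which is \<open>q\<^sup>3 + q\<^sup>2 + 1\<close> points.

  The heart of the proof is an upper bound for the number \<open>N\<close> of points in which a surface \<open>f = 0\<close> of degree
  \<open>d < q\<close> meets the Hermitian surface when \<open>f\<close> vanishes on none of its tangent planes. Let \<open>k\<^sub>x\<close> be the number
  of generators through \<open>x\<close> on which \<open>f\<close> vanishes. These generators lie in the tangent plane at \<open>x\<close>, where \<open>f\<close> is
  divisible by the product of their equations. Hence \<open>f\<close> restricted to any other generator \<open>g\<close> through \<open>x\<close>
  has a zero of order at least \<open>k\<^sub>x\<close> at \<open>x\<close>, and the numbers \<open>max 1 k\<^sub>x\<close> over the zeros \<open>x\<close> of \<open>f\<close> on \<open>g\<close> sum to
  at most \<open>d\<close> (lemma \<open>locus_line_weight\<close>). Everything else is double counting in the quadrangle. Let \<open>L\<close> be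
  the number of generators on which \<open>f\<close> vanishes, and let \<open>S\<close> be the number of ordered pairs of them that meet.
  Summing the weights over all generators gives
  \<open>d(q + 1)N + (q + 1 - d)S \<le> d\<^sup>2(q\<^sup>3 + 1)(q + 1) + dL(q\<^sup>2 + 1 - d)\<close> (lemma \<open>point_count\<close>), and summing over the
  generators through a point with \<open>f \<noteq> 0\<close> gives \<open>L \<le> d(q + 1)\<close> (lemma \<open>card_full_bound\<close>). So \<open>N\<close> can be large only
  if \<open>L\<close> is close to \<open>d(q + 1)\<close>; but then lemma \<open>nbrs_bound\<close> forces each of the \<open>L\<close> generators to meet many of the
  others, and the term with \<open>S\<close> pulls \<open>N\<close> down again. The outcome is \<open>N \<le> 3(q\<^sup>3 + q\<^sup>2 - q)\<close> for \<open>d = 3\<close>,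
  \<open>N < 2q\<^sup>3 + 2q\<^sup>2 - 3q\<close> for \<open>d = 2\<close> and \<open>N \<le> q\<^sup>3 + q\<close> for \<open>d = 1\<close>.

  A cubic with \<open>3(q\<^sup>3 + q\<^sup>2 - q) + 1\<close> points on the Hermitian surface therefore vanishes on a tangent plane and
  splits off its equation. The bound for \<open>d = 2\<close> applies to the quadratic cofactor and the bound for \<open>d = 1\<close>
  to the linear one, so the cubic is a product of the equations of three tangent planes (theorem
  \<open>cubic_factors_into_tangent_planes\<close>). Two tangent sections meet in \<open>q + 1\<close> points, or in the \<open>q\<^sup>2 + 1\<close> points of
  a generator if the points of tangency are collinear. By inclusion and exclusion the number of points of the
  cubic excludes the second case and equal planes, and leaves exactly one point of the surface on all three planes
  (lemma \<open>three_perps\<close>).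
\<close>

section \<open>Finite generalized quadrangles\<close>

lemma sum_card_swap:
  assumes "finite A" "finite B"
  shows "(\<Sum>a\<in>A. card {b\<in>B. R a b}) = (\<Sum>b\<in>B. card {a\<in>A. R a b})"
proof -
  have "(\<Sum>a\<in>A. card {b\<in>B. R a b}) = (\<Sum>a\<in>A. \<Sum>b\<in>B. if R a b then 1 else 0)"
    using assms by (intro sum.cong refl) (simp add: sum.If_cases Int_def)
  also have "\<dots> = (\<Sum>b\<in>B. \<Sum>a\<in>A. if R a b then 1 else 0)" by (rule sum.swap)
  also have "\<dots> = (\<Sum>b\<in>B. card {a\<in>A. R a b})"
    using assms by (intro sum.cong refl) (simp add: sum.If_cases Int_def)
  finally show ?thesis .
qed

text \<open>
  A finite generalized quadrangle of order \<open>(s, t)\<close>. The Hermitian surface is one with \<open>s = q\<^sup>2\<close> and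
  \<open>t = q\<close>, and all the counting below uses only these incidence axioms.
\<close>

locale generalized_quadrangle =
  fixes P :: "'p set" and Lines :: "'p set set" and s t :: nat
  assumes finite_points: "finite P"
    and line_subset: "l \<in> Lines \<Longrightarrow> l \<subseteq> P"
    and card_line: "l \<in> Lines \<Longrightarrow> card l = s + 1"
    and card_pencil: "x \<in> P \<Longrightarrow> card {l \<in> Lines. x \<in> l} = t + 1"
    and line_unique: "\<lbrakk>l \<in> Lines; m \<in> Lines; x \<in> l; x \<in> m; y \<in> l; y \<in> m; x \<noteq> y\<rbrakk> \<Longrightarrow> l = m"
    and projection: "\<lbrakk>x \<in> P; l \<in> Lines; x \<notin> l\<rbrakk> \<Longrightarrow> \<exists>!m. m \<in> Lines \<and> x \<in> m \<and> m \<inter> l \<noteq> {}"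
begin

lemma finite_lines [simp]: "finite Lines"
  using finite_points line_subset by (meson PowI finite_Pow_iff finite_subset subsetI)

lemma finite_line: "l \<in> Lines \<Longrightarrow> finite l"
  using finite_points line_subset finite_subset by blast

lemma card_meet:
  assumes "l \<in> Lines" "m \<in> Lines" "l \<noteq> m" "l \<inter> m \<noteq> {}"
  shows "card (l \<inter> m) = 1"
proof -
  obtain x where "x \<in> l \<inter> m" using assms by blast
  then have "l \<inter> m = {x}" using line_unique assms by blast
  then show ?thesis by simp
qed

lemma card_common_points:
  assumes "l \<in> Lines" "m \<in> Lines" "m \<noteq> l" "m \<inter> l \<noteq> {}"
  shows "card {x \<in> l. x \<in> m} = 1"
proof -
  have "{x \<in> l. x \<in> m} = l \<inter> m" by blast
  then show ?thesis using card_meet[of l m] assms by (simp add: Int_commute)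
qed

lemma card_lines_through_off:
  assumes "x \<in> P" "l \<in> Lines" "x \<notin> l"
  shows "card {m \<in> Lines. x \<in> m \<and> m \<inter> l \<noteq> {}} = 1"
proof -
  obtain m where "m \<in> Lines \<and> x \<in> m \<and> m \<inter> l \<noteq> {}"
      "\<And>m'. m' \<in> Lines \<and> x \<in> m' \<and> m' \<inter> l \<noteq> {} \<Longrightarrow> m' = m"
    using projection[OF assms] by metis
  then have "{m \<in> Lines. x \<in> m \<and> m \<inter> l \<noteq> {}} = {m}" by blast
  then show ?thesis by simp
qed

lemma card_lines_through_other:
  assumes "x \<in> l" "l \<in> Lines"
  shows "card {m \<in> Lines. m \<noteq> l \<and> x \<in> m} = t"
proof -
  have "{m \<in> Lines. m \<noteq> l \<and> x \<in> m} = {m \<in> Lines. x \<in> m} - {l}" by auto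
  moreover have "x \<in> P" using assms line_subset by blast
  ultimately show ?thesis using card_pencil[of x] assms by (simp add: card_Diff_singleton)
qed

lemma card_lines_meeting:
  assumes "l \<in> Lines"
  shows "card {m \<in> Lines. m \<noteq> l \<and> m \<inter> l \<noteq> {}} = (s + 1) * t" (is "card ?N = _")
proof -
  have "card ?N = (\<Sum>m\<in>?N. card {x \<in> l. x \<in> m})"
  proof -
    have "card {x \<in> l. x \<in> m} = 1" if "m \<in> ?N" for m
      using card_common_points[OF assms] that by blast
    then show ?thesis by simp
  qed
  also have "\<dots> = (\<Sum>x\<in>l. card {m \<in> ?N. x \<in> m})"
    by (rule sum_card_swap) (auto simp: finite_line assms)
  also have "\<dots> = (\<Sum>x\<in>l. t)"
  proof (intro sum.cong refl)
    fix x assume "x \<in> l"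
    then have "{m \<in> ?N. x \<in> m} = {m \<in> Lines. m \<noteq> l \<and> x \<in> m}" by blast
    then show "card {m \<in> ?N. x \<in> m} = t" using card_lines_through_other \<open>x \<in> l\<close> assms by simp
  qed
  finally show ?thesis using card_line assms by simp
qed

text \<open>
  Each point off a line \<open>l\<close> lies on exactly one of the \<open>(s + 1)t\<close> other lines that meet \<open>l\<close>, and each of those
  lines has \<open>s\<close> points off \<open>l\<close>.
\<close>

lemma card_points:
  assumes "l \<in> Lines"
  shows "card P = (s + 1) * (s * t + 1)"
proof -
  let ?N = "{m \<in> Lines. m \<noteq> l \<and> m \<inter> l \<noteq> {}}"
  have "card (P - l) = (\<Sum>x\<in>P-l. card {m \<in> ?N. x \<in> m})"
  proof -
    have "card {m \<in> ?N. x \<in> m} = 1" if "x \<in> P - l" for x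
    proof -
      have "{m \<in> ?N. x \<in> m} = {m \<in> Lines. x \<in> m \<and> m \<inter> l \<noteq> {}}" using that by blast
      then show ?thesis using card_lines_through_off that assms by simp
    qed
    then show ?thesis by simp
  qed
  also have "\<dots> = (\<Sum>m\<in>?N. card {x \<in> P - l. x \<in> m})"
    by (rule sum_card_swap) (auto simp: finite_points)
  also have "\<dots> = (\<Sum>m\<in>?N. s)"
  proof (intro sum.cong refl)
    fix m assume m: "m \<in> ?N"
    have "{x \<in> P - l. x \<in> m} = m - (m \<inter> l)" using line_subset m by blast
    then show "card {x \<in> P - l. x \<in> m} = s"
      using card_meet[of m l] card_line[of m] m assms finite_line[of m] by (simp add: card_Diff_subset_Int)
  qed
  also have "\<dots> = (s + 1) * t * s" using card_lines_meeting[OF assms] by simp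
  finally have "card (P - l) = (s + 1) * t * s" .
  moreover have "card P = card (P - l) + card l"
    using card_Diff_subset[of l P] finite_line assms line_subset finite_points card_mono[of P l] by simp
  ultimately show ?thesis using card_line assms by (simp add: algebra_simps)
qed

lemma card_lines:
  assumes "l \<in> Lines"
  shows "card Lines = (t + 1) * (s * t + 1)"
proof -
  have "(\<Sum>x\<in>P. card {l\<in>Lines. x \<in> l}) = (\<Sum>l\<in>Lines. card {x\<in>P. x \<in> l})"
    by (rule sum_card_swap[OF finite_points finite_lines])
  also have "\<dots> = (\<Sum>l\<in>Lines. s + 1)"
  proof (intro sum.cong refl)
    fix l assume l: "l \<in> Lines"
    then have "{x\<in>P. x \<in> l} = l" using line_subset by blast
    then show "card {x\<in>P. x \<in> l} = s + 1" using l card_line by simp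
  qed
  finally have "card P * (t + 1) = card Lines * (s + 1)" using card_pencil by simp
  then have "(s + 1) * (card Lines) = (s + 1) * ((t + 1) * (s * t + 1))"
    unfolding card_points[OF assms] by (simp only: mult_ac)
  then show ?thesis by (simp only: mult_cancel1) simp
qed

text \<open>
  On a Hermitian surface this is the set of rational points of the tangent plane section at \<open>x\<close>.
\<close>

definition perp :: "'p \<Rightarrow> 'p set" where
  "perp x = \<Union>{l \<in> Lines. x \<in> l}"

lemma perp_subset: "perp x \<subseteq> P"
  using line_subset by (auto simp: perp_def)

lemma finite_perp [simp]: "finite (perp x)"
  using perp_subset finite_points finite_subset by blast

text \<open>
  The lines through \<open>x\<close> are disjoint apart from \<open>x\<close>, so a set of points collinear with \<open>x\<close> can be counted
  line by line.
\<close>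

lemma card_perp_Int:
  assumes "x \<in> P" "S \<subseteq> perp x"  "\<And>l. l \<in> Lines \<Longrightarrow> x \<in> l \<Longrightarrow> card (l \<inter> S) = n" "x \<notin> S"
  shows "card S = (t + 1) * n"
proof -
  have "S = (\<Union>l\<in>{l \<in> Lines. x \<in> l}. l \<inter> S)" using assms(2) by (auto simp: perp_def)
  then have "card S = card (\<Union>l\<in>{l \<in> Lines. x \<in> l}. l \<inter> S)" by simp
  also have "\<dots> = (\<Sum>l\<in>{l \<in> Lines. x \<in> l}. card (l \<inter> S))"
  proof (rule card_UN_disjoint)
    show "\<forall>l\<in>{l \<in> Lines. x \<in> l}. \<forall>m\<in>{l \<in> Lines. x \<in> l}. l \<noteq> m \<longrightarrow> l \<inter> S \<inter> (m \<inter> S) = {}"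
      using line_unique[of _ _ x] assms(4) by blast
  qed (auto simp: finite_line)
  also have "\<dots> = (t + 1) * n" using assms card_pencil by simp
  finally show ?thesis .
qed

lemma card_perp:
  assumes "x \<in> P"
  shows "card (perp x) = (t + 1) * s + 1"
proof -
  have "card {l \<in> Lines. x \<in> l} \<noteq> 0" using card_pencil[OF assms] by simp
  then have "{l \<in> Lines. x \<in> l} \<noteq> {}" by (metis card.empty)
  then have "x \<in> perp x" by (auto simp: perp_def)
  moreover have "card (perp x - {x}) = (t + 1) * s"
  proof (rule card_perp_Int[OF assms])
    fix l assume l: "l \<in> Lines" "x \<in> l"
    then have "l \<inter> (perp x - {x}) = l - {x}" by (auto simp: perp_def)
    then show "card (l \<inter> (perp x - {x})) = s" using card_line[of l] l finite_line[of l] by simp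
  qed auto
  ultimately show ?thesis using card.remove[OF finite_perp[of x], of x] by linarith
qed

text \<open>
  A generalized quadrangle has no triangles: a point off \<open>l\<close> is collinear with only one point of \<open>l\<close>.
\<close>

lemma perp_Int_collinear:
  assumes "l \<in> Lines" "x \<in> l" "y \<in> l" "x \<noteq> y"
  shows "perp x \<inter> perp y = l"
proof
  show "l \<subseteq> perp x \<inter> perp y" using assms by (auto simp: perp_def)
  show "perp x \<inter> perp y \<subseteq> l"
  proof
    fix z assume "z \<in> perp x \<inter> perp y"
    then obtain m n where mn: "m \<in> Lines" "x \<in> m" "z \<in> m" "n \<in> Lines" "y \<in> n" "z \<in> n" by (auto simp: perp_def)
    show "z \<in> l"
    proof (rule ccontr)
      assume z: "z \<notin> l"
      have "m = n" using projection[of z l] mn z assms line_subset[of m] by blast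
      then have "m = l" using line_unique mn assms by blast
      then show False using z mn by simp
    qed
  qed
qed

text \<open>
  Each of the \<open>t + 1\<close> lines through \<open>x\<close> carries exactly one point collinear with \<open>y\<close>.
\<close>

lemma card_perp_Int_noncollinear:
  assumes "x \<in> P" "y \<in> P" "y \<notin> perp x"
  shows "card (perp x \<inter> perp y) = t + 1"
proof -
  have "x \<notin> perp y" using assms by (auto simp: perp_def)
  have "card (perp x \<inter> perp y) = (t + 1) * 1"
  proof (rule card_perp_Int[OF assms(1)])
    fix l assume l: "l \<in> Lines" "x \<in> l"
    then have "y \<notin> l" using assms by (auto simp: perp_def)
    then obtain m where m: "m \<in> Lines" "y \<in> m" "m \<inter> l \<noteq> {}"
       and u: "\<And>m'. m' \<in> Lines \<Longrightarrow> y \<in> m' \<Longrightarrow> m' \<inter> l \<noteq> {} \<Longrightarrow> m' = m"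
      using projection[of y l] l assms by blast
    have "l \<inter> (perp x \<inter> perp y) = m \<inter> l"
    proof
      show "l \<inter> (perp x \<inter> perp y) \<subseteq> m \<inter> l"
        using u unfolding perp_def by blast
      show "m \<inter> l \<subseteq> l \<inter> (perp x \<inter> perp y)"
        using m l unfolding perp_def by blast
    qed
    moreover have "m \<noteq> l" using m(2) \<open>y \<notin> l\<close> by blast
    ultimately show "card (l \<inter> (perp x \<inter> perp y)) = 1"
      using card_meet[of m l] m l by simp
  qed (use \<open>x \<notin> perp y\<close> in auto)
  then show ?thesis by simp
qed

lemma card_perp_Un_le:
  assumes "x \<in> P" "y \<in> P" "x \<noteq> y" "t \<le> s"
  shows "card (perp x \<union> perp y) + (t + 1) \<le> 2 * ((t + 1) * s + 1)"
    and "y \<in> perp x \<Longrightarrow> card (perp x \<union> perp y) + (s + 1) = 2 * ((t + 1) * s + 1)"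
    and "t + 1 \<le> card (perp x \<inter> perp y)"
proof -
  have u: "card (perp x \<union> perp y) + card (perp x \<inter> perp y) = 2 * ((t + 1) * s + 1)"
    using card_Un_Int[OF finite_perp finite_perp, of x y] card_perp assms by simp
  have co: "card (perp x \<inter> perp y) = s + 1" if y: "y \<in> perp x"
  proof -
    obtain l where "l \<in> Lines" "x \<in> l" "y \<in> l" using y unfolding perp_def by blast
    then show ?thesis using perp_Int_collinear assms(3) card_line by simp
  qed
  show i: "t + 1 \<le> card (perp x \<inter> perp y)"
    using co card_perp_Int_noncollinear[OF assms(1,2)] assms(4) by (cases "y \<in> perp x") auto
  show "card (perp x \<union> perp y) + (t + 1) \<le> 2 * ((t + 1) * s + 1)" using u i by linarith
  show "card (perp x \<union> perp y) + (s + 1) = 2 * ((t + 1) * s + 1)" if "y \<in> perp x" using u co[OF that] by linarith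
qed

text \<open>
  If \<open>x\<close> and \<open>y\<close> are collinear, their perps share a line, that is \<open>t\<^sup>2 + 1\<close> points instead of \<open>t + 1\<close>. Since the
  third perp has at least \<open>t + 1\<close> points in common with the first, the union is then too small. So is the union
  of only two perps, and therefore the three points are distinct.
\<close>

lemma collinear_perps_small:
  assumes s: "s = t\<^sup>2" and t: "t \<ge> 4" and xyz: "x \<in> P" "y \<in> P" "z \<in> P"
    and card: "card (perp x \<union> perp y \<union> perp z) + 3 * t = 3 * (t ^ 3 + t\<^sup>2) + 1"
  shows "y \<notin> perp x"
proof
  assume y: "y \<in> perp x"
  have ts: "t \<le> s" using s t by (simp add: power2_eq_square)
  have a: "(t + 1) * s + 1 = t ^ 3 + t\<^sup>2 + 1" by (simp add: s algebra_simps power2_eq_square power3_eq_cube)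
  have t2: "t\<^sup>2 \<ge> 4 * t" using t by (simp add: power2_eq_square)
  have t3: "t ^ 3 \<ge> 4 * t\<^sup>2" using t by (simp add: power2_eq_square power3_eq_cube)
  have two: "card (perp x \<union> perp y \<union> perp z) \<le> 2 * (t ^ 3 + t\<^sup>2 + 1)"
    if "x = y \<or> x = z \<or> y = z"
  proof -
    have "\<exists>b\<in>P. \<exists>c\<in>P. perp x \<union> perp y \<union> perp z = perp b \<union> perp c" using that xyz by blast
    then obtain b c where "b \<in> P" "c \<in> P" "perp x \<union> perp y \<union> perp z = perp b \<union> perp c" by blast
    then show ?thesis using card_Un_le[of "perp b" "perp c"] card_perp a by simp
  qed
  have "\<not> (x = y \<or> x = z \<or> y = z)"
  proof
    assume "x = y \<or> x = z \<or> y = z"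
    have "\<lbrakk>c \<le> 2 * (a + b + 1); c + 3 * t = 3 * (a + b) + 1; 4 * t \<le> b; 4 * b \<le> a\<rbrakk> \<Longrightarrow> False" for a b c :: nat
      using t by (unfold distrib_left; linarith)
    from this[OF two card t2 t3] show False using \<open>x = y \<or> x = z \<or> y = z\<close> by blast
  qed
  then have "x \<noteq> y" "x \<noteq> z" "y \<noteq> z" by blast+
  have u: "card (perp x \<union> perp y) + (t\<^sup>2 + 1) = 2 * (t ^ 3 + t\<^sup>2 + 1)"
    using card_perp_Un_le(2)[OF xyz(1,2) \<open>x \<noteq> y\<close> ts y] a s by simp
  have "t + 1 \<le> card (perp x \<inter> perp z)" by (rule card_perp_Un_le(3)[OF xyz(1,3) \<open>x \<noteq> z\<close> ts])
  also have "\<dots> \<le> card ((perp x \<union> perp y) \<inter> perp z)" by (intro card_mono) auto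
  finally have i: "t + 1 \<le> card ((perp x \<union> perp y) \<inter> perp z)" .
  have "card (perp x \<union> perp y) + card (perp z) = card (perp x \<union> perp y \<union> perp z) + card ((perp x \<union> perp y) \<inter> perp z)"
    by (rule card_Un_Int) auto
  moreover have "card (perp z) = t ^ 3 + t\<^sup>2 + 1" using card_perp[OF xyz(3)] a by simp
  ultimately have e: "card (perp x \<union> perp y) + (t ^ 3 + t\<^sup>2 + 1) = card (perp x \<union> perp y \<union> perp z) + card ((perp x \<union> perp y) \<inter> perp z)"
    by simp
  have "\<lbrakk>c + (b + 1) = 2 * (a + b + 1); t + 1 \<le> i; c + (a + b + 1) = n + i; n + 3 * t = 3 * (a + b) + 1; 4 * t \<le> b\<rbrakk> \<Longrightarrow> False"
    for a b c i n :: nat using t by (unfold distrib_left; linarith)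
  from this[OF u i e card t2] show False .
qed

lemma three_perps:
  assumes s: "s = t\<^sup>2" and t: "t \<ge> 4" and xyz: "x \<in> P" "y \<in> P" "z \<in> P"
    and card: "card (perp x \<union> perp y \<union> perp z) + 3 * t = 3 * (t ^ 3 + t\<^sup>2) + 1"
  shows "y \<notin> perp x" "z \<notin> perp x" "z \<notin> perp y" "card (perp x \<inter> perp y \<inter> perp z) = 1"
proof -
  show 1: "y \<notin> perp x" by (rule collinear_perps_small[OF s t xyz card])
  have "perp x \<union> perp z \<union> perp y = perp x \<union> perp y \<union> perp z" by blast
  then show 2: "z \<notin> perp x" using collinear_perps_small[OF s t xyz(1,3,2)] card by simp
  have "perp y \<union> perp z \<union> perp x = perp x \<union> perp y \<union> perp z" by blast
  then show 3: "z \<notin> perp y" using collinear_perps_small[OF s t xyz(2,3,1)] card by simp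
  have a: "(t + 1) * s + 1 = t ^ 3 + t\<^sup>2 + 1" by (simp add: s algebra_simps power2_eq_square power3_eq_cube)
  have "card (perp x \<union> perp y) + card (perp z) = card (perp x \<union> perp y \<union> perp z) + card ((perp x \<union> perp y) \<inter> perp z)"
    "card (perp x) + card (perp y) = card (perp x \<union> perp y) + card (perp x \<inter> perp y)"
    by (rule card_Un_Int; simp)+
  moreover have "card (perp x \<inter> perp z) + card (perp y \<inter> perp z)
      = card ((perp x \<union> perp y) \<inter> perp z) + card (perp x \<inter> perp y \<inter> perp z)"
  proof -
    have "(perp x \<union> perp y) \<inter> perp z = (perp x \<inter> perp z) \<union> (perp y \<inter> perp z)"
      "perp x \<inter> perp y \<inter> perp z = (perp x \<inter> perp z) \<inter> (perp y \<inter> perp z)" by blast+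
    then show ?thesis using card_Un_Int[of "perp x \<inter> perp z" "perp y \<inter> perp z"] by simp
  qed
  moreover have "card (perp v) = t ^ 3 + t\<^sup>2 + 1" if "v \<in> P" for v using card_perp[OF that] a by simp
  ultimately have e: "card (perp x \<union> perp y) + (t ^ 3 + t\<^sup>2 + 1) = card (perp x \<union> perp y \<union> perp z) + card ((perp x \<union> perp y) \<inter> perp z)"
    "2 * (t ^ 3 + t\<^sup>2 + 1) = card (perp x \<union> perp y) + (t + 1)"
    "2 * (t + 1) = card ((perp x \<union> perp y) \<inter> perp z) + card (perp x \<inter> perp y \<inter> perp z)"
    using xyz card_perp_Int_noncollinear[OF xyz(1,2) 1] card_perp_Int_noncollinear[OF xyz(1,3) 2]
      card_perp_Int_noncollinear[OF xyz(2,3) 3] by simp_all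
  have "\<lbrakk>c + (a + b + 1) = n + i; 2 * (a + b + 1) = c + (t + 1); 2 * (t + 1) = i + m; n + 3 * t = 3 * (a + b) + 1\<rbrakk> \<Longrightarrow> m = 1"
    for a b c i m n :: nat by (unfold distrib_left; linarith)
  from this[OF e card] show "card (perp x \<inter> perp y \<inter> perp z) = 1" .
qed

end

section \<open>Point sets that meet every line in few points\<close>

text \<open>
  The combinatorial shadow of a surface of degree \<open>d\<close> that contains no tangent plane: \<open>Z\<close> is the set of its
  points on the quadrangle, and the weight of a point bounds from below the order of vanishing along a line
  through this point that \<open>Z\<close> does not contain.
\<close>

locale light_set = generalized_quadrangle P Lines s t for P :: "'p set" and Lines :: "'p set set" and s t :: nat +
  fixes Z :: "'p set" and d :: nat
  assumes Z_subset: "Z \<subseteq> P" and d_pos: "1 \<le> d" and d_le: "d \<le> t"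
    and light: "\<lbrakk>g \<in> Lines; \<not> g \<subseteq> Z\<rbrakk> \<Longrightarrow>
      (\<Sum>x\<in>g \<inter> Z. max 1 (card {l \<in> Lines. l \<subseteq> Z \<and> x \<in> l})) \<le> d"
    and light_pencil: "x \<in> P \<Longrightarrow> card {l \<in> Lines. l \<subseteq> Z \<and> x \<in> l} \<le> d"
begin

definition full :: "'p set set" where "full = {l \<in> Lines. l \<subseteq> Z}"
definition full_mult :: "'p \<Rightarrow> nat" where "full_mult x = card {l \<in> full. x \<in> l}"
definition nbrs :: "'p set \<Rightarrow> 'p set set" where "nbrs l = {g \<in> full. g \<noteq> l \<and> g \<inter> l \<noteq> {}}"

lemma full_mult_eq: "full_mult x = card {l \<in> Lines. l \<subseteq> Z \<and> x \<in> l}"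
  by (simp add: full_mult_def full_def conj_assoc)

lemma finite_full [simp]: "finite full" by (simp add: full_def)
lemma finite_Z [simp]: "finite Z" using Z_subset finite_points finite_subset by blast
lemma finite_nbrs [simp]: "finite (nbrs l)" by (simp add: nbrs_def)
lemma full_line: "l \<in> full \<Longrightarrow> l \<in> Lines" by (simp add: full_def)
lemma full_subset: "l \<in> full \<Longrightarrow> l \<subseteq> Z" by (simp add: full_def)

lemma weight_le: "g \<in> Lines - full \<Longrightarrow> (\<Sum>x\<in>g \<inter> Z. max 1 (full_mult x)) \<le> d"
  using light[of g] by (simp add: full_mult_eq full_def)

lemma full_mult_le: "x \<in> P \<Longrightarrow> full_mult x \<le> d"
  using light_pencil by (simp add: full_mult_eq)

lemma full_mult_pos:
  assumes "x \<in> l" "l \<in> full"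
  shows "full_mult x \<ge> 1"
proof -
  have "{l \<in> full. x \<in> l} \<noteq> {}" using assms by blast
  then show ?thesis unfolding full_mult_def by (simp add: Suc_le_eq card_gt_0_iff)
qed

text \<open>
  A substitute for the theorem of Bezout, according to which the intersection is a curve of degree \<open>d(t + 1)\<close>.
  Each full line meets exactly one of the \<open>t + 1\<close> lines through a point
  \<open>y\<close> outside \<open>Z\<close>, and each of these lines meets at most \<open>d\<close> full lines because it is not full itself.
\<close>

lemma card_full_bound:
  shows "card full \<le> d * (t + 1)"
proof (cases "full = {}")
  case True then show ?thesis by simp
next
  case False
  then obtain l where l: "l \<in> full" by blast
  then have "l \<noteq> {}" using card_line[of l] full_line by auto
  then obtain x where "x \<in> l" by blast
  with l have "x \<in> P" using full_line line_subset by blast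
  \<comment> \<open>at most \<open>d\<close> of the \<open>t + 1\<close> lines through \<open>x\<close> are full, so \<open>Z\<close> does not contain all points\<close>
  have "\<not> {l \<in> Lines. x \<in> l} \<subseteq> {l \<in> full. x \<in> l}"
  proof
    assume "{l \<in> Lines. x \<in> l} \<subseteq> {l \<in> full. x \<in> l}"
    then have "card {l \<in> Lines. x \<in> l} \<le> full_mult x" unfolding full_mult_def by (intro card_mono) auto
    then show False using card_pencil \<open>x \<in> P\<close> full_mult_le[of x] d_le by simp
  qed
  then obtain g where "g \<in> Lines" "g \<notin> full" by blast
  then obtain y where y: "y \<in> P" "y \<notin> Z" using line_subset unfolding full_def by blast
  let ?N = "{m \<in> Lines. y \<in> m}"
  have N: "finite ?N" "card ?N = t + 1" using card_pencil y by auto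
  have one: "card {g\<in>?N. g \<inter> l \<noteq> {}} = 1" if "l \<in> full" for l
  proof -
    have "y \<notin> l" using that y full_subset by blast
    moreover have "{g\<in>?N. g \<inter> l \<noteq> {}} = {m \<in> Lines. y \<in> m \<and> m \<inter> l \<noteq> {}}" by auto
    ultimately show ?thesis using card_lines_through_off[OF y(1) full_line[OF that]] by simp
  qed
  have "card full = (\<Sum>l\<in>full. card {g\<in>?N. g \<inter> l \<noteq> {}})" using one by simp
  also have "\<dots> = (\<Sum>g\<in>?N. card {l\<in>full. g \<inter> l \<noteq> {}})" by (rule sum_card_swap) auto
  also have "\<dots> \<le> (\<Sum>g\<in>?N. d)"
  proof (rule sum_mono)
    fix g assume g: "g \<in> ?N"
    have "{l\<in>full. g \<inter> l \<noteq> {}} \<subseteq> (\<Union>x\<in>g \<inter> Z. {l \<in> full. x \<in> l})"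
      using full_subset by blast
    then have "card {l\<in>full. g \<inter> l \<noteq> {}} \<le> card (\<Union>x\<in>g \<inter> Z. {l \<in> full. x \<in> l})"
      by (intro card_mono) auto
    also have "\<dots> \<le> (\<Sum>x\<in>g \<inter> Z. full_mult x)" unfolding full_mult_def by (rule card_UN_le) simp
    also have "\<dots> \<le> (\<Sum>x\<in>g \<inter> Z. max 1 (full_mult x))" by (rule sum_mono) simp
    also have "\<dots> \<le> d" using g y full_subset by (intro weight_le) blast
    finally show "card {l\<in>full. g \<inter> l \<noteq> {}} \<le> d" .
  qed
  finally show ?thesis using N by (simp add: mult_ac)
qed

lemma sum_full_mult: "(\<Sum>x\<in>Z. full_mult x) = card full * (s + 1)"
proof -
  have "(\<Sum>x\<in>Z. full_mult x) = (\<Sum>l\<in>full. card {x\<in>Z. x \<in> l})" unfolding full_mult_def by (rule sum_card_swap) auto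
  also have "\<dots> = (\<Sum>l\<in>full. s + 1)"
  proof (rule sum.cong[OF refl])
    fix l assume l: "l \<in> full"
    then have "{x\<in>Z. x \<in> l} = l" using full_subset by blast
    then show "card {x\<in>Z. x \<in> l} = s + 1" using card_line[OF full_line[OF l]] by simp
  qed
  finally show ?thesis by simp
qed

lemma sum_over_incident:
  fixes f :: "'p \<Rightarrow> int"
  shows "(\<Sum>l\<in>full. \<Sum>x\<in>l. f x) = (\<Sum>x\<in>Z. int (full_mult x) * f x)"
proof -
  have "(\<Sum>l\<in>full. \<Sum>x\<in>l. f x) = (\<Sum>l\<in>full. \<Sum>x\<in>Z. if x \<in> l then f x else 0)"
  proof (rule sum.cong[OF refl])
    fix l assume "l \<in> full"
    then have "Z \<inter> l = l" using full_subset by blast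
    then show "(\<Sum>x\<in>l. f x) = (\<Sum>x\<in>Z. if x \<in> l then f x else 0)"
      using sum.inter_restrict[of Z f l] by simp
  qed
  also have "\<dots> = (\<Sum>x\<in>Z. \<Sum>l\<in>full. if x \<in> l then f x else 0)" by (rule sum.swap)
  also have "\<dots> = (\<Sum>x\<in>Z. int (full_mult x) * f x)"
    by (rule sum.cong[OF refl]) (simp add: sum.If_cases full_mult_def Int_def)
  finally show ?thesis .
qed

text \<open>
  A line that meets \<open>l\<close> does so in a single point, so the neighbours can be counted at the points of \<open>l\<close>.
\<close>

lemma card_nbrs:
  assumes "l \<in> full"
  shows "int (card (nbrs l)) = (\<Sum>x\<in>l. int (full_mult x) - 1)"
proof -
  have "card {x \<in> l. x \<in> m} = 1" if "m \<in> nbrs l" for m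
    using card_common_points[of l m] that assms full_line unfolding nbrs_def by blast
  then have "card (nbrs l) = (\<Sum>m\<in>nbrs l. card {x \<in> l. x \<in> m})" by simp
  also have "\<dots> = (\<Sum>x\<in>l. card {m\<in>nbrs l. x \<in> m})"
    by (rule sum_card_swap) (auto simp: finite_line full_line assms)
  finally have "int (card (nbrs l)) = (\<Sum>x\<in>l. int (card {m\<in>nbrs l. x \<in> m}))" by simp
  also have "\<dots> = (\<Sum>x\<in>l. int (full_mult x) - 1)"
  proof (rule sum.cong[OF refl])
    fix x assume x: "x \<in> l"
    have "{m\<in>nbrs l. x \<in> m} = {m \<in> full. x \<in> m} - {l}" using x by (auto simp: nbrs_def)
    then have "card {m\<in>nbrs l. x \<in> m} = full_mult x - 1" using x assms by (simp add: full_mult_def)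
    then show "int (card {m\<in>nbrs l. x \<in> m}) = int (full_mult x) - 1" using full_mult_pos[OF x assms] by simp
  qed
  finally show ?thesis .
qed

text \<open>
  The weights are summed over all incident pairs of a point of \<open>Z\<close> and a line that is not full, where a line is
  called full if \<open>Z\<close> contains it. A point of
  multiplicity \<open>k\<close> contributes \<open>(t + 1 - k) max 1 k\<close>; comparing this with \<open>t + 1 - k\<close> leaves a surplus that is
  at least \<open>(t + 1 - d)/d\<close> times the number \<open>k(k - 1)\<close> of ordered pairs of full lines meeting there.
\<close>

lemma point_count:
  assumes ne: "Lines \<noteq> {}"
  shows "int d * (int t + 1) * int (card Z) + (int t + 1 - int d) * (\<Sum>l\<in>full. int (card (nbrs l)))
    \<le> int d ^ 2 * (int s * int t + 1) * (int t + 1) + int d * int (card full) * (int s + 1 - int d)"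
proof -
  have "(\<Sum>g\<in>Lines-full. \<Sum>x\<in>g\<inter>Z. max 1 (full_mult x)) \<le> (\<Sum>g\<in>Lines-full. d)"
    by (rule sum_mono) (rule weight_le)
  also have "\<dots> = (card Lines - card full) * d"
    by (simp add: card_Diff_subset full_def)
  finally have up: "(\<Sum>g\<in>Lines-full. \<Sum>x\<in>g\<inter>Z. max 1 (full_mult x)) \<le> (card Lines - card full) * d" .
  have "(\<Sum>g\<in>Lines-full. \<Sum>x\<in>g\<inter>Z. max 1 (full_mult x))
      = (\<Sum>g\<in>Lines-full. \<Sum>x\<in>Z. if x \<in> g then max 1 (full_mult x) else 0)"
    by (rule sum.cong[OF refl]) (simp add: sum.inter_restrict Int_commute[of _ Z] del: One_nat_def)
  also have "\<dots> = (\<Sum>x\<in>Z. \<Sum>g\<in>Lines-full. if x \<in> g then max 1 (full_mult x) else 0)" by (rule sum.swap)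
  also have "\<dots> = (\<Sum>x\<in>Z. (t + 1 - full_mult x) * max 1 (full_mult x))"
  proof (rule sum.cong[OF refl])
    fix x assume x: "x \<in> Z"
    have "{g \<in> Lines - full. x \<in> g} = {l \<in> Lines. x \<in> l} - {l \<in> full. x \<in> l}" by auto
    moreover have "{l \<in> full. x \<in> l} \<subseteq> {l \<in> Lines. x \<in> l}" using full_line by blast
    ultimately have "card {g \<in> Lines - full. x \<in> g} = t + 1 - full_mult x"
      using card_pencil[OF subsetD[OF Z_subset x]] by (simp add: card_Diff_subset full_mult_def)
    then show "(\<Sum>g\<in>Lines-full. if x \<in> g then max 1 (full_mult x) else 0) = (t + 1 - full_mult x) * max 1 (full_mult x)"
      by (simp add: sum.If_cases Int_def)
  qed
  finally have eq: "(\<Sum>x\<in>Z. (t + 1 - full_mult x) * max 1 (full_mult x)) \<le> (card Lines - card full) * d"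
    using up by simp
  have "card full \<le> card Lines" by (rule card_mono) (auto simp: full_def)
  then have "int ((card Lines - card full) * d) = (int (card Lines) - int (card full)) * int d" by (simp add: of_nat_diff)
  with eq have eq': "(\<Sum>x\<in>Z. int ((t + 1 - full_mult x) * max 1 (full_mult x))) \<le> (int (card Lines) - int (card full)) * int d"
    unfolding of_nat_sum[symmetric] by (metis of_nat_le_iff)
  \<comment> \<open>for \<open>k \<ge> 1\<close> the two sides differ by \<open>(k - 1)(d - k)(t + 1)\<close>\<close>
  have pw: "int d * (int t + 1) - int d * int (full_mult x) + (int t + 1 - int d) * (int (full_mult x) * (int (full_mult x) - 1))
      \<le> int d * int ((t + 1 - full_mult x) * max 1 (full_mult x))" if x: "x \<in> Z" for x
  proof -
    have k: "full_mult x \<le> d" using full_mult_le x Z_subset by blast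
    show ?thesis
    proof (cases "full_mult x = 0")
      case True then show ?thesis by (simp add: algebra_simps)
    next
      case False
      define k where "k = int (full_mult x)"
      have kb: "1 \<le> k" "k \<le> int d" using False k by (auto simp: k_def)
      have e: "int ((t + 1 - full_mult x) * max 1 (full_mult x)) = (int t + 1 - k) * k"
        using False k d_le by (simp add: k_def of_nat_diff max_def)
      have "int d * ((int t + 1 - k) * k) - (int d * (int t + 1) - int d * k + (int t + 1 - int d) * (k * (k-1)))
        = (k - 1) * ((int d - k) * (int t + 1))" by (simp add: algebra_simps)
      moreover have "(k - 1) * ((int d - k) * (int t + 1)) \<ge> 0" using kb by simp
      ultimately show ?thesis unfolding k_def[symmetric] e by (metis diff_ge_0_iff_ge)
    qed
  qed
  have S1: "(\<Sum>l\<in>full. int (card (nbrs l))) = (\<Sum>x\<in>Z. int (full_mult x) * (int (full_mult x) - 1))"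
    unfolding sum_over_incident[symmetric] by (rule sum.cong[OF refl card_nbrs])
  have S0: "(\<Sum>x\<in>Z. int (full_mult x)) = int (card full) * (int s + 1)"
    using arg_cong[OF sum_full_mult, of int] by (simp add: algebra_simps)
  have "int d * (int t + 1) * int (card Z) - int d * (int (card full) * (int s + 1))
        + (int t + 1 - int d) * (\<Sum>l\<in>full. int (card (nbrs l)))
      = (\<Sum>x\<in>Z. int d * (int t + 1) - int d * int (full_mult x) + (int t + 1 - int d) * (int (full_mult x) * (int (full_mult x) - 1)))"
    unfolding S1 S0[symmetric] sum.distrib sum_subtractf sum_distrib_left[symmetric] by (simp add: algebra_simps)
  also have "\<dots> \<le> (\<Sum>x\<in>Z. int d * int ((t + 1 - full_mult x) * max 1 (full_mult x)))" by (rule sum_mono) (rule pw)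
  also have "\<dots> = int d * (\<Sum>x\<in>Z. int ((t + 1 - full_mult x) * max 1 (full_mult x)))" by (simp add: sum_distrib_left)
  also have "\<dots> \<le> int d * ((int (card Lines) - int (card full)) * int d)" by (rule mult_left_mono[OF eq']) simp
  finally have le: "int d * (int t + 1) * int (card Z) - int d * (int (card full) * (int s + 1))
        + (int t + 1 - int d) * (\<Sum>l\<in>full. int (card (nbrs l)))
      \<le> int d * ((int (card Lines) - int (card full)) * int d)" .
  obtain l where "l \<in> Lines" using ne by blast
  then have "int (card Lines) = (int t + 1) * (int s * int t + 1)" using card_lines[of l] by (simp add: algebra_simps)
  with le show ?thesis by (simp add: algebra_simps power2_eq_square)
qed

text \<open>
  Full lines tend to meet each other. A full line skew to \<open>l\<close> has \<open>s + 1\<close> transversals to \<open>l\<close>, one through each point of \<open>l\<close>.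
  On the other hand, a transversal \<open>g\<close> through \<open>x \<in> l\<close> that is not full meets at most \<open>d - k\<close> full lines skew to
  \<open>l\<close>, where \<open>k\<close> is the multiplicity of \<open>x\<close>, and a full one meets only its own neighbours that avoid \<open>x\<close>.
  Counting pairs of a transversal and a skew full line in both ways shows that \<open>l\<close> cannot have few neighbours if
  there are many full lines.
\<close>

lemma nbrs_bound:
  assumes l: "l \<in> full"
  shows "(int s + 1) * (int (card full) - 1 - int t * (int d - 1))
    \<le> (int s + 1 - int t - int d + int (card full)) * int (card (nbrs l))"
proof -
  let ?skew = "{h \<in> full. h \<inter> l = {}}"
  have lL: "l \<in> Lines" using l full_line by blast
  have finl: "finite l" using finite_line lL by blast
  have full_split: "full = insert l (nbrs l \<union> ?skew)" using l by (auto simp: nbrs_def)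
  have "card full = Suc (card (nbrs l \<union> ?skew))"
    using card_line[OF lL] by (subst full_split, subst card_insert_disjoint) (auto simp: nbrs_def)
  also have "card (nbrs l \<union> ?skew) = card (nbrs l) + card ?skew"
    by (rule card_Un_disjoint) (auto simp: nbrs_def)
  finally have cfull: "card full = Suc (card (nbrs l) + card ?skew)" .
  define w where "w g = card {h \<in> ?skew. g \<inter> h \<noteq> {}}" for g
  have tot: "(\<Sum>x\<in>l. \<Sum>g\<in>{g\<in>Lines. g \<noteq> l \<and> x \<in> g}. w g) = (s + 1) * card ?skew"
  proof -
    have "(\<Sum>g\<in>{g\<in>Lines. g \<noteq> l \<and> x \<in> g}. w g) = card ?skew" if x: "x \<in> l" for x
    proof -
      have "(\<Sum>g\<in>{g\<in>Lines. g \<noteq> l \<and> x \<in> g}. w g)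
         = (\<Sum>h\<in>?skew. card {g \<in> {g\<in>Lines. g \<noteq> l \<and> x \<in> g}. g \<inter> h \<noteq> {}})"
        unfolding w_def by (rule sum_card_swap) auto
      also have "\<dots> = (\<Sum>h\<in>?skew. 1)"
      proof (rule sum.cong[OF refl])
        fix h assume h: "h \<in> ?skew"
        have "{g \<in> {g\<in>Lines. g \<noteq> l \<and> x \<in> g}. g \<inter> h \<noteq> {}} = {m \<in> Lines. x \<in> m \<and> m \<inter> h \<noteq> {}}"
          using h by auto
        moreover have "x \<notin> h" "x \<in> P" "h \<in> Lines" using h x lL line_subset full_line by blast+
        ultimately show "card {g \<in> {g\<in>Lines. g \<noteq> l \<and> x \<in> g}. g \<inter> h \<noteq> {}} = 1"
          using card_lines_through_off[of x h] by simp
      qed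
      finally show ?thesis by simp
    qed
    then show ?thesis using card_line[OF lL] by simp
  qed
  \<comment> \<open>the contributions \<open>(t + 1 - k)(d - k)\<close> and \<open>- (k - 1)\<^sup>2\<close> add up to a linear function of \<open>k\<close>\<close>
  have point: "int (\<Sum>g\<in>{g\<in>Lines. g \<noteq> l \<and> x \<in> g}. w g)
     \<le> int t * (int d - 1) - (int t + int d - 1) * (int (full_mult x) - 1) + (\<Sum>g\<in>{g\<in>nbrs l. x \<in> g}. int (card (nbrs g)))"
    if x: "x \<in> l" for x
  proof -
    have xP: "x \<in> P" using x lL line_subset by blast
    have xX: "x \<in> Z" using x l full_subset by blast
    define k where "k = full_mult x"
    have k1: "1 \<le> k" "k \<le> d" using full_mult_pos[OF x l] full_mult_le[OF xP] by (auto simp: k_def)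
    have split: "{g\<in>Lines. g \<noteq> l \<and> x \<in> g} = {g\<in>Lines-full. x \<in> g} \<union> {g\<in>nbrs l. x \<in> g}"
      using x l by (auto simp: nbrs_def full_def)
    have c2: "card {g\<in>nbrs l. x \<in> g} = k - 1"
    proof -
      have "{m\<in>nbrs l. x \<in> m} = {m \<in> full. x \<in> m} - {l}" using x by (auto simp: nbrs_def)
      then show ?thesis using x l by (simp add: full_mult_def k_def)
    qed
    have c1: "card {g\<in>Lines-full. x \<in> g} = t + 1 - k"
    proof -
      have "{g \<in> Lines - full. x \<in> g} = {l \<in> Lines. x \<in> l} - {l \<in> full. x \<in> l}" by auto
      moreover have "{l \<in> full. x \<in> l} \<subseteq> {l \<in> Lines. x \<in> l}" using full_line by blast
      ultimately show ?thesis
        using card_pencil[OF xP] by (auto simp: card_Diff_subset full_mult_def k_def)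
    qed
    have b1: "w g \<le> d - k" if g: "g \<in> {g\<in>Lines-full. x \<in> g}" for g
    proof -
      have "{h \<in> ?skew. g \<inter> h \<noteq> {}} \<subseteq> (\<Union>y\<in>g \<inter> Z - {x}. {h \<in> full. y \<in> h})"
        using full_subset x by blast
      then have "w g \<le> card (\<Union>y\<in>g \<inter> Z - {x}. {h \<in> full. y \<in> h})" unfolding w_def by (intro card_mono) auto
      also have "\<dots> \<le> (\<Sum>y\<in>g \<inter> Z - {x}. full_mult y)" unfolding full_mult_def by (rule card_UN_le) simp
      also have "\<dots> \<le> (\<Sum>y\<in>g \<inter> Z - {x}. max 1 (full_mult y))" by (rule sum_mono) simp
      finally have 1: "w g \<le> (\<Sum>y\<in>g \<inter> Z - {x}. max 1 (full_mult y))" .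
      have "max 1 (full_mult x) + (\<Sum>y\<in>g \<inter> Z - {x}. max 1 (full_mult y)) = (\<Sum>y\<in>g \<inter> Z. max 1 (full_mult y))"
        using g xX by (subst sum.remove[of "g \<inter> Z" x]) auto
      also have "\<dots> \<le> d" using g by (intro weight_le) auto
      finally show ?thesis using 1 k1 unfolding k_def by linarith
    qed
    have b2: "int (w g) \<le> int (card (nbrs g)) - (int k - 1)" if g: "g \<in> {g\<in>nbrs l. x \<in> g}" for g
    proof -
      have gf: "g \<in> full" "x \<in> g" "g \<noteq> l" using g by (auto simp: nbrs_def)
      have sub: "{h \<in> full. x \<in> h} - {g} \<subseteq> nbrs g" using gf by (auto simp: nbrs_def)
      have "{h \<in> ?skew. g \<inter> h \<noteq> {}} \<subseteq> nbrs g - ({h \<in> full. x \<in> h} - {g})"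
      proof
        fix h assume h: "h \<in> {h \<in> ?skew. g \<inter> h \<noteq> {}}"
        have "x \<notin> h" using h x by blast
        moreover have "h \<noteq> g" using \<open>x \<notin> h\<close> gf by blast
        ultimately show "h \<in> nbrs g - ({h \<in> full. x \<in> h} - {g})" using h by (auto simp: nbrs_def)
      qed
      then have "w g \<le> card (nbrs g - ({h \<in> full. x \<in> h} - {g}))" unfolding w_def by (intro card_mono) auto
      also have "\<dots> = card (nbrs g) - (k - 1)" using sub gf by (simp add: card_Diff_subset full_mult_def k_def)
      finally have "w g \<le> card (nbrs g) - (k - 1)" .
      moreover have "k - 1 \<le> card (nbrs g)"
        using card_mono[OF _ sub] gf by (simp add: full_mult_def k_def)
      ultimately show ?thesis using k1 by linarith
    qed
    have "int (\<Sum>g\<in>{g\<in>Lines. g \<noteq> l \<and> x \<in> g}. w g)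
      = (\<Sum>g\<in>{g\<in>Lines-full. x \<in> g}. int (w g)) + (\<Sum>g\<in>{g\<in>nbrs l. x \<in> g}. int (w g))"
      unfolding split of_nat_sum by (rule sum.union_disjoint) (auto simp: nbrs_def)
    also have "\<dots> \<le> (\<Sum>g\<in>{g\<in>Lines-full. x \<in> g}. int d - int k) + (\<Sum>g\<in>{g\<in>nbrs l. x \<in> g}. int (card (nbrs g)) - (int k - 1))"
      using b1 b2 k1 by (intro add_mono sum_mono) fastforce+
    also have "\<dots> = (int t + 1 - int k) * (int d - int k) - (int k - 1)^2 + (\<Sum>g\<in>{g\<in>nbrs l. x \<in> g}. int (card (nbrs g)))"
      using c1 c2 k1 d_le by (simp add: sum_subtractf of_nat_diff power2_eq_square)
    also have "(int t + 1 - int k) * (int d - int k) - (int k - 1)^2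
      = int t * (int d - 1) - (int t + int d - 1) * (int (full_mult x) - 1)"
      unfolding k_def[symmetric] by (simp add: algebra_simps power2_eq_square)
    finally show ?thesis .
  qed
  have swap: "(\<Sum>x\<in>l. \<Sum>g\<in>{g\<in>nbrs l. x \<in> g}. int (card (nbrs g))) = (\<Sum>g\<in>nbrs l. int (card (nbrs g)))"
  proof -
    have "(\<Sum>x\<in>l. \<Sum>g\<in>{g\<in>nbrs l. x \<in> g}. int (card (nbrs g)))
       = (\<Sum>x\<in>l. \<Sum>g\<in>nbrs l. if x \<in> g then int (card (nbrs g)) else 0)"
      by (rule sum.cong[OF refl]) (simp add: sum.If_cases Int_def)
    also have "\<dots> = (\<Sum>g\<in>nbrs l. \<Sum>x\<in>l. if x \<in> g then int (card (nbrs g)) else 0)" by (rule sum.swap)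
    also have "\<dots> = (\<Sum>g\<in>nbrs l. int (card (nbrs g)))"
    proof (rule sum.cong[OF refl])
      fix g assume g: "g \<in> nbrs l"
      have "card {x \<in> l. x \<in> g} = 1"
        using card_common_points[of l g] g lL full_line unfolding nbrs_def by blast
      then show "(\<Sum>x\<in>l. if x \<in> g then int (card (nbrs g)) else 0) = int (card (nbrs g))"
        using finl by (simp add: sum.If_cases Int_def)
    qed
    finally show ?thesis .
  qed
  have "(int s + 1) * int (card ?skew) = (\<Sum>x\<in>l. int (\<Sum>g\<in>{g\<in>Lines. g \<noteq> l \<and> x \<in> g}. w g))"
    using arg_cong[OF tot, of int] by (simp add: algebra_simps)
  also have "\<dots> \<le> (\<Sum>x\<in>l. int t * (int d - 1) - (int t + int d - 1) * (int (full_mult x) - 1) + (\<Sum>g\<in>{g\<in>nbrs l. x \<in> g}. int (card (nbrs g))))"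
    by (rule sum_mono) (rule point)
  also have "\<dots> = (int s + 1) * (int t * (int d - 1)) - (int t + int d - 1) * int (card (nbrs l)) + (\<Sum>g\<in>nbrs l. int (card (nbrs g)))"
    unfolding sum.distrib swap card_nbrs[OF l] using card_line[OF lL] by (simp add: sum_subtractf sum_distrib_left[symmetric])
  also have "(\<Sum>g\<in>nbrs l. int (card (nbrs g))) \<le> (\<Sum>g\<in>nbrs l. int (card full) - 1)"
  proof (rule sum_mono)
    fix g assume "g \<in> nbrs l"
    then have "nbrs g \<subseteq> full - {g}" "g \<in> full" by (auto simp: nbrs_def)
    then have "card (nbrs g) \<le> card full - 1" "card full \<noteq> 0"
      using card_mono[of "full - {g}" "nbrs g"] by auto
    then show "int (card (nbrs g)) \<le> int (card full) - 1" by linarith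
  qed
  finally show ?thesis using cfull by (simp add: algebra_simps)
qed

lemma sum_nbrs_bound:
  "int (card full) * ((int s + 1) * (int (card full) - 1 - int t * (int d - 1)))
    \<le> (int s + 1 - int t - int d + int (card full)) * (\<Sum>l\<in>full. int (card (nbrs l)))"
proof -
  have "(\<Sum>l\<in>full. (int s + 1) * (int (card full) - 1 - int t * (int d - 1)))
    \<le> (\<Sum>l\<in>full. (int s + 1 - int t - int d + int (card full)) * int (card (nbrs l)))"
    by (rule sum_mono) (rule nbrs_bound)
  then show ?thesis by (simp add: sum_distrib_left)
qed

text \<open>
  For \<open>d = 1\<close> no two full lines meet, so \<open>nbrs_bound\<close> leaves room for at most one full line.
\<close>

lemma card_hyperplane_le:
  assumes s: "s = t\<^sup>2" and d: "d = 1" and ne: "Lines \<noteq> {}"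
  shows "card Z \<le> t ^ 3 + t"
proof -
  have nb: "card (nbrs l) = 0" if l: "l \<in> full" for l
  proof -
    have "full_mult x = 1" if "x \<in> l" for x
      using full_mult_pos[OF that l] full_mult_le[of x] that l full_line line_subset d by fastforce
    then have "int (card (nbrs l)) = 0" unfolding card_nbrs[OF l] by simp
    then show ?thesis by simp
  qed
  have L: "card full \<le> 1"
  proof (cases "full = {}")
    case False
    then obtain l where l: "l \<in> full" by blast
    have "(int s + 1) * (int (card full) - 1) \<le> 0" using nbrs_bound[OF l] nb[OF l] d by simp
    then have "int (card full) - 1 \<le> 0" by (simp add: mult_le_0_iff)
    then show ?thesis by simp
  qed simp
  have "(\<Sum>l\<in>full. int (card (nbrs l))) = 0" using nb by simp
  then have "(int t + 1) * int (card Z) \<le> ((int t)\<^sup>2 * int t + 1) * (int t + 1) + int (card full) * (int t)\<^sup>2"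
    using point_count[OF ne] unfolding d s by simp
  also have "\<dots> \<le> ((int t)\<^sup>2 * int t + 1) * (int t + 1) + 1 * (int t)\<^sup>2"
    using L by (intro add_left_mono mult_right_mono) auto
  also have "\<dots> < (int t + 1) * (int t ^ 3 + int t + 1)"
    using d_pos d_le by (simp add: algebra_simps power2_eq_square power3_eq_cube)
  finally have "int (card Z) < int t ^ 3 + int t + 1" using mult_less_cancel_left_pos[of "int t + 1"] by simp
  then have "int (card Z) < int (t ^ 3 + t + 1)" by simp
  then show ?thesis by linarith
qed

text \<open>
  Let \<open>L\<close> be the number of full lines and \<open>S\<close> the number of ordered pairs of them that meet. If the bound
  failed, \<open>point_count\<close> would give an upper bound for \<open>S\<close> that is negative unless \<open>L > 3t\<close>.
  Since \<open>L \<le> 3(t + 1)\<close>, three values of \<open>L\<close> remain, and for each of them the lower bound for \<open>S\<close> from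
  \<open>nbrs_bound\<close> exceeds the upper one. With \<open>t = 4 + r\<close> the difference is a polynomial in \<open>r\<close> with positive
  coefficients.
\<close>

lemma card_cubic_le:
  assumes s: "s = t\<^sup>2" and d: "d = 3" and t: "t \<ge> 4" and ne: "Lines \<noteq> {}"
  shows "card Z \<le> 3 * (t ^ 3 + t\<^sup>2 - t)"
proof (rule ccontr)
  define r where "r = int t - 4"
  define L where "L = int (card full)"
  define S where "S = (\<Sum>l\<in>full. int (card (nbrs l)))"
  have r: "r \<ge> 0" "int t = 4 + r" using t by (auto simp: r_def)
  have S0: "S \<ge> 0" unfolding S_def by (intro sum_nonneg) simp
  assume "\<not> ?thesis"
  then have "card Z + 3 * t \<ge> 3 * t ^ 3 + 3 * t\<^sup>2 + 1" by (simp add: algebra_simps)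
  then have "int (card Z + 3 * t) \<ge> int (3 * t ^ 3 + 3 * t\<^sup>2 + 1)" by linarith
  then have "int (card Z) \<ge> 3 * (4 + r) ^ 3 + 3 * (4 + r)\<^sup>2 - 3 * (4 + r) + 1" using r by simp
  then have N: "3 * (5 + r) * int (card Z) \<ge> 3 * (5 + r) * (3 * (4 + r) ^ 3 + 3 * (4 + r)\<^sup>2 - 3 * (4 + r) + 1)"
    using r by (intro mult_left_mono) auto
  have pc: "3 * (5 + r) * int (card Z) + (2 + r) * S
    \<le> 9 * ((4 + r)\<^sup>2 * (4 + r) + 1) * (5 + r) + 3 * L * ((4 + r)\<^sup>2 - 2)"
    using point_count[OF ne] unfolding d s L_def[symmetric] S_def[symmetric] using r by (simp add: algebra_simps)
  have up: "(2 + r) * S \<le> 3 * L * ((4 + r)\<^sup>2 - 2) - 9 * (4 + r) ^ 3 + 15 * (4 + r) + 6"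
    using pc N by (simp add: algebra_simps power2_eq_square power3_eq_cube)
  have low: "L * (((4 + r)\<^sup>2 + 1) * (L - 1 - 2 * (4 + r))) \<le> ((4 + r)\<^sup>2 + 1 - (4 + r) - 3 + L) * S"
    using sum_nbrs_bound unfolding d s L_def[symmetric] S_def[symmetric] using r by (simp add: algebra_simps)
  have Lup: "L \<le> 3 * (5 + r)"
  proof -
    have "int (card full) \<le> int (3 * (t + 1))" using card_full_bound d by (simp only: of_nat_le_iff)
    then show ?thesis using r by (simp add: L_def)
  qed
  have sq: "(4 + r)\<^sup>2 \<ge> 4\<^sup>2" using r by (intro power_mono) auto
  have Llow: "L > 3 * (4 + r)"
  proof (rule ccontr)
    assume "\<not> ?thesis"
    then have "3 * L * ((4 + r)\<^sup>2 - 2) \<le> 3 * (3 * (4 + r)) * ((4 + r)\<^sup>2 - 2)"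
      using sq by (intro mult_right_mono) auto
    then have "(2 + r) * S \<le> - 3 * (4 + r) + 6" using up by (simp add: algebra_simps power2_eq_square power3_eq_cube)
    moreover have "(2 + r) * S \<ge> 0" using r S0 by simp
    ultimately have "- 3 * (4 + r) + 6 \<ge> 0" by (rule order_trans[rotated])
    then show False using r by simp
  qed
  have "(2 + r) * (L * (((4 + r)\<^sup>2 + 1) * (L - 1 - 2 * (4 + r)))) \<le> ((4 + r)\<^sup>2 + 1 - (4 + r) - 3 + L) * ((2 + r) * S)"
    using mult_left_mono[OF low, of "2 + r"] r by (simp add: mult_ac)
  also have "\<dots> \<le> ((4 + r)\<^sup>2 + 1 - (4 + r) - 3 + L) * (3 * L * ((4 + r)\<^sup>2 - 2) - 9 * (4 + r) ^ 3 + 15 * (4 + r) + 6)"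
    using sq r Llow by (intro mult_left_mono[OF up]) auto
  finally have key: "(2 + r) * (L * (((4 + r)\<^sup>2 + 1) * (L - 1 - 2 * (4 + r))))
    \<le> ((4 + r)\<^sup>2 + 1 - (4 + r) - 3 + L) * (3 * L * ((4 + r)\<^sup>2 - 2) - 9 * (4 + r) ^ 3 + 15 * (4 + r) + 6)" .
  have "L = 13 + 3 * r \<or> L = 14 + 3 * r \<or> L = 15 + 3 * r" using Lup Llow by presburger
  then consider "L = 13 + 3 * r" | "L = 14 + 3 * r" | "L = 15 + 3 * r" by blast
  then have "3 * r^5 + 52 * r^4 + 350 * r^3 + 1056 * r^2 + 1167 * r + 60 \<le> 0"
  proof cases
    case 1
    have "3 * r^5 + 52 * r^4 + 350 * r^3 + 1132 * r^2 + 1723 * r + 940 \<le> 0"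
      using key unfolding 1 by (simp add: algebra_simps eval_nat_numeral)
    then show ?thesis using r zero_le_power[of r 2] by linarith
  next
    case 2
    have "3 * r^5 + 53 * r^4 + 354 * r^3 + 1087 * r^2 + 1436 * r + 508 \<le> 0"
      using key unfolding 2 by (simp add: algebra_simps eval_nat_numeral)
    then show ?thesis using r zero_le_power[of r 4] zero_le_power[of r 3] zero_le_power[of r 2] by linarith
  next
    case 3
    have "3 * r^5 + 54 * r^4 + 360 * r^3 + 1056 * r^2 + 1167 * r + 60 \<le> 0"
      using key unfolding 3 by (simp add: algebra_simps eval_nat_numeral)
    then show ?thesis using r zero_le_power[of r 4] zero_le_power[of r 3] by linarith
  qed
  moreover have "3 * r^5 + 52 * r^4 + 350 * r^3 + 1056 * r^2 + 1167 * r \<ge> 0" using r by simp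
  ultimately show False by linarith
qed

text \<open>
  The same elimination of \<open>S\<close> as for cubics; here the five values of \<open>L\<close> from \<open>2t - 2\<close> to
  \<open>2t + 2\<close> have to be excluded.
\<close>

lemma card_quadric_less:
  assumes s: "s = t\<^sup>2" and d: "d = 2" and t: "t \<ge> 4" and ne: "Lines \<noteq> {}"
  shows "card Z + 3 * t < 2 * t ^ 3 + 2 * t\<^sup>2"
proof (rule ccontr)
  define r where "r = int t - 4"
  define L where "L = int (card full)"
  define S where "S = (\<Sum>l\<in>full. int (card (nbrs l)))"
  have r: "r \<ge> 0" "int t = 4 + r" using t by (auto simp: r_def)
  have S0: "S \<ge> 0" unfolding S_def by (intro sum_nonneg) simp
  assume "\<not> ?thesis"
  then have "card Z + 3 * t \<ge> 2 * t ^ 3 + 2 * t\<^sup>2" by simp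
  then have "int (card Z + 3 * t) \<ge> int (2 * t ^ 3 + 2 * t\<^sup>2)" by linarith
  then have "int (card Z) \<ge> 2 * (4 + r) ^ 3 + 2 * (4 + r)\<^sup>2 - 3 * (4 + r)" using r by simp
  then have N: "2 * (5 + r) * int (card Z) \<ge> 2 * (5 + r) * (2 * (4 + r) ^ 3 + 2 * (4 + r)\<^sup>2 - 3 * (4 + r))"
    using r by (intro mult_left_mono) auto
  have pc: "2 * (5 + r) * int (card Z) + (3 + r) * S
    \<le> 4 * ((4 + r)\<^sup>2 * (4 + r) + 1) * (5 + r) + 2 * L * ((4 + r)\<^sup>2 - 1)"
    using point_count[OF ne] unfolding d s L_def[symmetric] S_def[symmetric] using r by (simp add: algebra_simps)
  have up: "(3 + r) * S \<le> (5 + r) * (2 * L * (3 + r) - 4 * (4 + r)\<^sup>2 + 6 * (4 + r) + 4)"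
    using pc N by (simp add: algebra_simps power2_eq_square power3_eq_cube)
  have low: "L * (((4 + r)\<^sup>2 + 1) * (L - 1 - (4 + r))) \<le> ((4 + r)\<^sup>2 + 1 - (4 + r) - 2 + L) * S"
    using sum_nbrs_bound unfolding d s L_def[symmetric] S_def[symmetric] using r by (simp add: algebra_simps)
  have Lup: "L \<le> 2 * (5 + r)"
  proof -
    have "int (card full) \<le> int (2 * (t + 1))" using card_full_bound d by (simp only: of_nat_le_iff)
    then show ?thesis using r by (simp add: L_def)
  qed
  have sq: "(4 + r)\<^sup>2 \<ge> 4\<^sup>2" using r by (intro power_mono) auto
  have Llow: "L \<ge> 2 * (3 + r)"
  proof (rule ccontr)
    assume "\<not> ?thesis"
    then have "2 * L * (3 + r) \<le> 2 * (2 * (3 + r) - 1) * (3 + r)"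
      using r by (intro mult_right_mono) auto
    then have "2 * L * (3 + r) - 4 * (4 + r)\<^sup>2 + 6 * (4 + r) + 4 < 0"
      using r by (simp add: algebra_simps power2_eq_square)
    then have "(5 + r) * (2 * L * (3 + r) - 4 * (4 + r)\<^sup>2 + 6 * (4 + r) + 4) < 0"
      using r by (intro mult_pos_neg) auto
    moreover have "(3 + r) * S \<ge> 0" using r S0 by simp
    ultimately show False using up by linarith
  qed
  have "(3 + r) * (L * (((4 + r)\<^sup>2 + 1) * (L - 1 - (4 + r)))) \<le> ((4 + r)\<^sup>2 + 1 - (4 + r) - 2 + L) * ((3 + r) * S)"
    using mult_left_mono[OF low, of "3 + r"] r by (simp add: mult_ac)
  also have "\<dots> \<le> ((4 + r)\<^sup>2 + 1 - (4 + r) - 2 + L) * ((5 + r) * (2 * L * (3 + r) - 4 * (4 + r)\<^sup>2 + 6 * (4 + r) + 4))"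
    using sq r Llow by (intro mult_left_mono[OF up]) auto
  finally have key: "(3 + r) * (L * (((4 + r)\<^sup>2 + 1) * (L - 1 - (4 + r))))
    \<le> ((4 + r)\<^sup>2 + 1 - (4 + r) - 2 + L) * ((5 + r) * (2 * L * (3 + r) - 4 * (4 + r)\<^sup>2 + 6 * (4 + r) + 4))" .
  have "L = 10 + 2 * r \<or> L = 9 + 2 * r \<or> L = 8 + 2 * r \<or> L = 7 + 2 * r \<or> L = 6 + 2 * r"
    using Lup Llow by presburger
  then consider "L = 10 + 2 * r" | "L = 9 + 2 * r" | "L = 8 + 2 * r" | "L = 7 + 2 * r" | "L = 6 + 2 * r"
    by blast
  then have "2 * r^5 + 32 * r^4 + 204 * r^3 + 620 * r^2 + 740 * r + 30 \<le> 0"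
  proof cases
    case 1
    have "2 * r^5 + 36 * r^4 + 244 * r^3 + 740 * r^2 + 856 * r + 30 \<le> 0"
      using key unfolding 1 by (simp add: algebra_simps eval_nat_numeral)
    then show ?thesis using r zero_le_power[of r 4] zero_le_power[of r 3] zero_le_power[of r 2] by linarith
  next
    case 2
    have "2 * r^5 + 35 * r^4 + 231 * r^3 + 683 * r^2 + 773 * r + 36 \<le> 0"
      using key unfolding 2 by (simp add: algebra_simps eval_nat_numeral)
    then show ?thesis using r zero_le_power[of r 4] zero_le_power[of r 3] zero_le_power[of r 2] by linarith
  next
    case 3
    have "2 * r^5 + 34 * r^4 + 220 * r^3 + 644 * r^2 + 740 * r + 84 \<le> 0"
      using key unfolding 3 by (simp add: algebra_simps eval_nat_numeral)
    then show ?thesis using r zero_le_power[of r 4] zero_le_power[of r 3] zero_le_power[of r 2] by linarith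
  next
    case 4
    have "2 * r^5 + 33 * r^4 + 211 * r^3 + 623 * r^2 + 757 * r + 174 \<le> 0"
      using key unfolding 4 by (simp add: algebra_simps eval_nat_numeral)
    then show ?thesis using r zero_le_power[of r 4] zero_le_power[of r 3] zero_le_power[of r 2] by linarith
  next
    case 5
    have "2 * r^5 + 32 * r^4 + 204 * r^3 + 620 * r^2 + 824 * r + 306 \<le> 0"
      using key unfolding 5 by (simp add: algebra_simps eval_nat_numeral)
    then show ?thesis using r zero_le_power[of r 4] zero_le_power[of r 3] zero_le_power[of r 2] by linarith
  qed
  moreover have "2 * r^5 + 32 * r^4 + 204 * r^3 + 620 * r^2 + 740 * r \<ge> 0" using r by simp
  ultimately show False by linarith
qed

end

section \<open>Forms over the algebraic closure\<close>

text \<open>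
  Homogeneous polynomial functions of degree \<open>d\<close> over the algebraic closure whose coefficients lie in the
  small field. Induction over this generation replaces computations with monomials.
\<close>

inductive form :: "nat \<Rightarrow> ('a::field alg_closure ^ 4 \<Rightarrow> 'a alg_closure) \<Rightarrow> bool" where
  const: "form 0 (\<lambda>_. to_ac c)"
| times_var: "form d f \<Longrightarrow> form (Suc d) (\<lambda>x. x $ i * f x)"
| add: "form d f \<Longrightarrow> form d g \<Longrightarrow> form d (\<lambda>x. f x + g x)"

lemma form_zero: "form d (\<lambda>_. 0)"
proof (induction d)
  case 0 show ?case using form.const[of 0] by simp
next
  case (Suc d) show ?case using form.times_var[OF Suc] by simp
qed

lemma form_cmult: "form d f \<Longrightarrow> form d (\<lambda>x. to_ac c * f x)"
proof (induction rule: form.induct)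
  case (const b) show ?case using form.const[of "c * b"] by simp
next
  case (times_var d f i) show ?case using form.times_var[OF times_var.IH, of i] by (simp add: mult_ac)
next
  case (add d f g) show ?case using form.add[OF add.IH] by (simp add: distrib_left)
qed

lemma form_mult: "form d f \<Longrightarrow> form e g \<Longrightarrow> form (d + e) (\<lambda>x. f x * g x)"
proof (induction rule: form.induct)
  case (const b) then show ?case using form_cmult by simp
next
  case (times_var d f i) show ?case using form.times_var[OF times_var.IH[OF times_var.prems], of i] by (simp add: mult_ac)
next
  case (add d f h) show ?case using form.add[OF add.IH[OF add.prems]] by (simp add: distrib_right)
qed

lemma form_sum: "finite I \<Longrightarrow> (\<And>i. i \<in> I \<Longrightarrow> form d (f i)) \<Longrightarrow> form d (\<lambda>x. \<Sum>i\<in>I. f i x)"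
  by (induction I rule: finite_induct) (auto intro: form_zero form.add)

lemma form_var: "form 1 (\<lambda>x. x $ i)"
  using form.times_var[OF form.const[of 1], of i] by simp

lemma form_one: "form 0 (\<lambda>_. 1)"
  using form.const[of 1] by simp

lemma form_power: "form (k) (\<lambda>x. x $ i ^ k)"
proof (induction k)
  case 0 show ?case using form_one by simp
next
  case (Suc k) show ?case using form.times_var[OF Suc, of i] by simp
qed

lemma form_monomial: "finite I \<Longrightarrow> form (\<Sum>i\<in>I. m i) (\<lambda>x. \<Prod>i\<in>I. x $ i ^ m i)"
proof (induction I rule: finite_induct)
  case empty show ?case using form_one by simp
next
  case (insert i I) show ?case using form_mult[OF form_power[of "m i" i] insert.IH] insert.hyps by simp
qed

lemma form_eval_ac:
  assumes "homogeneous d F" shows "form d (eval_ac F)"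
proof -
  have "form d (\<lambda>x. \<Sum>m\<in>Poly_Mapping.keys F. to_ac (Poly_Mapping.lookup F m) * (\<Prod>i\<in>UNIV. x $ i ^ Poly_Mapping.lookup m i))"
  proof (rule form_sum, simp)
    fix m assume "m \<in> Poly_Mapping.keys F"
    then have "(\<Sum>i\<in>UNIV. Poly_Mapping.lookup m i) = d" using assms by (simp add: homogeneous_def)
    then show "form d (\<lambda>x. to_ac (Poly_Mapping.lookup F m) * (\<Prod>i\<in>UNIV. x $ i ^ Poly_Mapping.lookup m i))"
      using form_cmult[OF form_monomial[of UNIV "Poly_Mapping.lookup m"]] by simp
  qed
  then show ?thesis by (simp add: eval_ac_def[abs_def])
qed

lemma form_scale: "form d f \<Longrightarrow> f (c *s x) = c ^ d * f x"
  by (induction rule: form.induct) (simp_all add: algebra_simps)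

lemma form_comp:
  assumes "\<And>j. form 1 (\<lambda>x. \<sigma> x $ j)"
  shows "form d f \<Longrightarrow> form d (\<lambda>x. f (\<sigma> x))"
proof (induction rule: form.induct)
  case (const b) show ?case by (rule form.const)
next
  case (times_var d f i) show ?case using form_mult[OF assms[of i] times_var.IH] by simp
next
  case (add d f h) show ?case using form.add[OF add.IH] by simp
qed

lemma form_0_const:
  fixes f :: "'a::field alg_closure ^ 4 \<Rightarrow> 'a alg_closure"
  assumes "form 0 f" obtains b where "f = (\<lambda>_. to_ac b)"
proof -
  have "form n f \<Longrightarrow> n = 0 \<Longrightarrow> \<exists>b. f = (\<lambda>_. to_ac b)" for n and f :: "'a alg_closure ^ 4 \<Rightarrow> 'a alg_closure"
  proof (induction rule: form.induct)
    case (add d f g)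
    then obtain a b where "f = (\<lambda>_. to_ac a)" "g = (\<lambda>_. to_ac b)" by auto
    then have "(\<lambda>x. f x + g x) = (\<lambda>_. to_ac (a + b))" by simp
    then show ?case by blast
  qed auto
  from this[OF assms refl] show thesis using that by blast
qed

definition lin :: "'a::field ^ 4 \<Rightarrow> 'a alg_closure ^ 4 \<Rightarrow> 'a alg_closure" where
  "lin c x = (\<Sum>i\<in>UNIV. to_ac (c $ i) * x $ i)"

lemma form_lin: "form 1 (lin c)"
  unfolding lin_def[abs_def] by (intro form_sum form_cmult form_var) simp

lemma lin_add: "lin c (x + y) = lin c x + lin c y"
  and lin_scale: "lin c (a *s x) = a * lin c x"
  by (simp_all add: lin_def sum.distrib sum_distrib_left algebra_simps)

lemma lin_diff: "lin c (x - y) = lin c x - lin c y"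
  by (simp add: lin_def sum_subtractf algebra_simps)

lemma lin_axis: "lin c (axis i a) = to_ac (c $ i) * a"
proof -
  have "lin c (axis i a) = (\<Sum>j\<in>UNIV. if j = i then to_ac (c $ j) * a else 0)"
    unfolding lin_def by (rule sum.cong) (auto simp: axis_def)
  then show ?thesis by simp
qed

lemma form_line_poly:
  assumes "form d f"
  obtains p where "degree p \<le> d" "\<And>t. f (x + t *s y) = poly p t" "coeff p d = f y"
proof -
  from assms have "\<exists>p. degree p \<le> d \<and> (\<forall>t. f (x + t *s y) = poly p t) \<and> coeff p d = f y"
  proof (induction rule: form.induct)
    case (const b) show ?case by (rule exI[of _ "[:to_ac b:]"]) simp
  next
    case (times_var d f i)
    then obtain p where p: "degree p \<le> d" "\<And>t. f (x + t *s y) = poly p t" "coeff p d = f y" by blast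
    have "degree ([:x $ i, y $ i:] * p) \<le> Suc d"
      using degree_mult_le[of "[:x $ i, y $ i:]" p] p(1) by (simp split: if_splits)
    moreover have "coeff p (Suc d) = 0" using p(1) by (intro coeff_eq_0) simp
    ultimately show ?case using p
      by (intro exI[of _ "[:x $ i, y $ i:] * p"]) (auto simp: algebra_simps)
  next
    case (add d f g)
    obtain p where "degree p \<le> d" "\<And>t. f (x + t *s y) = poly p t" "coeff p d = f y"
      using add.IH(1) by blast
    moreover obtain r where "degree r \<le> d" "\<And>t. g (x + t *s y) = poly r t" "coeff r d = g y"
      using add.IH(2) by blast
    ultimately show ?case by (intro exI[of _ "p + r"]) (auto intro: degree_add_le)
  qed
  then show thesis using that by blast
qed

lemma poly_eq_0_if_many_roots:
  fixes p :: "'b::idom poly"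
  assumes "degree p < card R" "\<And>r. r \<in> R \<Longrightarrow> poly p r = 0"
  shows "p = 0"
proof (rule ccontr)
  assume p: "p \<noteq> 0"
  have "card R \<le> card {r. poly p r = 0}"
    using assms(2) poly_roots_finite[OF p] by (intro card_mono) auto
  then show False using card_poly_roots_bound[OF p] assms(1) by simp
qed

lemma card_range_to_ac: "card (range (to_ac :: 'a::{field,finite} \<Rightarrow> _)) = CARD('a)"
  using card_image[OF inj_to_ac] .

text \<open>
  In each coordinate separately the function is a polynomial of degree at most \<open>d\<close> and the small field has more
  than \<open>d\<close> elements, so the coordinates can be released from the small field one at a time.
\<close>

lemma form_vanishing:
  fixes f :: "'a::{field,finite} alg_closure ^ 4 \<Rightarrow> 'a alg_closure"
  assumes f: "form d f" and d: "d < CARD('a)" and van: "\<And>x. f (embed_ac x) = 0"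
  shows "f x = 0"
proof -
  have "finite I \<Longrightarrow> (\<And>i. i \<notin> I \<Longrightarrow> x $ i \<in> range to_ac) \<Longrightarrow> f x = 0" for I x
  proof (induction I arbitrary: x rule: finite_induct)
    case empty
    have "\<exists>a. x $ i = to_ac a" for i using empty[of i] by blast
    then obtain a where "\<And>i. x $ i = to_ac (a i)" by metis
    then have "x = embed_ac (\<chi> i. a i)" by (simp add: embed_ac_def vec_eq_iff)
    then show ?case using van by simp
  next
    case (insert i I)
    define y where "y = (\<chi> j. if j = i then 0 else x $ j)"
    have xy: "x = y + (x $ i) *s axis i 1" by (auto simp: y_def vec_eq_iff axis_def)
    obtain p where p: "degree p \<le> d" "\<And>t. f (y + t *s axis i 1) = poly p t" using form_line_poly[OF f] by metis
    have "p = 0"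
    proof (rule poly_eq_0_if_many_roots)
      show "degree p < card (range (to_ac :: 'a \<Rightarrow> _))" using p(1) d card_range_to_ac by (metis le_less_trans)
      fix t assume t: "t \<in> range (to_ac :: 'a \<Rightarrow> _)"
      have "f (y + t *s axis i 1) = 0"
        by (rule insert.IH) (use insert.prems t in \<open>auto simp: y_def axis_def\<close>)
      then show "poly p t = 0" using p(2) by simp
    qed
    then show ?case using p(2)[of "x $ i"] xy by simp
  qed
  from this[of UNIV x] show ?thesis by simp
qed

text \<open>
  Division with remainder by a linear form with nonzero \<open>i\<close>-th coefficient: the remainder is \<open>f\<close> composed with
  the projection onto the plane along the \<open>i\<close>-th axis.
\<close>

lemma form_divide_lin:
  assumes f: "form n f" and ci: "c $ i \<noteq> (0::'a::field)"
  obtains g where "form (n - 1) g" "\<And>x. f x = lin c x * g x + f (x - axis i (lin c x / to_ac (c $ i)))"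
proof -
  define \<pi> where "\<pi> x = x - axis i (lin c x / to_ac (c $ i))" for x
  have form_pi: "form 1 (\<lambda>x. \<pi> x $ j)" for j
  proof -
    have "form 1 (\<lambda>x. x $ j + to_ac (if j = i then - 1 / c $ i else 0) * lin c x)"
      by (intro form.add form_var form_cmult form_lin)
    also have "(\<lambda>x. x $ j + to_ac (if j = i then - 1 / c $ i else 0) * lin c x) = (\<lambda>x. \<pi> x $ j)"
      by (auto simp: \<pi>_def axis_def)
    finally show ?thesis .
  qed
  from f have "\<exists>g. form (n - 1) g \<and> (n = 0 \<longrightarrow> g = (\<lambda>_. 0)) \<and> (\<forall>x. f x - f (\<pi> x) = lin c x * g x)"
  proof (induction rule: form.induct)
    case (const b) show ?case by (rule exI[of _ "\<lambda>_. 0"]) (simp add: form_zero)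
  next
    case (times_var d f j)
    then obtain g where g: "form (d - 1) g" "d = 0 \<longrightarrow> g = (\<lambda>_. 0)" "\<And>x. f x - f (\<pi> x) = lin c x * g x" by blast
    define b where "b = (if j = i then 1 / c $ i else 0)"
    have "form d (\<lambda>x. x $ j * g x)"
    proof (cases d)
      case 0 then show ?thesis using g(2) form_zero by simp
    next
      case (Suc e) then show ?thesis using form.times_var[OF g(1)] by simp
    qed
    then have h: "form d (\<lambda>x. x $ j * g x + to_ac b * f (\<pi> x))"
      by (intro form.add form_cmult form_comp[OF form_pi times_var.hyps])
    have "x $ j * f x - \<pi> x $ j * f (\<pi> x) = lin c x * (x $ j * g x + to_ac b * f (\<pi> x))" for x
    proof -
      have "x $ j * f x - \<pi> x $ j * f (\<pi> x) = x $ j * (f x - f (\<pi> x)) + (x $ j - \<pi> x $ j) * f (\<pi> x)"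
        by (simp add: algebra_simps)
      also have "x $ j - \<pi> x $ j = lin c x * to_ac b" by (simp add: \<pi>_def b_def axis_def)
      finally show ?thesis unfolding g(3) by (simp add: distrib_left mult_ac)
    qed
    with h show ?case by (intro exI[of _ "\<lambda>x. x $ j * g x + to_ac b * f (\<pi> x)"]) simp
  next
    case (add d f f')
    obtain g where g: "form (d - 1) g" "d = 0 \<longrightarrow> g = (\<lambda>_. 0)" "\<And>x. f x - f (\<pi> x) = lin c x * g x"
      using add.IH(1) by blast
    obtain g' where g': "form (d - 1) g'" "d = 0 \<longrightarrow> g' = (\<lambda>_. 0)" "\<And>x. f' x - f' (\<pi> x) = lin c x * g' x"
      using add.IH(2) by blast
    note h = g g'
    have "f x + f' x - (f (\<pi> x) + f' (\<pi> x)) = lin c x * (g x + g' x)" for x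
      unfolding distrib_left h(3)[symmetric] h(6)[symmetric] by simp
    moreover have "form (d - 1) (\<lambda>x. g x + g' x)" using h(1,4) by (rule form.add)
    moreover have "d = 0 \<longrightarrow> (\<lambda>x. g x + g' x) = (\<lambda>_. 0)" using h(2,5) by simp
    ultimately show ?case by (intro exI[of _ "\<lambda>x. g x + g' x"]) simp
  qed
  then obtain g where "form (n - 1) g" "\<And>x. f x - f (\<pi> x) = lin c x * g x" by blast
  then show thesis using that[of g] unfolding \<pi>_def by (metis diff_add_cancel)
qed

lemma lin_embed: "lin c (embed_ac x) = to_ac (\<Sum>i\<in>UNIV. c $ i * x $ i)"
  by (simp add: lin_def embed_ac_def to_ac_sum)

text \<open>
  The projection maps rational points to rational points of the plane, so the remainder of the division vanishes
  at all rational points and therefore everywhere.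
\<close>

lemma form_factor_lin:
  fixes f :: "'a::{field,finite} alg_closure ^ 4 \<Rightarrow> 'a alg_closure"
  assumes f: "form (Suc d) f" and d: "Suc d < CARD('a)" and c: "c \<noteq> 0"
    and van: "\<And>x. lin c (embed_ac x) = 0 \<Longrightarrow> f (embed_ac x) = 0"
  obtains g where "form d g" "\<And>x. f x = lin c x * g x"
proof -
  obtain i where i: "c $ i \<noteq> 0" using c by (auto simp: vec_eq_iff)
  obtain g where g: "form (Suc d - 1) g" "\<And>x. f x = lin c x * g x + f (x - axis i (lin c x / to_ac (c $ i)))"
    using form_divide_lin[OF f i] by metis
  define h where "h = (\<lambda>x. f x + to_ac (-1) * (lin c x * g x))"
  have "form (1 + d) (\<lambda>x. lin c x * g x)" using form_mult[OF form_lin g(1)[simplified]] .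
  then have fh: "form (Suc d) h" unfolding h_def by (intro form.add f form_cmult) simp
  have "h x = 0" for x
  proof (rule form_vanishing[OF fh d])
    fix x :: "'a ^ 4"
    define a where "a = (\<Sum>i\<in>UNIV. c $ i * x $ i) / c $ i"
    have e: "embed_ac x - axis i (lin c (embed_ac x) / to_ac (c $ i)) = embed_ac (x - axis i a)"
      by (simp add: lin_embed a_def) (simp add: embed_ac_def vec_eq_iff axis_def)
    have "lin c (embed_ac (x - axis i a)) = 0"
      unfolding e[symmetric] using i by (simp add: lin_diff lin_axis)
    then have "f (embed_ac (x - axis i a)) = 0" by (rule van)
    then show "h (embed_ac x) = 0" using g(2)[of "embed_ac x"] e by (simp add: h_def)
  qed
  then have "f x = lin c x * g x" for x by (simp add: h_def eq_neg_iff_add_eq_0)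
  then show thesis using that g(1) by simp
qed

text \<open>
  The polynomial \<open>G\<close> expands \<open>f\<close> at \<open>x\<close> along the lines of a planar pencil: its coefficient at \<open>t\<^sup>s\<close> is a polynomial
  in the slope \<open>u\<close> of degree at most \<open>s\<close>. The line in direction \<open>y\<close> is the one with infinite slope, so the
  expansion \<open>H\<close> along it consists of the top coefficients.
\<close>

lemma form_pencil_poly:
  assumes "form d f"
  obtains G H where "degree G \<le> d" "degree H \<le> d" "\<And>s. degree (coeff G s) \<le> s" "\<And>s. coeff H s = coeff (coeff G s) s"
    "\<And>t u. f (x + t *s (w + u *s y)) = poly (poly G [:t:]) u" "\<And>t. f (x + t *s y) = poly H t"
proof -
  from assms have "\<exists>G H. degree G \<le> d \<and> degree H \<le> d \<and> (\<forall>s. degree (coeff G s) \<le> s \<and> coeff H s = coeff (coeff G s) s) \<and>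
    (\<forall>t u. f (x + t *s (w + u *s y)) = poly (poly G [:t:]) u) \<and> (\<forall>t. f (x + t *s y) = poly H t)"
  proof (induction rule: form.induct)
    case (const b) show ?case
      by (rule exI[of _ "[:[:to_ac b:]:]"], rule exI[of _ "[:to_ac b:]"]) (auto simp: coeff_pCons split: nat.split)
  next
    case (times_var d f i)
    then obtain G H where G: "degree G \<le> d" "degree H \<le> d" "\<And>s. degree (coeff G s) \<le> s" "\<And>s. coeff H s = coeff (coeff G s) s"
      "\<And>t u. f (x + t *s (w + u *s y)) = poly (poly G [:t:]) u" "\<And>t. f (x + t *s y) = poly H t" by blast
    let ?G = "[:[:x $ i:], [:w $ i, y $ i:]:] * G" and ?H = "[:x $ i, y $ i:] * H"
    have dG: "degree ?G \<le> Suc d" "degree ?H \<le> Suc d"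
      using degree_mult_le[of "[:[:x $ i:], [:w $ i, y $ i:]:]" G] degree_mult_le[of "[:x $ i, y $ i:]" H] G(1,2)
      by (auto split: if_splits)
    have cs: "degree (coeff ?G s) \<le> s \<and> coeff ?H s = coeff (coeff ?G s) s" for s
    proof (cases s)
      case 0 then show ?thesis using G(3,4)[of 0] by (auto simp: coeff_pCons)
    next
      case (Suc e)
      have "degree ([:w $ i, y $ i:] * coeff G e) \<le> Suc e"
        using degree_mult_le[of "[:w $ i, y $ i:]" "coeff G e"] G(3)[of e] by (auto split: if_splits)
      moreover have "degree ([:x $ i:] * coeff G s) \<le> s" using G(3)[of s] by (auto intro: le_trans[OF degree_smult_le])
      moreover have "coeff ?G s = [:x $ i:] * coeff G s + [:w $ i, y $ i:] * coeff G e" using Suc by simp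
      ultimately have "degree (coeff ?G s) \<le> s" using Suc by (metis degree_add_le)
      moreover have "coeff (coeff G e) s = 0" using G(3)[of e] Suc by (intro coeff_eq_0) simp
      ultimately show ?thesis using Suc G(4) by (simp add: coeff_pCons)
    qed
    have "(x + t *s (w + u *s y)) $ i * f (x + t *s (w + u *s y)) = poly (poly ?G [:t:]) u" for t u
      using G(5) by (simp add: algebra_simps)
    moreover have "(x + t *s y) $ i * f (x + t *s y) = poly ?H t" for t using G(6) by (simp add: algebra_simps)
    ultimately show ?case using dG cs by (intro exI[of _ ?G] exI[of _ ?H]) blast
  next
    case (add d f g)
    obtain G H where G: "degree G \<le> d" "degree H \<le> d" "\<And>s. degree (coeff G s) \<le> s" "\<And>s. coeff H s = coeff (coeff G s) s"
      "\<And>t u. f (x + t *s (w + u *s y)) = poly (poly G [:t:]) u" "\<And>t. f (x + t *s y) = poly H t"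
      using add.IH(1) by blast
    obtain G' H' where G': "degree G' \<le> d" "degree H' \<le> d" "\<And>s. degree (coeff G' s) \<le> s" "\<And>s. coeff H' s = coeff (coeff G' s) s"
      "\<And>t u. g (x + t *s (w + u *s y)) = poly (poly G' [:t:]) u" "\<And>t. g (x + t *s y) = poly H' t"
      using add.IH(2) by blast
    note h = G G'
    have "degree (G + G') \<le> d" "degree (H + H') \<le> d" using h(1,2,7,8) by (auto intro: degree_add_le)
    moreover have "degree (coeff (G + G') s) \<le> s \<and> coeff (H + H') s = coeff (coeff (G + G') s) s" for s
      using h(3,4,9,10)[of s] by (auto intro: degree_add_le)
    moreover have "f (x + t *s (w + u *s y)) + g (x + t *s (w + u *s y)) = poly (poly (G + G') [:t:]) u" for t u
      using h(5,11)[of t u] by simp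
    moreover have "f (x + t *s y) + g (x + t *s y) = poly (H + H') t" for t
      using h(6,12)[of t] by simp
    ultimately show ?case by (intro exI[of _ "G + G'"] exI[of _ "H + H'"]) blast
  qed
  then show thesis using that by blast
qed

text \<open>
  If \<open>f\<close> vanishes on \<open>k\<close> lines of a planar pencil, then each coefficient of \<open>t\<^sup>s\<close> with \<open>s < k\<close> has more roots \<open>u\<close>
  than its degree allows. So these coefficients vanish, along every line of the pencil, and if \<open>k\<close> exceeds
  the degree of \<open>f\<close> then nothing is left.
\<close>

lemma form_lines_through_point:
  fixes f :: "'a::{field,finite} alg_closure ^ 4 \<Rightarrow> 'a alg_closure"
  assumes f: "form d f" and d: "d < CARD('a)"
    and van: "\<And>t u. u \<in> U \<Longrightarrow> f (x + to_ac t *s (w + u *s y)) = 0"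
  shows form_lines_multiplicity: "\<exists>H. degree H \<le> d \<and> (\<forall>t. f (x + t *s y) = poly H t) \<and> (\<forall>s < card U. coeff H s = 0)"
    and form_lines_plane: "d < card U \<Longrightarrow> f (x + a *s w + b *s y) = 0"
proof -
  obtain G H where G: "degree G \<le> d" "degree H \<le> d" "\<And>s. degree (coeff G s) \<le> s" "\<And>s. coeff H s = coeff (coeff G s) s"
    "\<And>t u. f (x + t *s (w + u *s y)) = poly (poly G [:t:]) u" "\<And>t. f (x + t *s y) = poly H t"
    using form_pencil_poly[OF f] by metis
  \<comment> \<open>for fixed \<open>u\<close>, the polynomial in \<open>t\<close> vanishes on the small field\<close>
  have Gu: "poly (coeff G s) u = 0" if "u \<in> U" for u s
  proof -
    have "map_poly (\<lambda>p. poly p u) G = 0"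
    proof (rule poly_eq_0_if_many_roots)
      have "degree (map_poly (\<lambda>p. poly p u) G) \<le> d" using map_poly_degree_leq[of "\<lambda>p. poly p u" G] G(1) by simp
      then show "degree (map_poly (\<lambda>p. poly p u) G) < card (range (to_ac :: 'a \<Rightarrow> _))"
        using d card_range_to_ac by (metis le_less_trans)
      fix t assume "t \<in> range (to_ac :: 'a \<Rightarrow> _)"
      then have "poly (poly G [:t:]) u = 0" using van that G(5) by auto
      moreover have "poly (poly G [:t:]) u = poly (map_poly (\<lambda>p. poly p u) G) t"
        by (induction G) (simp_all add: map_poly_pCons)
      ultimately show "poly (map_poly (\<lambda>p. poly p u) G) t = 0" by simp
    qed
    then have "coeff (map_poly (\<lambda>p. poly p u) G) s = 0" by simp
    then show ?thesis by (simp add: coeff_map_poly)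
  qed
  have Gs: "coeff G s = 0" if "s < card U" for s
    by (rule poly_eq_0_if_many_roots[of _ U]) (use G(3)[of s] that Gu in auto)
  show "\<exists>H. degree H \<le> d \<and> (\<forall>t. f (x + t *s y) = poly H t) \<and> (\<forall>s < card U. coeff H s = 0)"
    using G(2,4,6) Gs by (intro exI[of _ H]) simp
  assume "d < card U"
  then have "coeff G s = 0" for s using Gs[of s] G(1) by (cases "s \<le> d") (auto intro: coeff_eq_0)
  then have G0: "G = 0" by (simp add: poly_eq_iff)
  then have H0: "H = 0" using G(4) by (simp add: poly_eq_iff)
  show "f (x + a *s w + b *s y) = 0"
  proof (cases "a = 0")
    case True then show ?thesis using G(6)[of b] H0 by simp
  next
    case False
    have e: "x + a *s w + b *s y = x + a *s (w + (b / a) *s y)" using False by (simp add: vec_eq_iff algebra_simps)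
    show ?thesis unfolding e using G(5)[of a "b / a"] G0 by simp
  qed
qed

section \<open>Hermitian forms over a finite field\<close>

text \<open>
  If at most \<open>m\<close> fibres, each with at most \<open>n\<close> elements, cover \<open>m * n\<close> elements, then each of them has exactly \<open>n\<close>.
  This gives the fibres of the trace and of the norm from bounds for the number of roots of polynomials.
\<close>

lemma fibres_full:
  assumes "finite S" "finite T" "f ` S \<subseteq> T" "card T \<le> m" "card S = m * n"
    and le: "\<And>c. c \<in> T \<Longrightarrow> card {a \<in> S. f a = c} \<le> n" and c: "c \<in> T"
  shows "card {a \<in> S. f a = c} = n"
proof (rule ccontr)
  assume "\<not> ?thesis"
  then have lt: "card {a \<in> S. f a = c} < n" using le[OF c] by simp
  have S: "S = (\<Union>b\<in>T. {a \<in> S. f a = b})" using assms(3) by blast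
  have "card S \<le> (\<Sum>b\<in>T. card {a \<in> S. f a = b})"
    by (subst S) (rule card_UN_le[OF assms(2)])
  also have "\<dots> < (\<Sum>b\<in>T. n)"
    using lt le c assms(2) by (intro sum_strict_mono_ex1) auto
  also have "\<dots> \<le> m * n" using assms(4) by simp
  finally show False using assms(5) by simp
qed

lemma card_roots_le:
  fixes p :: "'b::idom poly"
  assumes "p \<noteq> 0" "degree p \<le> n" "\<And>x. x \<in> R \<Longrightarrow> poly p x = 0"
  shows "card R \<le> n"
  using poly_eq_0_if_many_roots[of p R] assms by force

lemma finite_field_power_card:
  fixes x :: "'a::{field,finite}"
  assumes "x \<noteq> 0" shows "x ^ (CARD('a) - 1) = 1"
proof -
  let ?U = "UNIV - {0 :: 'a}"
  have "(\<Prod>y\<in>?U. x * y) = \<Prod>?U"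
    using assms by (intro prod.reindex_bij_witness[of _ "\<lambda>y. y / x" "\<lambda>y. x * y"]) auto
  moreover have "card ?U = CARD('a) - 1" by (simp add: card_Diff_singleton)
  ultimately have "x ^ (CARD('a) - 1) * \<Prod>?U = 1 * \<Prod>?U" by (simp add: prod.distrib)
  moreover have "\<Prod>?U \<noteq> 0" by simp
  ultimately show ?thesis using mult_right_cancel by blast
qed

locale hermitian_space =
  fixes q :: nat and A :: "'a::{field,finite} ^ 4 ^ 4"
  assumes q_primepow: "primepow q" and q_ge: "q \<ge> 4" and card_field: "CARD('a) = q ^ 2"
    and A_inv: "invertible A" and A_herm: "hermitian_matrix q A"
begin

lemma CHAR_dvd_q: "\<exists>n. q = CHAR('a) ^ n" and prime_CHAR: "prime CHAR('a)"
proof -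
  have "CHAR('a) > 0" by (rule finite_imp_CHAR_pos) simp
  then show p: "prime CHAR('a)" by (rule prime_CHAR_semidom)
  obtain r n where r: "prime r" "n > 0" "q = r ^ n" using q_primepow by (auto simp: primepow_def)
  have "CHAR('a) dvd r ^ (n * 2)" using CHAR_dvd_CARD[where 'a='a] card_field r by (simp add: power_mult)
  then have "CHAR('a) dvd r" using p prime_dvd_power by blast
  then have "CHAR('a) = r" using p r primes_dvd_imp_eq by blast
  then show "\<exists>n. q = CHAR('a) ^ n" using r by blast
qed

lemma of_nat_q [simp]: "(of_nat q :: 'a) = 0"
proof -
  obtain n where n: "q = CHAR('a) ^ n" using CHAR_dvd_q by blast
  have "n \<noteq> 0" using n q_ge by (cases n) auto
  then have "CHAR('a) dvd q" using n by (simp add: dvd_power)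
  then show ?thesis by (simp add: of_nat_eq_0_iff_char_dvd)
qed

lemma frob_add: "(x + y :: 'a) ^ q = x ^ q + y ^ q"
  using freshmans_dream'[OF prime_CHAR] CHAR_dvd_q by blast

lemma frob_sum: "(\<Sum>i\<in>I. f i :: 'a) ^ q = (\<Sum>i\<in>I. f i ^ q)"
  using freshmans_dream_sum'[OF prime_CHAR] CHAR_dvd_q by blast

lemma frob_zero [simp]: "(0::'a) ^ q = 0"
  using q_ge by simp

lemma frob_minus: "(- x :: 'a) ^ q = - (x ^ q)"
  using frob_add[of x "- x"] by (simp add: eq_neg_iff_add_eq_0 add.commute)

lemma frob_diff: "(x - y :: 'a) ^ q = x ^ q - y ^ q"
  using frob_add[of x "- y"] by (simp add: frob_minus)

text \<open>
  The exponent \<open>q\<close> defines an automorphism of order two since the field has \<open>q\<^sup>2\<close> elements.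
\<close>

lemma frob_frob [simp]: "((x::'a) ^ q) ^ q = x"
proof (cases "x = 0")
  case False
  have "(x ^ q) ^ q = x ^ Suc (q ^ 2 - 1)" using q_ge by (simp add: power_mult[symmetric] power2_eq_square)
  also have "\<dots> = x" using finite_field_power_card[OF False] card_field by simp
  finally show ?thesis .
qed simp

lemma trace_fibre:
  assumes "(c::'a) ^ q = c" shows "card {u. u + u ^ q = c} = q"
proof -
  have "card {u \<in> UNIV. u + u ^ q = c} = q"
  proof (rule fibres_full[where T = "{c::'a. c ^ q = c}" and m = q])
    show "(\<lambda>u::'a. u + u ^ q) ` UNIV \<subseteq> {c. c ^ q = c}" by (auto simp: frob_add add.commute)
    have d: "degree (monom (1::'a) q + [:0, - 1:]) = q" using q_ge by (subst degree_add_eq_left) (auto simp: degree_monom_eq)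
    show "card {c::'a. c ^ q = c} \<le> q"
      by (rule card_roots_le[of "monom 1 q + [:0, - 1:]"]) (use d q_ge in \<open>auto simp: poly_monom\<close>)
    show "card (UNIV :: 'a set) = q * q" using card_field by (simp add: power2_eq_square)
    fix c :: 'a
    have d: "degree (monom 1 q + [:- c, 1:]) = q" using q_ge by (subst degree_add_eq_left) (auto simp: degree_monom_eq)
    show "card {a \<in> UNIV. a + a ^ q = c} \<le> q"
      by (rule card_roots_le[of "monom 1 q + [:- c, 1:]"]) (use d q_ge in \<open>auto simp: poly_monom\<close>)
  qed (use assms in auto)
  then show ?thesis by simp
qed

lemma trace_surj:
  assumes "(c::'a) ^ q = c" obtains u where "u + u ^ q = c"
proof -
  have "{u. u + u ^ q = c} \<noteq> {}" using trace_fibre[OF assms] q_ge by (intro notI) simp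
  then show thesis using that by blast
qed

lemma norm_surj:
  assumes "(c::'a) ^ q = c" "c \<noteq> 0" obtains u where "u * u ^ q = c"
proof -
  have "card {u \<in> UNIV - {0}. u * u ^ q = c} = q + 1"
  proof (rule fibres_full[where T = "{c::'a. c \<noteq> 0 \<and> c ^ q = c}" and m = "q - 1"])
    show "(\<lambda>u::'a. u * u ^ q) ` (UNIV - {0}) \<subseteq> {c. c \<noteq> 0 \<and> c ^ q = c}"
      by (auto simp: power_mult_distrib mult.commute)
    have d: "degree (monom (1::'a) (q - 1) + [:- 1:]) = q - 1" using q_ge by (subst degree_add_eq_left) (auto simp: degree_monom_eq)
    have "c ^ (q - 1) = 1" if "c ^ q = c" "c \<noteq> 0" for c :: 'a
    proof -
      have "c * c ^ (q - 1) = c * 1" using that q_ge power_Suc[of c "q - 1"] by simp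
      then show ?thesis using that by (metis mult_left_cancel)
    qed
    then show "card {c::'a. c \<noteq> 0 \<and> c ^ q = c} \<le> q - 1"
      by (intro card_roots_le[of "monom 1 (q - 1) + [:- 1:]"]) (use d q_ge in \<open>auto simp: poly_monom\<close>)
    have "card (UNIV - {0::'a}) = q * q - 1" using card_field by (simp add: power2_eq_square card_Diff_singleton)
    also have "\<dots> = (q - 1) * (q + 1)" by (simp add: algebra_simps)
    finally show "card (UNIV - {0::'a}) = (q - 1) * (q + 1)" .
    fix c :: 'a
    have d: "degree (monom 1 (q + 1) + [:- c:]) = q + 1" using q_ge by (subst degree_add_eq_left) (auto simp: degree_monom_eq)
    show "card {a \<in> UNIV - {0}. a * a ^ q = c} \<le> q + 1"
      by (rule card_roots_le[of "monom 1 (q + 1) + [:- c:]"]) (use d q_ge in \<open>auto simp: poly_monom\<close>)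
  qed (use assms in auto)
  then have "{u \<in> UNIV - {0}. u * u ^ q = c} \<noteq> {}"
    by (metis (no_types, lifting) Suc_eq_plus1 card.empty nat.distinct(1))
  then show thesis using that by blast
qed

text \<open>
  The sesquilinear form with matrix \<open>A\<close>; its nonzero isotropic vectors represent the rational points of the
  surface.
\<close>

definition herm :: "'a ^ 4 \<Rightarrow> 'a ^ 4 \<Rightarrow> 'a" where
  "herm x y = (\<Sum>i\<in>UNIV. \<Sum>j\<in>UNIV. A $ i $ j * x $ i * (y $ j) ^ q)"

lemma herm_add_left: "herm (x + y) z = herm x z + herm y z"
  and herm_scale_left: "herm (c *s x) z = c * herm x z"
  and herm_add_right: "herm z (x + y) = herm z x + herm z y"
  and herm_scale_right: "herm z (c *s x) = c ^ q * herm z x"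
  by (simp_all add: herm_def algebra_simps sum.distrib sum_distrib_left frob_add power_mult_distrib)

lemma herm_diff_left: "herm (x - y) z = herm x z - herm y z"
  and herm_diff_right: "herm z (x - y) = herm z x - herm z y"
  by (simp_all add: herm_def algebra_simps sum_subtractf frob_diff)

lemma herm_zero [simp]: "herm 0 z = 0" "herm z 0 = 0"
  by (simp_all add: herm_def)

lemmas herm_simps = herm_add_left herm_add_right herm_scale_left herm_scale_right herm_diff_left herm_diff_right

lemma herm_conj: "herm y x = (herm x y) ^ q"
proof -
  have A: "(A $ i $ j) ^ q = A $ j $ i" for i j
    using arg_cong[OF A_herm[unfolded hermitian_matrix_def], of "\<lambda>M. M $ i $ j"] by (simp add: transpose_def)
  have "(herm x y) ^ q = (\<Sum>i\<in>UNIV. \<Sum>j\<in>UNIV. A $ j $ i * (x $ i) ^ q * y $ j)"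
    by (simp add: herm_def frob_sum power_mult_distrib A)
  also have "\<dots> = (\<Sum>j\<in>UNIV. \<Sum>i\<in>UNIV. A $ j $ i * (x $ i) ^ q * y $ j)" by (rule sum.swap)
  also have "\<dots> = herm y x" by (simp add: herm_def mult_ac)
  finally show ?thesis by simp
qed

lemma herm_sym0: "herm x y = 0 \<longleftrightarrow> herm y x = 0"
proof
  show "herm y x = 0" if "herm x y = 0" using that by (subst herm_conj) simp
  show "herm x y = 0" if "herm y x = 0" using that by (subst herm_conj) simp
qed

lemma herm_self_fixed: "(herm x x) ^ q = herm x x"
  by (rule herm_conj[symmetric])

lemma herm_nondegenerate:
  assumes "x \<noteq> 0" obtains y where "herm x y = 1"
proof -
  have "\<exists>y. herm x y \<noteq> 0"
  proof (rule ccontr)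
    assume "\<not> ?thesis"
    then have z: "herm x y = 0" for y by simp
    have "x v* A = 0"
    proof -
      have "(x v* A) $ j = herm x (axis j 1)" for j
      proof -
        have "herm x (axis j 1) = (\<Sum>i\<in>UNIV. \<Sum>k\<in>UNIV. if k = j then A $ i $ k * x $ i else 0)"
          unfolding herm_def by (intro sum.cong refl) (auto simp: axis_def)
        then show ?thesis by (simp add: vector_matrix_mult_def mult.commute)
      qed
      then show ?thesis using z by (simp add: vec_eq_iff)
    qed
    moreover obtain A' where "A ** A' = mat 1" using A_inv by (auto simp: invertible_def)
    moreover have "(x v* A) v* A' = x v* (A ** A')" by (rule vector_matrix_mul_assoc)
    ultimately have "x = 0" by simp
    then show False using assms by simp
  qed
  then obtain y where y: "herm x y \<noteq> 0" by blast
  have "herm x ((inverse (herm x y)) ^ q *s y) = 1" using y by (simp add: herm_scale_right)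
  then show thesis using that by blast
qed

definition indep2 :: "'a ^ 4 \<Rightarrow> 'a ^ 4 \<Rightarrow> bool" where
  "indep2 u v \<longleftrightarrow> (\<forall>a b. a *s u + b *s v = 0 \<longrightarrow> a = 0 \<and> b = 0)"

definition iso_pair :: "'a ^ 4 \<Rightarrow> 'a ^ 4 \<Rightarrow> bool" where
  "iso_pair u v \<longleftrightarrow> indep2 u v \<and> herm u u = 0 \<and> herm v v = 0 \<and> herm u v = 0"

lemma indep2_nonzero: "indep2 u v \<Longrightarrow> u \<noteq> 0 \<and> v \<noteq> 0"
proof -
  assume i: "indep2 u v"
  have "u \<noteq> 0" using i[unfolded indep2_def, rule_format, of 1 0] by auto
  moreover have "v \<noteq> 0" using i[unfolded indep2_def, rule_format, of 0 1] by auto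
  ultimately show ?thesis by simp
qed

lemma indep2_sym: "indep2 u v \<Longrightarrow> indep2 v u"
  unfolding indep2_def by (metis add.commute)

lemma iso_pair_sym: "iso_pair u v \<Longrightarrow> iso_pair v u"
  unfolding iso_pair_def using indep2_sym herm_sym0 by blast

text \<open>
  The Gram matrix of two orthogonal hyperbolic pairs \<open>(u, r)\<close> and \<open>(v, w)\<close>.
\<close>

definition hyperbolic_basis :: "'a ^ 4 \<Rightarrow> 'a ^ 4 \<Rightarrow> 'a ^ 4 \<Rightarrow> 'a ^ 4 \<Rightarrow> bool" where
  "hyperbolic_basis u r v w \<longleftrightarrow> herm u u = 0 \<and> herm r r = 0 \<and> herm v v = 0 \<and> herm w w = 0 \<and>
     herm u r = 1 \<and> herm r u = 1 \<and> herm v w = 1 \<and> herm w v = 1 \<and>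
     herm u v = 0 \<and> herm v u = 0 \<and> herm u w = 0 \<and> herm w u = 0 \<and> herm r v = 0 \<and> herm v r = 0 \<and> herm r w = 0 \<and> herm w r = 0"

text \<open>
  The Gram matrix makes the coordinates recoverable, so the map from coordinates to vectors is injective,
  hence surjective by finiteness.
\<close>

lemma hyperbolic_expand:
  assumes "hyperbolic_basis u r v w"
  shows "x = herm x r *s u + herm x u *s r + herm x w *s v + herm x v *s w"
proof -
  define \<phi> where "\<phi> z = (z $ 4) *s u + (z $ 1) *s r + (z $ 2) *s v + (z $ 3) *s w" for z :: "'a ^ 4"
  have c: "herm (\<phi> z) r = z $ 4" "herm (\<phi> z) u = z $ 1" "herm (\<phi> z) w = z $ 2" "herm (\<phi> z) v = z $ 3" for z
    using assms by (simp_all add: \<phi>_def hyperbolic_basis_def herm_simps)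
  have "inj \<phi>"
  proof (rule injI)
    fix y z assume "\<phi> y = \<phi> z"
    then have "y $ 4 = z $ 4" "y $ 1 = z $ 1" "y $ 2 = z $ 2" "y $ 3 = z $ 3" using c by metis+
    then show "y = z" by (simp add: vec_eq_iff forall_4)
  qed
  then have "surj \<phi>" by (rule finite_UNIV_inj_surj[rotated]) simp
  then obtain z where "x = \<phi> z" by (metis surjD)
  then show ?thesis using c[of z] by (simp add: \<phi>_def)
qed

text \<open>
  Adding \<open>c *s u\<close> changes \<open>herm y y\<close> by the trace of \<open>c\<close>, and the trace is surjective.
\<close>

lemma make_isotropic:
  assumes "herm u u = 0" "herm u y = 1"
  obtains c where "herm (y + c *s u) (y + c *s u) = 0"
proof -
  have "(- herm y y) ^ q = - herm y y" by (simp add: frob_minus herm_self_fixed)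
  then obtain c where c: "c + c ^ q = - herm y y" using trace_surj by blast
  have "herm y u = 1" using herm_conj[of y u] assms by simp
  then have "herm (y + c *s u) (y + c *s u) = 0" using assms c by (simp add: herm_simps algebra_simps eq_neg_iff_add_eq_0)
  then show thesis using that by blast
qed

text \<open>
  First \<open>r\<close> is chosen dual to \<open>u\<close> and orthogonal to \<open>v\<close>; then \<open>w\<close> is chosen dual to \<open>v\<close> and projected to the
  orthogonal complement of \<open>u\<close> and \<open>r\<close>.
\<close>

lemma extend_hyperbolic:
  assumes "iso_pair u v"
  obtains r w where "hyperbolic_basis u r v w"
proof -
  have iso: "indep2 u v" "herm u u = 0" "herm v v = 0" "herm u v = 0" "herm v u = 0"
    using assms herm_sym0[of u v] by (auto simp: iso_pair_def)
  obtain y1 where y1: "herm v y1 = 1" using herm_nondegenerate indep2_nonzero[OF iso(1)] by blast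
  have "u - herm u y1 *s v \<noteq> 0"
  proof
    assume "u - herm u y1 *s v = 0"
    then have "1 *s u + (- herm u y1) *s v = 0" by (simp add: vec_eq_iff)
    then show False using iso(1) by (metis indep2_def zero_neq_one)
  qed
  then obtain y2 where y2: "herm (u - herm u y1 *s v) y2 = 1" using herm_nondegenerate by blast
  define y where "y = y2 - (herm v y2) ^ q *s y1"
  have y: "herm v y = 0" "herm u y = 1" using y1 y2 by (simp_all add: y_def herm_simps algebra_simps)
  obtain c where c: "herm (y + c *s u) (y + c *s u) = 0" using make_isotropic[OF iso(2) y(2)] by blast
  define r where "r = y + c *s u"
  have r: "herm r r = 0" "herm v r = 0" "herm u r = 1" using c y iso by (simp_all add: r_def herm_simps)
  have r': "herm r v = 0" "herm r u = 1" using r herm_sym0[of v r] herm_conj[of r u] by auto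
  obtain w0 where w0: "herm v w0 = 1" using herm_nondegenerate indep2_nonzero[OF iso(1)] by blast
  define w1 where "w1 = w0 - herm w0 r *s u - herm w0 u *s r"
  have w1: "herm w1 u = 0" "herm w1 r = 0" "herm v w1 = 1"
    using w0 iso r r' by (simp_all add: w1_def herm_simps)
  obtain c where c: "herm (w1 + c *s v) (w1 + c *s v) = 0" using make_isotropic[OF iso(3) w1(3)] by blast
  define w where "w = w1 + c *s v"
  have w: "herm w w = 0" "herm w u = 0" "herm w r = 0" "herm v w = 1"
    using c w1 iso r by (simp_all add: w_def herm_simps)
  have w': "herm u w = 0" "herm r w = 0" "herm w v = 1" using w herm_sym0[of w u] herm_sym0[of w r] herm_conj[of w v] by auto
  show thesis using that[of r w] r r' w w' iso unfolding hyperbolic_basis_def by blast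
qed

lemma exists_outside_span:
  fixes x1 x2 x3 :: "'a ^ 4"
  shows "\<exists>y. \<forall>a b c. y \<noteq> a *s x1 + b *s x2 + c *s x3"
proof -
  define h where "h z = z $ 1 *s x1 + z $ 2 *s x2 + z $ 3 *s x3" for z :: "'a ^ 4"
  have "\<not> inj h"
  proof
    assume "inj h"
    moreover have "h 0 = h (axis 4 1)" by (simp add: h_def axis_def)
    ultimately have "(0 :: 'a ^ 4) = axis 4 1" by (simp add: inj_eq)
    then show False by (metis axis_eq_0_iff zero_neq_one)
  qed
  then have "\<not> surj h" using finite_UNIV_surj_inj[of h] by auto
  then obtain y where y: "y \<notin> range h" by blast
  have "y \<noteq> a *s x1 + b *s x2 + c *s x3" for a b c
  proof -
    have "a *s x1 + b *s x2 + c *s x3 \<in> range h"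
      by (rule range_eqI[of _ h "\<chi> i. if i = 1 then a else if i = 2 then b else c"]) (simp add: h_def)
    then show ?thesis using y by blast
  qed
  then show ?thesis by blast
qed

text \<open>
  Every point of the surface lies on a generator. The complement of a hyperbolic pair \<open>(u, r)\<close> contains two
  orthogonal nonzero vectors \<open>v1\<close> and \<open>v2\<close>; if both are anisotropic then \<open>v2 + c *s v1\<close> is isotropic for a
  suitable \<open>c\<close>, because the norm is surjective.
\<close>

lemma exists_iso_pair:
  assumes u: "u \<noteq> 0" "herm u u = 0"
  obtains v where "iso_pair u v"
proof -
  obtain y where y: "herm u y = 1" using herm_nondegenerate u by blast
  obtain c where c: "herm (y + c *s u) (y + c *s u) = 0" using make_isotropic[OF u(2) y] by blast
  define r where "r = y + c *s u"
  have r: "herm r r = 0" "herm u r = 1" "herm r u = 1"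
    using c y u herm_conj[of "y + c *s u" u] by (simp_all add: r_def herm_simps)
  have pairI: "iso_pair u v" if v: "v \<noteq> 0" "herm v v = 0" "herm v u = 0" "herm v r = 0" for v
  proof -
    have "a = 0 \<and> b = 0" if ab: "a *s u + b *s v = 0" for a b
    proof -
      have "herm (a *s u + b *s v) r = a" using r v by (simp add: herm_simps)
      then have "a = 0" using ab by simp
      moreover have "b *s v = 0" using ab \<open>a = 0\<close> by simp
      ultimately show ?thesis using v by (simp add: vector_mul_eq_0)
    qed
    then show ?thesis using u v herm_sym0[of v u] by (auto simp: iso_pair_def indep2_def)
  qed
  obtain y1 where y1: "\<And>a b c. y1 \<noteq> a *s u + b *s r + c *s 0"
    using exists_outside_span[of u r 0] by blast
  define v1 where "v1 = y1 - herm y1 r *s u - herm y1 u *s r"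
  have v1: "herm v1 u = 0" "herm v1 r = 0" using u r by (simp_all add: v1_def herm_simps)
  have "v1 \<noteq> 0"
  proof
    assume "v1 = 0"
    then have "y1 = herm y1 r *s u + herm y1 u *s r + 0 *s 0"
      by (simp add: v1_def algebra_simps)
    then show False using y1 by blast
  qed
  show thesis
  proof (cases "herm v1 v1 = 0")
    case True then show ?thesis using that pairI[of v1] v1 \<open>v1 \<noteq> 0\<close> by blast
  next
    case False
    define b where "b = herm v1 v1"
    have b: "b \<noteq> 0" "b ^ q = b" using False by (simp_all add: b_def herm_self_fixed)
    obtain y2 where y2: "\<And>a b c. y2 \<noteq> a *s u + b *s r + c *s v1"
    using exists_outside_span[of u r v1] by blast
    define v2 where "v2 = y2 - herm y2 r *s u - herm y2 u *s r - (herm y2 v1 / b) *s v1"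
    have uv: "herm u v1 = 0" "herm r v1 = 0" using v1 herm_sym0[of v1 u] herm_sym0[of v1 r] by auto
    have v2: "herm v2 u = 0" "herm v2 r = 0" "herm v2 v1 = 0"
      using u r v1 uv b by (simp_all add: v2_def herm_simps b_def[symmetric])
    have "v2 \<noteq> 0"
    proof
      assume "v2 = 0"
      then have "y2 = herm y2 r *s u + herm y2 u *s r + (herm y2 v1 / b) *s v1"
        by (simp add: v2_def algebra_simps)
      then show False using y2 by blast
    qed
    show ?thesis
    proof (cases "herm v2 v2 = 0")
      case True then show ?thesis using that pairI[of v2] v2 \<open>v2 \<noteq> 0\<close> by blast
    next
      case False
      have "(- herm v2 v2 / b) ^ q = - herm v2 v2 / b"
        by (simp add: power_divide frob_minus herm_self_fixed b)
      then obtain c where c: "c * c ^ q = - herm v2 v2 / b" using norm_surj False b by (metis divide_eq_0_iff neg_equal_0_iff_equal)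
      define v where "v = v2 + c *s v1"
      have "herm v1 v2 = 0" using v2 herm_sym0 by blast
      have "herm v v = herm v2 v2 + c * c ^ q * b"
        using v2 \<open>herm v1 v2 = 0\<close> by (simp add: v_def herm_simps b_def mult_ac)
      then have "herm v v = 0" using c b by simp
      moreover have "herm v u = 0" "herm v r = 0" using v1 v2 by (simp_all add: v_def herm_simps)
      moreover have "herm v v1 = c * b" using v2 by (simp add: v_def herm_simps b_def)
      moreover have "c \<noteq> 0" using c False b by auto
      ultimately have "v \<noteq> 0" using b by auto
      then show ?thesis using that pairI[of v] \<open>herm v v = 0\<close> \<open>herm v u = 0\<close> \<open>herm v r = 0\<close> by blast
    qed
  qed
qed

end

section \<open>The generalized quadrangle of a Hermitian surface\<close>

definition pt :: "'a::field ^ 4 \<Rightarrow> 'a point3" where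
  "pt x = vec.span {embed_ac x}"

lemma embed_ac_add [simp]: "embed_ac (x + y) = embed_ac x + embed_ac y"
  and embed_ac_scale [simp]: "embed_ac (c *s x) = to_ac c *s embed_ac x"
  and embed_ac_zero [simp]: "embed_ac 0 = 0"
  by (simp_all add: embed_ac_def vec_eq_iff)

lemma embed_ac_eq_iff [simp]: "embed_ac x = embed_ac y \<longleftrightarrow> x = y"
  by (simp add: embed_ac_def vec_eq_iff)

lemma span_single_eq_iff:
  fixes x y :: "'b::field ^ 4"
  assumes "x \<noteq> 0"
  shows "vec.span {x} = vec.span {y} \<longleftrightarrow> (\<exists>c. c \<noteq> 0 \<and> y = c *s x)"
proof
  assume e: "vec.span {x} = vec.span {y}"
  then have "y \<in> vec.span {x}" using vec.span_base[of y "{y}"] by simp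
  then obtain c where c: "y = c *s x" by (auto simp: vec.span_singleton)
  moreover have "c \<noteq> 0"
  proof
    assume "c = 0"
    then have "x \<in> vec.span {0}" using e c vec.span_base[of x "{x}"] by simp
    then show False using assms by (simp add: vec.span_singleton)
  qed
  ultimately show "\<exists>c. c \<noteq> 0 \<and> y = c *s x" by blast
next
  assume "\<exists>c. c \<noteq> 0 \<and> y = c *s x"
  then obtain c where c: "c \<noteq> 0" "y = c *s x" by blast
  then have "x = (1 / c) *s y" by simp
  then have "x \<in> vec.span {y}" using vec.span_scale[of y "{y}" "1 / c"] vec.span_base[of y "{y}"] by simp
  moreover have "y \<in> vec.span {x}" using vec.span_scale[of x "{x}" c] vec.span_base[of x "{x}"] c by simp
  ultimately show "vec.span {x} = vec.span {y}"
    by (intro subset_antisym vec.span_minimal vec.subspace_span) auto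
qed

lemma pt_eq_iff:
  assumes "x \<noteq> 0"
  shows "pt x = pt y \<longleftrightarrow> (\<exists>c. c \<noteq> 0 \<and> y = c *s x)"
proof
  assume "pt x = pt y"
  then obtain c where c: "c \<noteq> 0" "embed_ac y = c *s embed_ac x"
    unfolding pt_def using span_single_eq_iff[of "embed_ac x" "embed_ac y"] assms embed_ac_eq_iff[of x 0] by auto
  obtain i where i: "x $ i \<noteq> 0" using assms by (auto simp: vec_eq_iff)
  have yi: "to_ac (y $ j) = c * to_ac (x $ j)" for j
    using arg_cong[OF c(2), of "\<lambda>z. z $ j"] by (simp add: embed_ac_def)
  then have "c = to_ac (y $ i / x $ i)" using i by (simp add: field_simps)
  then have "embed_ac y = embed_ac ((y $ i / x $ i) *s x)" using c by simp
  then have "y = (y $ i / x $ i) *s x" by (simp only: embed_ac_eq_iff)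
  moreover have "y $ i / x $ i \<noteq> 0" using c \<open>c = to_ac (y $ i / x $ i)\<close> by auto
  ultimately show "\<exists>c. c \<noteq> 0 \<and> y = c *s x" by blast
next
  assume "\<exists>c. c \<noteq> 0 \<and> y = c *s x"
  then obtain c where "c \<noteq> 0" "y = c *s x" by blast
  then show "pt x = pt y"
    unfolding pt_def using span_single_eq_iff[of "embed_ac x" "embed_ac y"] assms embed_ac_eq_iff[of x 0] by force
qed

lemma pt_scale: "x \<noteq> 0 \<Longrightarrow> c \<noteq> 0 \<Longrightarrow> pt (c *s x) = pt x"
  using pt_eq_iff by metis

context hermitian_space
begin

definition points :: "'a point3 set" where
  "points = {pt x | x. x \<noteq> 0 \<and> herm x x = 0}"

definition join :: "'a ^ 4 \<Rightarrow> 'a ^ 4 \<Rightarrow> 'a point3 set" where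
  "join u v = {pt (a *s u + b *s v) | a b. a *s u + b *s v \<noteq> 0}"

definition generators :: "'a point3 set set" where
  "generators = {join u v | u v. iso_pair u v}"

lemma indep2_eq:
  assumes "indep2 u v" "a *s u + b *s v = c *s u + d *s v" shows "a = c \<and> b = d"
proof -
  have "(a - c) *s u + (b - d) *s v = (a *s u + b *s v) - (c *s u + d *s v)"
    by (simp add: vec_eq_iff algebra_simps)
  then have "(a - c) *s u + (b - d) *s v = 0" using assms(2) by simp
  then show ?thesis using assms(1) unfolding indep2_def by (metis eq_iff_diff_eq_0)
qed

lemma indep2_iff_pt:
  assumes "x \<noteq> 0" "y \<noteq> 0" shows "indep2 x y \<longleftrightarrow> pt x \<noteq> pt y"
proof
  assume i: "indep2 x y"
  show "pt x \<noteq> pt y"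
  proof
    assume "pt x = pt y"
    then obtain c where "y = c *s x" using pt_eq_iff assms by blast
    then have "c *s x + (-1) *s y = 0" by (simp add: vec_eq_iff)
    then have "(-1::'a) = 0" using i unfolding indep2_def by blast
    then show False by simp
  qed
next
  assume n: "pt x \<noteq> pt y"
  show "indep2 x y" unfolding indep2_def
  proof (intro allI impI)
    fix a b assume ab: "a *s x + b *s y = 0"
    have "b = 0"
    proof (rule ccontr)
      assume b: "b \<noteq> 0"
      have "y = (1 / b) *s (a *s x + b *s y) + (- a / b) *s x" using b by (simp add: vec_eq_iff field_simps)
      then have y: "y = (- a / b) *s x" using ab by simp
      then have "- a / b \<noteq> 0" using assms by auto
      then show False using n y pt_eq_iff[OF assms(1), of y] by blast
    qed
    then show "a = 0 \<and> b = 0" using ab assms by (simp add: vector_mul_eq_0)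
  qed
qed

lemma pt_in_join:
  assumes "z \<noteq> 0" shows "pt z \<in> join u v \<longleftrightarrow> (\<exists>a b. z = a *s u + b *s v)"
proof
  assume "pt z \<in> join u v"
  then obtain a b where ab: "pt z = pt (a *s u + b *s v)" "a *s u + b *s v \<noteq> 0" by (auto simp: join_def)
  then obtain c where "c \<noteq> 0" "z = c *s (a *s u + b *s v)" using pt_eq_iff[OF ab(2), of z] by metis
  then have "z = (c * a) *s u + (c * b) *s v" by (simp add: vec_eq_iff algebra_simps)
  then show "\<exists>a b. z = a *s u + b *s v" by blast
next
  assume "\<exists>a b. z = a *s u + b *s v"
  then show "pt z \<in> join u v" using assms by (auto simp: join_def)
qed

lemma join_sym: "join u v = join v u"
proof -
  have "join u v \<subseteq> join v u" for u v
  proof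
    fix P assume "P \<in> join u v"
    then obtain a b where "P = pt (a *s u + b *s v)" "a *s u + b *s v \<noteq> 0" by (auto simp: join_def)
    then have "P = pt (b *s v + a *s u)" "b *s v + a *s u \<noteq> 0" by (simp_all add: add.commute[of "b *s v"])
    then show "P \<in> join v u" unfolding join_def by blast
  qed
  then show ?thesis by blast
qed

lemma join_eq_insert:
  assumes "indep2 u v"
  shows "join u v = insert (pt v) (range (\<lambda>t. pt (u + t *s v)))"
proof
  have nz: "u \<noteq> 0" "v \<noteq> 0" using indep2_nonzero[OF assms] by auto
  show "join u v \<subseteq> insert (pt v) (range (\<lambda>t. pt (u + t *s v)))"
  proof
    fix P assume "P \<in> join u v"
    then obtain a b where ab: "P = pt (a *s u + b *s v)" "a *s u + b *s v \<noteq> 0" by (auto simp: join_def)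
    show "P \<in> insert (pt v) (range (\<lambda>t. pt (u + t *s v)))"
    proof (cases "a = 0")
      case True then show ?thesis using ab nz pt_scale[of v b] by auto
    next
      case False
      have e: "a *s u + b *s v = a *s (u + (b / a) *s v)" using False by (simp add: vec_eq_iff field_simps)
      then have "u + (b / a) *s v \<noteq> 0" using ab by auto
      then have "P = pt (u + (b / a) *s v)" using ab e pt_scale False by simp
      then show ?thesis by blast
    qed
  qed
  have "u + t *s v \<noteq> 0" for t
  proof
    assume "u + t *s v = 0"
    then have "1 *s u + t *s v = 0" by simp
    then have "(1::'a) = 0" using assms unfolding indep2_def by blast
    then show False by simp
  qed
  then have "pt (u + t *s v) \<in> join u v" for t
    using pt_in_join[of "u + t *s v" u v] by (metis vector_smult_lid)
  moreover have "pt v \<in> join u v" using pt_in_join[of v u v] nz by (metis add.left_neutral vector_smult_lid vector_smult_lzero)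
  ultimately show "insert (pt v) (range (\<lambda>t. pt (u + t *s v))) \<subseteq> join u v" by blast
qed

lemma affine_nonzero: "indep2 u v \<Longrightarrow> u + t *s v \<noteq> 0"
proof
  assume "indep2 u v" "u + t *s v = 0"
  then have "1 *s u + t *s v = 0 *s u + 0 *s v" by simp
  then show False using indep2_eq[OF \<open>indep2 u v\<close>] zero_neq_one by metis
qed

lemma inj_affine_points: assumes "indep2 u v" shows "inj (\<lambda>t. pt (u + t *s v))"
proof (rule injI)
  fix t t' assume "pt (u + t *s v) = pt (u + t' *s v)"
  then obtain c where "u + t' *s v = c *s (u + t *s v)" using pt_eq_iff affine_nonzero[OF assms] by blast
  then have "1 *s u + t' *s v = c *s u + (c * t) *s v" by (simp add: vec_eq_iff algebra_simps)
  then have "1 = c \<and> t' = c * t" by (rule indep2_eq[OF assms])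
  then show "t = t'" by simp
qed

lemma pt_notin_affine: assumes "indep2 u v" shows "pt v \<noteq> pt (u + t *s v)"
proof
  assume "pt v = pt (u + t *s v)"
  then obtain c where "u + t *s v = c *s v" using pt_eq_iff indep2_nonzero[OF assms] by blast
  then have "1 *s u + t *s v = 0 *s u + c *s v" by simp
  then show False using indep2_eq[OF assms] zero_neq_one by metis
qed

lemma card_join: assumes "indep2 u v" shows "card (join u v) = q\<^sup>2 + 1"
proof -
  have "card (range (\<lambda>t. pt (u + t *s v))) = q\<^sup>2"
    using card_image[OF inj_affine_points[OF assms]] card_field by simp
  moreover have "pt v \<notin> range (\<lambda>t. pt (u + t *s v))" using pt_notin_affine[OF assms] by blast
  ultimately show ?thesis unfolding join_eq_insert[OF assms] by simp
qed

lemma finite_join: "indep2 u v \<Longrightarrow> finite (join u v)"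
  unfolding join_eq_insert by simp

lemma herm_on_join:
  assumes "iso_pair u v" shows "herm (a *s u + b *s v) (c *s u + d *s v) = 0"
  using assms herm_sym0[of u v] by (simp add: iso_pair_def herm_simps)

lemma join_subset_points:
  assumes "iso_pair u v" shows "join u v \<subseteq> points"
  using herm_on_join[OF assms] unfolding join_def points_def by blast

text \<open>
  The two lines have the same number of points, so one inclusion suffices.
\<close>

lemma iso_pair_on_join:
  assumes "iso_pair u v" "x \<noteq> 0" "y \<noteq> 0" "pt x \<in> join u v" "pt y \<in> join u v" "pt x \<noteq> pt y"
  shows "iso_pair x y" "join x y = join u v"
proof -
  obtain a b c d where x: "x = a *s u + b *s v" and y: "y = c *s u + d *s v"
    using assms(4,5) pt_in_join[OF assms(2)] pt_in_join[OF assms(3)] by blast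
  show iso: "iso_pair x y"
    using herm_on_join[OF assms(1)] indep2_iff_pt[OF assms(2,3)] assms(6) unfolding x y iso_pair_def by blast
  have "join x y \<subseteq> join u v"
  proof
    fix P assume "P \<in> join x y"
    then obtain e f where P: "P = pt (e *s x + f *s y)" "e *s x + f *s y \<noteq> 0" by (auto simp: join_def)
    have "e *s x + f *s y = (e * a + f * c) *s u + (e * b + f * d) *s v"
      unfolding x y by (simp add: vec_eq_iff algebra_simps)
    then show "P \<in> join u v" using P pt_in_join by blast
  qed
  then show "join x y = join u v"
    using card_join iso assms(1) finite_join by (intro card_subset_eq) (auto simp: iso_pair_def)
qed

lemma generator_through:
  assumes l: "l \<in> generators" and x: "x \<noteq> 0" "pt x \<in> l"
  obtains y where "iso_pair x y" "l = join x y"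
proof -
  obtain u v where uv: "iso_pair u v" "l = join u v" using l by (auto simp: generators_def)
  have i: "indep2 u v" "u \<noteq> 0" "v \<noteq> 0" using uv(1) indep2_nonzero by (auto simp: iso_pair_def)
  have uj: "pt u \<in> l" "pt v \<in> l" "pt u \<noteq> pt v"
    using join_eq_insert[OF i(1)] join_eq_insert[OF indep2_sym[OF i(1)]] join_sym[of u v] uv indep2_iff_pt i by auto
  obtain y where "y \<noteq> 0" "pt y \<in> l" "pt x \<noteq> pt y" using uj i by metis
  then show thesis using that iso_pair_on_join[of u v x y] uv x by metis
qed

lemma herm_zero_on_generator:
  assumes "l \<in> generators" "x \<noteq> 0" "y \<noteq> 0" "pt x \<in> l" "pt y \<in> l" shows "herm x y = 0"
proof -
  obtain u v where uv: "iso_pair u v" "l = join u v" using assms(1) by (auto simp: generators_def)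
  obtain a b where "x = a *s u + b *s v" using assms(4) uv pt_in_join[OF assms(2)] by blast
  moreover obtain c d where "y = c *s u + d *s v" using assms(5) uv pt_in_join[OF assms(3)] by blast
  ultimately show ?thesis using herm_on_join[OF uv(1)] by simp
qed

lemma join_generator: "iso_pair u v \<Longrightarrow> join u v \<in> generators"
  by (auto simp: generators_def)

lemma pt_in_own_join: assumes "indep2 u v" shows "pt u \<in> join u v" "pt v \<in> join u v"
  using join_eq_insert[OF assms] join_eq_insert[OF indep2_sym[OF assms]] join_sym[of u v] by auto

text \<open>
  The vectors orthogonal to \<open>u\<close> are spanned by \<open>u\<close> and a hyperbolic pair \<open>(v, w)\<close>. Modulo \<open>u\<close> the isotropic
  directions are that of \<open>v\<close> and those of \<open>w + t *s v\<close> with \<open>t\<close> of trace zero, of which there are \<open>q\<close>.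
\<close>

lemma pencil:
  assumes "iso_pair u v"
  obtains w where "\<And>x. herm x u = 0 \<Longrightarrow> \<exists>a b c. x = a *s u + b *s v + c *s w"
    "{l \<in> generators. pt u \<in> l} = insert (join u v) ((\<lambda>t. join u (w + t *s v)) ` {t. t + t ^ q = 0})"
    "inj_on (\<lambda>t. join u (w + t *s v)) {t. t + t ^ q = 0}"
    "join u v \<notin> (\<lambda>t. join u (w + t *s v)) ` {t. t + t ^ q = 0}"
    "\<And>t. t + t ^ q = 0 \<Longrightarrow> iso_pair u (w + t *s v)"
proof -
  obtain r w where h: "hyperbolic_basis u r v w" using extend_hyperbolic[OF assms] by blast
  have hb: "herm u u = 0" "herm v v = 0" "herm u v = 0" "herm v u = 0" "herm w w = 0" "herm v w = 1" "herm w v = 1"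
     "herm u w = 0" "herm w u = 0" "herm u r = 1" "herm v r = 0" "herm w r = 0"
    using h unfolding hyperbolic_basis_def by blast+
  have exp: "\<exists>a b c. x = a *s u + b *s v + c *s w" if "herm x u = 0" for x
  proof -
    have "x = herm x r *s u + herm x w *s v + herm x v *s w"
      using hyperbolic_expand[OF h, of x] that by simp
    then show ?thesis by blast
  qed
  have co: "herm (a *s u + b *s v + c *s w) r = a" "herm (a *s u + b *s v + c *s w) w = b"
    "herm (a *s u + b *s v + c *s w) v = c" for a b c
    using hb by (simp_all add: herm_simps)
  have iso: "iso_pair u (w + t *s v)" if "t + t ^ q = 0" for t
  proof -
    have "indep2 u (w + t *s v)" unfolding indep2_def
    proof (intro allI impI)
      fix a b assume "a *s u + b *s (w + t *s v) = 0"
      then have "a *s u + (b * t) *s v + b *s w = 0" by (simp add: vec_eq_iff algebra_simps)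
      then show "a = 0 \<and> b = 0" using co[of a "b * t" b] by simp
    qed
    moreover have "herm (w + t *s v) (w + t *s v) = t + t ^ q" using hb by (simp add: herm_simps)
    ultimately show ?thesis using hb that by (simp add: iso_pair_def herm_simps)
  qed
  have notin: "join u v \<noteq> join u (w + t *s v)" if t: "t + t ^ q = 0" for t
  proof
    assume e: "join u v = join u (w + t *s v)"
    have i: "indep2 u v" using assms by (simp add: iso_pair_def)
    have "pt v \<in> join u (w + t *s v)" using pt_in_own_join[OF i] e by simp
    then obtain a b where "v = a *s u + b *s (w + t *s v)" using pt_in_join indep2_nonzero[OF i] by blast
    then have "v = a *s u + (b * t) *s v + b *s w" by (simp add: vec_eq_iff algebra_simps)
    then have "herm v v = b" "herm v w = b * t" using co[of a "b * t" b] by metis+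
    then show False using hb by simp
  qed
  have inj: "inj_on (\<lambda>t. join u (w + t *s v)) {t. t + t ^ q = 0}"
  proof (rule inj_onI)
    fix t t' assume t: "t \<in> {t. t + t ^ q = 0}" "t' \<in> {t. t + t ^ q = 0}" and e: "join u (w + t *s v) = join u (w + t' *s v)"
    have i: "indep2 u (w + t *s v)" using iso t by (simp add: iso_pair_def)
    have "pt (w + t *s v) \<in> join u (w + t' *s v)" using pt_in_own_join[OF i] e by simp
    then obtain a b where ab: "w + t *s v = a *s u + b *s (w + t' *s v)" using pt_in_join indep2_nonzero[OF i] by blast
    then have "0 *s u + t *s v + 1 *s w = a *s u + (b * t') *s v + b *s w" by (simp add: vec_eq_iff algebra_simps)
    then have "1 = b" "t = b * t'" using co[of 0 t 1] co[of a "b * t'" b] by metis+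
    then show "t = t'" by simp
  qed
  have set: "{l \<in> generators. pt u \<in> l} = insert (join u v) ((\<lambda>t. join u (w + t *s v)) ` {t. t + t ^ q = 0})"
  proof
    show "insert (join u v) ((\<lambda>t. join u (w + t *s v)) ` {t. t + t ^ q = 0}) \<subseteq> {l \<in> generators. pt u \<in> l}"
      using iso assms join_generator pt_in_own_join unfolding iso_pair_def by blast
    show "{l \<in> generators. pt u \<in> l} \<subseteq> insert (join u v) ((\<lambda>t. join u (w + t *s v)) ` {t. t + t ^ q = 0})"
    proof
      fix l assume l: "l \<in> {l \<in> generators. pt u \<in> l}"
      have u0: "u \<noteq> 0" using assms indep2_nonzero by (auto simp: iso_pair_def)
      obtain y where y: "iso_pair u y" "l = join u y" using generator_through[of l u] l u0 by blast
      have iy: "indep2 u y" using y by (simp add: iso_pair_def)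
      have "herm y u = 0" using y herm_sym0[of u y] by (simp add: iso_pair_def)
      then obtain a b c where abc: "y = a *s u + b *s v + c *s w" using exp by blast
      show "l \<in> insert (join u v) ((\<lambda>t. join u (w + t *s v)) ` {t. t + t ^ q = 0})"
      proof (cases "c = 0")
        case True
        have v0: "v \<noteq> 0" using assms indep2_nonzero by (auto simp: iso_pair_def)
        have b: "b \<noteq> 0"
        proof
          assume "b = 0"
          then have "a *s u + (-1) *s y = 0" using abc True by (simp add: vec_eq_iff)
          then have "(-1::'a) = 0" using iy unfolding indep2_def by blast
          then show False by simp
        qed
        then have "v = (- a / b) *s u + (1 / b) *s y" using abc True by (simp add: vec_eq_iff field_simps)
        then have "pt v \<in> l" using pt_in_join[OF v0] y by blast
        moreover have "pt u \<noteq> pt v" using indep2_iff_pt u0 v0 assms by (simp add: iso_pair_def)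
        ultimately have "join u v = l" using iso_pair_on_join(2)[OF y(1) u0 v0] y l by simp
        then show ?thesis by simp
      next
        case False
        define t where "t = b / c"
        have e: "w + t *s v = (- a / c) *s u + (1 / c) *s y" using abc False by (simp add: t_def vec_eq_iff field_simps)
        have "herm (w + t *s v) (w + t *s v) = 0" unfolding e by (rule herm_on_join[OF y(1)])
        moreover have "herm (w + t *s v) (w + t *s v) = t + t ^ q" using hb by (simp add: herm_simps)
        ultimately have t: "t + t ^ q = 0" by simp
        have w0: "w + t *s v \<noteq> 0" using iso[OF t] indep2_nonzero by (auto simp: iso_pair_def)
        have "pt (w + t *s v) \<in> l" using pt_in_join[OF w0] e y by blast
        moreover have "pt u \<noteq> pt (w + t *s v)" using indep2_iff_pt u0 w0 iso[OF t] by (simp add: iso_pair_def)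
        ultimately have "join u (w + t *s v) = l" using iso_pair_on_join(2)[OF y(1) u0 w0] y l by simp
        then show ?thesis using t by blast
      qed
    qed
  qed
  show thesis using that[OF exp set inj _ iso] notin by blast
qed

text \<open>
  The projection axiom holds because the tangent plane at a point \<open>P\<close> of the surface meets each generator off \<open>P\<close>
  in a single point: otherwise the generator and \<open>P\<close> would span a totally isotropic plane, which does not exist.
\<close>

sublocale generalized_quadrangle points generators "q\<^sup>2" q
proof
  have "points \<subseteq> range pt" by (auto simp: points_def)
  then show "finite points" by (rule finite_subset) simp
next
  fix l assume "l \<in> generators"
  then obtain u v where uv: "iso_pair u v" "l = join u v" by (auto simp: generators_def)
  then show "l \<subseteq> points" "card l = q\<^sup>2 + 1" using join_subset_points card_join by (auto simp: iso_pair_def)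
next
  fix P assume "P \<in> points"
  then obtain u where u: "u \<noteq> 0" "herm u u = 0" "P = pt u" by (auto simp: points_def)
  obtain v where v: "iso_pair u v" using exists_iso_pair[OF u(1,2)] by blast
  obtain w where w: "{l \<in> generators. pt u \<in> l} = insert (join u v) ((\<lambda>t. join u (w + t *s v)) ` {t. t + t ^ q = 0})"
    "inj_on (\<lambda>t. join u (w + t *s v)) {t. t + t ^ q = 0}"
    "join u v \<notin> (\<lambda>t. join u (w + t *s v)) ` {t. t + t ^ q = 0}"
    by (rule pencil[OF v]) (rule that)
  show "card {l \<in> generators. P \<in> l} = q + 1"
    unfolding u(3) w(1) using w(2,3) trace_fibre[of 0] by (simp add: card_image)
next
  fix l m P Q assume a: "l \<in> generators" "m \<in> generators" "P \<in> l" "P \<in> m" "Q \<in> l" "Q \<in> m" "P \<noteq> Q"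
  obtain u v where uv: "iso_pair u v" "l = join u v" using a by (auto simp: generators_def)
  obtain u' v' where uv': "iso_pair u' v'" "m = join u' v'" using a by (auto simp: generators_def)
  obtain x where x: "x \<noteq> 0" "P = pt x" using a(3) uv by (auto simp: join_def)
  obtain y where y: "y \<noteq> 0" "Q = pt y" using a(5) uv by (auto simp: join_def)
  show "l = m" using iso_pair_on_join(2)[OF uv(1) x(1) y(1)] iso_pair_on_join(2)[OF uv'(1) x(1) y(1)] a uv uv' x y by simp
next
  fix P l assume P: "P \<in> points" and l: "l \<in> generators" and off: "P \<notin> l"
  obtain x where x: "x \<noteq> 0" "herm x x = 0" "P = pt x" using P by (auto simp: points_def)
  obtain u v where uv: "iso_pair u v" "l = join u v" using l by (auto simp: generators_def)
  obtain r w where h: "hyperbolic_basis u r v w" using extend_hyperbolic[OF uv(1)] by blast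
  have nz: "herm u x \<noteq> 0 \<or> herm v x \<noteq> 0"
  proof (rule ccontr)
    assume "\<not> ?thesis"
    then have "herm x u = 0" "herm x v = 0" using herm_sym0[of x u] herm_sym0[of x v] by auto
    then have "x = herm x r *s u + herm x w *s v" using hyperbolic_expand[OF h, of x] by simp
    then show False using pt_in_join[OF x(1)] off uv x by blast
  qed
  \<comment> \<open>the point of the line \<open>l\<close> on the tangent plane at \<open>x\<close>\<close>
  define z where "z = herm v x *s u + (- herm u x) *s v"
  have z0: "z \<noteq> 0"
  proof
    assume "z = 0"
    then have "herm v x = 0 \<and> - herm u x = 0" using uv(1) unfolding z_def iso_pair_def indep2_def by blast
    then show False using nz by simp
  qed
  have zx: "herm z x = 0" by (simp add: z_def herm_simps)
  have zl: "pt z \<in> l" using z0 unfolding uv(2) z_def join_def by blast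
  have zP: "pt x \<noteq> pt z" using zl off x by auto
  have zz: "herm z z = 0" unfolding z_def by (rule herm_on_join[OF uv(1)])
  have iso: "iso_pair x z" using indep2_iff_pt[OF x(1) z0] zP x zz zx herm_sym0[of x z] by (simp add: iso_pair_def)
  show "\<exists>!m. m \<in> generators \<and> P \<in> m \<and> m \<inter> l \<noteq> {}"
  proof (rule ex1I[of _ "join x z"])
    have "pt x \<in> join x z" "pt z \<in> join x z" using pt_in_own_join iso by (auto simp: iso_pair_def)
    then show "join x z \<in> generators \<and> P \<in> join x z \<and> join x z \<inter> l \<noteq> {}"
      using join_generator[OF iso] zl x by blast
  next
    fix m assume m: "m \<in> generators \<and> P \<in> m \<and> m \<inter> l \<noteq> {}"
    then obtain R where R: "R \<in> m" "R \<in> l" by blast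
    then obtain a b where ab: "R = pt (a *s u + b *s v)" "a *s u + b *s v \<noteq> 0" using uv by (auto simp: join_def)
    have "herm (a *s u + b *s v) x = 0" using herm_zero_on_generator[of m "a *s u + b *s v" x] m R ab x by simp
    then have eq: "a * herm u x + b * herm v x = 0" by (simp add: herm_simps)
    have "\<exists>c. a *s u + b *s v = c *s z"
    proof (cases "herm v x = 0")
      case True
      then have "a = 0" using eq nz by simp
      then have "a *s u + b *s v = (- b / herm u x) *s z" using nz True by (simp add: z_def vec_eq_iff)
      then show ?thesis by blast
    next
      case False
      then have bi: "b = - (a * herm u x) / herm v x" using eq by (simp add: field_simps eq_neg_iff_add_eq_0 add.commute)
      have "a *s u + b *s v = (a / herm v x) *s z"
        by (subst bi) (use False in \<open>simp add: z_def vec_eq_iff field_simps\<close>)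
      then show ?thesis by blast
    qed
    then obtain c where c: "a *s u + b *s v = c *s z" by blast
    then have "c \<noteq> 0" using ab by auto
    then have Rz: "R = pt z" using ab c pt_scale[OF z0] by simp
    obtain u' v' where uv': "iso_pair u' v'" "m = join u' v'" using m by (auto simp: generators_def)
    show "m = join x z" using iso_pair_on_join(2)[OF uv'(1) x(1) z0] m uv' x Rz R zP by simp
  qed
qed

lemma in_perp_iff:
  assumes "p \<noteq> 0" "herm p p = 0" "x \<noteq> 0"
  shows "pt x \<in> perp (pt p) \<longleftrightarrow> herm x x = 0 \<and> herm x p = 0"
proof
  assume "pt x \<in> perp (pt p)"
  then obtain l where l: "l \<in> generators" "pt p \<in> l" "pt x \<in> l" by (auto simp: perp_def)
  then show "herm x x = 0 \<and> herm x p = 0" using herm_zero_on_generator assms by blast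
next
  assume h: "herm x x = 0 \<and> herm x p = 0"
  show "pt x \<in> perp (pt p)"
  proof (cases "pt p = pt x")
    case True
    obtain v where v: "iso_pair p v" using exists_iso_pair assms by blast
    then have "pt p \<in> join p v" using pt_in_own_join by (simp add: iso_pair_def)
    then show ?thesis using True join_generator[OF v] unfolding perp_def by auto
  next
    case False
    then have iso: "iso_pair p x" using indep2_iff_pt assms h herm_sym0[of x p] by (simp add: iso_pair_def)
    then have "pt p \<in> join p x" "pt x \<in> join p x" using pt_in_own_join by (simp_all add: iso_pair_def)
    then show ?thesis using join_generator[OF iso] unfolding perp_def by blast
  qed
qed

end

section \<open>Sections by surfaces without tangent plane\<close>

text \<open>
  The set \<open>R\<close> is too large for \<open>p\<close> and \<open>h(t - a)\<close> to be different polynomials, so \<open>h\<close> is the expansion of \<open>p\<close>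
  at \<open>a\<close>.
\<close>

lemma shifted_order_ge:
  fixes p h :: "'b::field poly"
  assumes "p \<noteq> 0" "degree p < card R" "degree h < card R" "\<And>t. t \<in> R \<Longrightarrow> poly p t = poly h (t - a)"
    and low: "\<And>s. s < k \<Longrightarrow> coeff h s = 0"
  shows "k \<le> order a p"
proof -
  have "p - pcompose h [:- a, 1:] = 0"
  proof (rule poly_eq_0_if_many_roots)
    have "degree (p - pcompose h [:- a, 1:]) \<le> max (degree p) (degree (pcompose h [:- a, 1:]))"
      by (rule degree_diff_le_max)
    then show "degree (p - pcompose h [:- a, 1:]) < card R" using assms(2,3) by (simp add: degree_pcompose)
    show "poly (p - pcompose h [:- a, 1:]) t = 0" if "t \<in> R" for t
      using assms(4)[OF that] by (simp add: poly_pcompose)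
  qed
  then have p: "p = pcompose h [:- a, 1:]" by simp
  have "monom 1 k dvd h" using low by (simp add: monom_1_dvd_iff')
  then obtain h' where "h = monom 1 k * h'" by (elim dvdE)
  moreover have "pcompose (monom 1 k) [:- a, 1:] = [:- a, 1:] ^ k"
    by (induction k) (simp_all add: monom_0 monom_Suc pcompose_pCons)
  ultimately have "[:- a, 1:] ^ k dvd p" using p by (simp add: pcompose_mult)
  then show ?thesis using assms(1) by (simp add: order_divides)
qed

context hermitian_space
begin

definition locus :: "('a alg_closure ^ 4 \<Rightarrow> 'a alg_closure) \<Rightarrow> 'a point3 set" where
  "locus f = {pt x | x. x \<noteq> 0 \<and> herm x x = 0 \<and> f (embed_ac x) = 0}"

lemma locus_subset: "locus f \<subseteq> points"
  by (auto simp: locus_def points_def)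

lemma pt_in_locus:
  assumes "form d f" "x \<noteq> 0"
  shows "pt x \<in> locus f \<longleftrightarrow> herm x x = 0 \<and> f (embed_ac x) = 0"
proof
  assume "pt x \<in> locus f"
  then obtain y where y: "pt x = pt y" "y \<noteq> 0" "herm y y = 0" "f (embed_ac y) = 0" by (auto simp: locus_def)
  then obtain c where "x = c *s y" using pt_eq_iff[OF y(2), of x] by metis
  then show "herm x x = 0 \<and> f (embed_ac x) = 0" using y form_scale[OF assms(1)] by (simp add: herm_simps)
next
  assume "herm x x = 0 \<and> f (embed_ac x) = 0"
  then show "pt x \<in> locus f" using assms by (auto simp: locus_def)
qed

lemma q_less_card: "q < CARD('a)"
  using q_ge card_field by (simp add: power2_eq_square)

text \<open>
  Generators in the locus through one point, in the coordinates of the pencil in which \<open>join u v\<close> has infinite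
  slope: this is the input for \<open>form_lines_through_point\<close>.
\<close>

lemma full_lines_through:
  assumes "iso_pair u v" and K: "K \<subseteq> {l \<in> generators. l \<subseteq> locus f \<and> pt u \<in> l}" and "join u v \<notin> K"
    and f: "form d f" "d < CARD('a)"
  obtains w U where "\<And>x. herm x u = 0 \<Longrightarrow> \<exists>a b c. x = a *s u + b *s v + c *s w" "card U = card K"
    "\<And>t b. b \<in> U \<Longrightarrow> f (embed_ac u + to_ac t *s (embed_ac w + b *s embed_ac v)) = 0"
proof -
  obtain w where w: "\<And>x. herm x u = 0 \<Longrightarrow> \<exists>a b c. x = a *s u + b *s v + c *s w"
    "{l \<in> generators. pt u \<in> l} = insert (join u v) ((\<lambda>t. join u (w + t *s v)) ` {t. t + t ^ q = 0})"
    "inj_on (\<lambda>t. join u (w + t *s v)) {t. t + t ^ q = 0}"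
    "\<And>t. t + t ^ q = 0 \<Longrightarrow> iso_pair u (w + t *s v)"
    by (rule pencil[OF assms(1)]) (rule that)
  define U where "U = {t. t + t ^ q = 0 \<and> join u (w + t *s v) \<in> K}"
  have "K \<subseteq> {l \<in> generators. pt u \<in> l}" using K by blast
  then have "K = (\<lambda>t. join u (w + t *s v)) ` U" unfolding U_def w(2) using assms(3) by blast
  moreover have "inj_on (\<lambda>t. join u (w + t *s v)) U" using w(3) by (rule inj_on_subset) (auto simp: U_def)
  ultimately have "card (to_ac ` U) = card K"
    by (simp add: card_image inj_on_subset[OF inj_to_ac])
  moreover have "f (embed_ac u + to_ac t *s (embed_ac w + b *s embed_ac v)) = 0" if b: "b \<in> to_ac ` U" for t b
  proof -
    obtain a where a: "a \<in> U" "b = to_ac a" using b by blast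
    let ?y = "w + a *s v"
    have i: "indep2 u ?y" using w(4)[of a] a by (simp add: U_def iso_pair_def)
    have nz: "u + t *s ?y \<noteq> 0" using affine_nonzero[OF i] .
    have "pt (u + t *s ?y) \<in> join u ?y" using pt_in_join[OF nz] by (metis vector_smult_lid)
    moreover have "join u ?y \<subseteq> locus f" using a K by (auto simp: U_def)
    ultimately have "f (embed_ac (u + t *s ?y)) = 0" using pt_in_locus[OF f(1) nz] by blast
    then show ?thesis by (simp add: a(2))
  qed
  ultimately show thesis using that[of w "to_ac ` U"] w(1) by blast
qed

text \<open>
  On a generator \<open>g\<close> outside the locus, with \<open>v\<close> a point where \<open>f\<close> does not vanish, the zeros are the points
  \<open>u + t *s v\<close> with \<open>t\<close> a root of a polynomial of degree \<open>d\<close>. The order of each root is at least the number of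
  generators in the locus through the corresponding point.
\<close>

lemma locus_line_weight:
  assumes f: "form d f" "d \<le> q" and g: "g \<in> generators" "\<not> g \<subseteq> locus f"
  shows "(\<Sum>x\<in>g \<inter> locus f. max 1 (card {l \<in> generators. l \<subseteq> locus f \<and> x \<in> l})) \<le> d"
proof -
  let ?k = "\<lambda>x. card {l \<in> generators. l \<subseteq> locus f \<and> x \<in> l}"
  have dc: "d < CARD('a)" using f(2) q_less_card by simp
  obtain Q where Q: "Q \<in> g" "Q \<notin> locus f" using g by blast
  then have "Q \<in> points" using g line_subset by blast
  then obtain v where v: "v \<noteq> 0" "herm v v = 0" "Q = pt v" by (auto simp: points_def)
  obtain u where u: "iso_pair v u" "g = join v u" using generator_through[of g v] g v Q by blast
  have iso: "iso_pair u v" and gj: "g = join u v" using u iso_pair_sym join_sym by auto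
  have i: "indep2 u v" using iso by (simp add: iso_pair_def)
  have fv: "f (embed_ac v) \<noteq> 0" using Q v pt_in_locus[OF f(1) v(1)] by simp
  obtain p where p: "degree p \<le> d" "\<And>t. f (embed_ac u + t *s embed_ac v) = poly p t" "coeff p d = f (embed_ac v)"
    using form_line_poly[OF f(1), where x = "embed_ac u" and y = "embed_ac v"] by blast
  have p0: "p \<noteq> 0" using p(3) fv by auto
  define T where "T = {t. poly p (to_ac t) = 0}"
  have gT: "g \<inter> locus f = (\<lambda>t. pt (u + t *s v)) ` T"
  proof -
    have "pt (u + t *s v) \<in> locus f \<longleftrightarrow> t \<in> T" for t
    proof -
      have "herm (1 *s u + t *s v) (1 *s u + t *s v) = 0" by (rule herm_on_join[OF iso])
      then show ?thesis using pt_in_locus[OF f(1) affine_nonzero[OF i]] p(2)[of "to_ac t"] by (simp add: T_def)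
    qed
    then show ?thesis using Q v unfolding gj join_eq_insert[OF i] by auto
  qed
  have k: "max 1 (?k (pt (u + t *s v))) \<le> order (to_ac t) p" if t: "t \<in> T" for t
  proof -
    let ?u = "u + t *s v"
    have ne: "pt ?u \<noteq> pt v" using pt_notin_affine[OF i, of t] by simp
    have "pt ?u \<in> g" using gT t by blast
    moreover have "pt v \<in> g" using Q v by simp
    ultimately have iso': "iso_pair ?u v" and j': "join ?u v = g"
      using iso_pair_on_join[OF iso affine_nonzero[OF i] v(1)] ne gj by auto
    let ?K = "{l \<in> generators. l \<subseteq> locus f \<and> pt ?u \<in> l}"
    have notin: "join ?u v \<notin> ?K" using j' g by simp
    obtain w U where "\<And>x. herm x ?u = 0 \<Longrightarrow> \<exists>a b c. x = a *s ?u + b *s v + c *s w" and U: "card U = card ?K"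
      "\<And>t b. b \<in> U \<Longrightarrow> f (embed_ac ?u + to_ac t *s (embed_ac w + b *s embed_ac v)) = 0"
      by (rule full_lines_through[OF iso' subset_refl notin f(1) dc]) (rule that)
    obtain h where h: "degree h \<le> d" "\<And>t. f (embed_ac ?u + t *s embed_ac v) = poly h t" "\<And>s. s < card U \<Longrightarrow> coeff h s = 0"
      using form_lines_multiplicity[OF f(1) dc U(2)] by blast
    have "?k (pt ?u) \<le> order (to_ac t) p"
    proof (rule shifted_order_ge[OF p0])
      show "degree p < card (range (to_ac :: 'a \<Rightarrow> _))" "degree h < card (range (to_ac :: 'a \<Rightarrow> _))"
        using p(1) h(1) dc card_range_to_ac[where 'a = 'a] by simp_all
      show "poly p b = poly h (b - to_ac t)" if "b \<in> range to_ac" for b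
      proof -
        have e: "embed_ac ?u + (b - to_ac t) *s embed_ac v = embed_ac u + b *s embed_ac v"
          by (simp add: vec_eq_iff algebra_simps)
        show ?thesis using p(2)[of b] h(2)[of "b - to_ac t"] unfolding e by simp
      qed
      show "coeff h s = 0" if "s < ?k (pt ?u)" for s using h(3) U(1) that by simp
    qed
    moreover have "order (to_ac t) p \<noteq> 0" using t p0 order_root[of p "to_ac t"] by (simp add: T_def)
    ultimately show ?thesis by simp
  qed
  have "(\<Sum>x\<in>g \<inter> locus f. max 1 (?k x)) = (\<Sum>t\<in>T. max 1 (?k (pt (u + t *s v))))"
    unfolding gT by (rule sum.reindex[unfolded o_def]) (rule inj_on_subset[OF inj_affine_points[OF i]], simp)
  also have "\<dots> \<le> (\<Sum>t\<in>T. order (to_ac t) p)" by (rule sum_mono) (rule k)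
  also have "\<dots> = (\<Sum>b\<in>to_ac ` T. order b p)"
    by (rule sum.reindex[unfolded o_def, symmetric]) (rule inj_on_subset[OF inj_to_ac], simp)
  also have "\<dots> \<le> (\<Sum>b | poly p b = 0. order b p)"
    by (rule sum_mono2) (auto simp: T_def poly_roots_finite[OF p0])
  also have "\<dots> \<le> degree p" by (rule sum_order_le_degree[OF p0])
  finally show ?thesis using p(1) by simp
qed

text \<open>
  Only rational points of the tangent planes are tested. For a form of degree below the size of the field this
  is the same as not vanishing identically on any of these planes.
\<close>

definition tangent_free :: "('a alg_closure ^ 4 \<Rightarrow> 'a alg_closure) \<Rightarrow> bool" where
  "tangent_free f \<longleftrightarrow> (\<forall>p. p \<noteq> 0 \<longrightarrow> herm p p = 0 \<longrightarrow> (\<exists>x. herm x p = 0 \<and> f (embed_ac x) \<noteq> 0))"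

text \<open>
  If \<open>f\<close> vanishes on \<open>d + 1\<close> generators through one point, it vanishes on the whole tangent plane that they
  span. Since \<open>d + 1 \<le> q\<close> there is another generator through this point, which can serve as the one with
  infinite slope.
\<close>

lemma locus_pencil:
  assumes f: "form d f" "d < q" and tf: "tangent_free f" and P: "P \<in> points"
  shows "card {l \<in> generators. l \<subseteq> locus f \<and> P \<in> l} \<le> d"
proof (rule ccontr)
  assume "\<not> ?thesis"
  then have "d + 1 \<le> card {l \<in> generators. l \<subseteq> locus f \<and> P \<in> l}" by simp
  then obtain K where K: "K \<subseteq> {l \<in> generators. l \<subseteq> locus f \<and> P \<in> l}" "card K = d + 1" "finite K"
    by (rule obtain_subset_with_card_n)
  have dc: "d < CARD('a)" using f(2) q_less_card by simp
  obtain u where u: "u \<noteq> 0" "herm u u = 0" "P = pt u" using P by (auto simp: points_def)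
  have "\<not> {l \<in> generators. P \<in> l} \<subseteq> K"
  proof
    assume "{l \<in> generators. P \<in> l} \<subseteq> K"
    then have "card {l \<in> generators. P \<in> l} \<le> card K"
      using K(3) by (intro card_mono)
    then show False using card_pencil[OF P] K(2) f(2) by simp
  qed
  then obtain g where g: "g \<in> generators" "P \<in> g" "g \<notin> K" by blast
  obtain v where v: "iso_pair u v" "g = join u v" using generator_through[of g u] g u by blast
  obtain w U where U: "\<And>x. herm x u = 0 \<Longrightarrow> \<exists>a b c. x = a *s u + b *s v + c *s w" "card U = card K"
      "\<And>t b. b \<in> U \<Longrightarrow> f (embed_ac u + to_ac t *s (embed_ac w + b *s embed_ac v)) = 0"
    by (rule full_lines_through[OF v(1) K(1)[unfolded u(3)] g(3)[unfolded v(2)] f(1) dc]) (rule that)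
  have plane: "f (embed_ac u + a *s embed_ac w + b *s embed_ac v) = 0" for a b
    using form_lines_plane[OF f(1) dc U(3)] U(2) K(2) by simp
  have aff: "f (embed_ac (a *s u + b *s v + c *s w)) = 0" if "a \<noteq> 0" for a b c
  proof -
    have "embed_ac (a *s u + b *s v + c *s w)
      = to_ac a *s (embed_ac u + to_ac (c / a) *s embed_ac w + to_ac (b / a) *s embed_ac v)"
      using that by (simp add: vec_eq_iff field_simps)
    then show ?thesis using plane form_scale[OF f(1)] by simp
  qed
  \<comment> \<open>for \<open>a = 0\<close>: as a polynomial in \<open>a\<close> the value has more than \<open>d\<close> roots\<close>
  have all: "f (embed_ac (a *s u + b *s v + c *s w)) = 0" for a b c
  proof (cases "a = 0")
    case True
    let ?y = "b *s v + c *s w"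
    obtain p where p: "degree p \<le> d" "\<And>t. f (embed_ac ?y + t *s embed_ac u) = poly p t"
      using form_line_poly[OF f(1), where x = "embed_ac ?y" and y = "embed_ac u"] by blast
    have "p = 0"
    proof (rule poly_eq_0_if_many_roots)
      have "card (to_ac ` (UNIV - {0 :: 'a})) = CARD('a) - 1"
        by (subst card_image) (auto intro: inj_on_subset[OF inj_to_ac] simp: card_Diff_singleton)
      then show "degree p < card (to_ac ` (UNIV - {0 :: 'a}))" using p(1) f(2) q_less_card by simp
      fix t assume "t \<in> to_ac ` (UNIV - {0 :: 'a})"
      then obtain e where e: "t = to_ac e" "e \<noteq> 0" by blast
      have "embed_ac ?y + t *s embed_ac u = embed_ac (e *s u + b *s v + c *s w)" by (simp add: e add_ac)
      then show "poly p t = 0" using aff[OF e(2), of b c] p(2)[of t] by (simp only:)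
    qed
    then show ?thesis using True p(2)[of 0] by simp
  next
    case False then show ?thesis by (rule aff)
  qed
  obtain x where "herm x u = 0" "f (embed_ac x) \<noteq> 0" using tf u unfolding tangent_free_def by blast
  then show False using U(1)[of x] all by auto
qed

lemma light_set_locus:
  assumes "form d f" "1 \<le> d" "d < q" "tangent_free f"
  shows "light_set points generators (q\<^sup>2) q (locus f) d"
proof (unfold_locales)
  show "locus f \<subseteq> points" by (rule locus_subset)
  show "1 \<le> d" "d \<le> q" using assms by auto
  show "(\<Sum>x\<in>g \<inter> locus f. max 1 (card {l \<in> generators. l \<subseteq> locus f \<and> x \<in> l})) \<le> d"
    if "g \<in> generators" "\<not> g \<subseteq> locus f" for g
    using locus_line_weight[OF assms(1) _ that] assms(3) by simp
  show "card {l \<in> generators. l \<subseteq> locus f \<and> x \<in> l} \<le> d" if "x \<in> points" for x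
    by (rule locus_pencil[OF assms(1,3,4) that])
qed

end

section \<open>Factorization and the three tangent planes\<close>

lemma eval_ac_single: "eval_ac (Poly_Mapping.single m c) x = to_ac c * (\<Prod>i\<in>UNIV. x $ i ^ Poly_Mapping.lookup m i)"
  by (cases "c = 0") (simp_all add: eval_ac_def)

lemma eval_ac_superset:
  assumes "finite S" "Poly_Mapping.keys F \<subseteq> S"
  shows "eval_ac F x = (\<Sum>m\<in>S. to_ac (Poly_Mapping.lookup F m) * (\<Prod>i\<in>UNIV. x $ i ^ Poly_Mapping.lookup m i))"
  unfolding eval_ac_def using assms by (intro sum.mono_neutral_left) (auto simp: in_keys_iff)

lemma eval_ac_add: "eval_ac (F + G) x = eval_ac F x + eval_ac G x"
proof -
  let ?S = "Poly_Mapping.keys F \<union> Poly_Mapping.keys G"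
  have "Poly_Mapping.keys (F + G) \<subseteq> ?S" by (rule Poly_Mapping.keys_add)
  then show ?thesis
    by (simp add: eval_ac_superset[of ?S] lookup_add algebra_simps sum.distrib)
qed

lemma eval_ac_zero: "eval_ac 0 x = 0"
  by (simp add: eval_ac_def)

lemma eval_ac_sum: "finite I \<Longrightarrow> eval_ac (\<Sum>i\<in>I. F i) x = (\<Sum>i\<in>I. eval_ac (F i) x)"
  by (induction I rule: finite_induct) (simp_all add: eval_ac_zero eval_ac_add)

lemma partial_deriv_superset:
  assumes "finite S" "Poly_Mapping.keys F \<subseteq> S"
  shows "partial_deriv i F = (\<Sum>m\<in>S. Poly_Mapping.single (m - Poly_Mapping.single i 1)
       (of_nat (Poly_Mapping.lookup m i) * Poly_Mapping.lookup F m))"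
  unfolding partial_deriv_def using assms by (intro sum.mono_neutral_left) (auto simp: in_keys_iff)

lemma partial_deriv_add: "partial_deriv i (F + G) = partial_deriv i F + partial_deriv i G"
proof -
  let ?S = "Poly_Mapping.keys F \<union> Poly_Mapping.keys G"
  have "Poly_Mapping.keys (F + G) \<subseteq> ?S" by (rule Poly_Mapping.keys_add)
  then show ?thesis
    by (simp add: partial_deriv_superset[of ?S] lookup_add algebra_simps single_add sum.distrib)
qed

lemma partial_deriv_sum: "finite I \<Longrightarrow> partial_deriv i (\<Sum>j\<in>I. F j) = (\<Sum>j\<in>I. partial_deriv i (F j))"
  by (induction I rule: finite_induct) (simp_all add: partial_deriv_add, simp add: partial_deriv_def)

lemma partial_deriv_single:
  "partial_deriv i (Poly_Mapping.single m c) = Poly_Mapping.single (m - Poly_Mapping.single i 1) (of_nat (Poly_Mapping.lookup m i) * c)"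
  by (cases "c = 0") (simp_all add: partial_deriv_def)

lemma prod_power_single: "(\<Prod>i\<in>UNIV. (x::'b::comm_semiring_1 ^ 4) $ i ^ Poly_Mapping.lookup (Poly_Mapping.single j n) i) = x $ j ^ n"
proof -
  have "(\<Prod>i\<in>UNIV. x $ i ^ Poly_Mapping.lookup (Poly_Mapping.single j n) i) = (\<Prod>i\<in>UNIV. if i = j then x $ j ^ n else 1)"
    by (rule prod.cong) (auto simp: lookup_single when_def)
  then show ?thesis by simp
qed

definition lin_poly :: "'a::field ^ 4 \<Rightarrow> 'a poly4" where
  "lin_poly c = (\<Sum>i\<in>UNIV. Poly_Mapping.single (Poly_Mapping.single i 1) (c $ i))"

lemma eval_lin_poly: "eval_ac (lin_poly c) = lin c"
  by (simp add: fun_eq_iff lin_poly_def lin_def eval_ac_sum eval_ac_single prod_power_single)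

lemma homogeneous_lin_poly: "homogeneous 1 (lin_poly c)"
  unfolding homogeneous_def
proof
  fix m assume "m \<in> Poly_Mapping.keys (lin_poly c)"
  then have "(\<Sum>i\<in>UNIV. Poly_Mapping.lookup (Poly_Mapping.single (Poly_Mapping.single i 1) (c $ i)) m) \<noteq> 0"
    by (simp add: lin_poly_def in_keys_iff lookup_sum)
  then obtain i where "Poly_Mapping.lookup (Poly_Mapping.single (Poly_Mapping.single i (1::nat)) (c $ i)) m \<noteq> 0"
    by (meson sum.not_neutral_contains_not_neutral)
  then have "m = Poly_Mapping.single i 1" by (simp add: lookup_single when_def split: if_splits)
  then show "(\<Sum>i\<in>UNIV. Poly_Mapping.lookup m i) = 1" by (simp add: lookup_single when_def)
qed

definition plane :: "'a::field ^ 4 \<Rightarrow> 'a point3 set" where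
  "plane c = {vec.span {z} | z. z \<noteq> 0 \<and> lin c z = 0}"

lemma zero_set_lin_poly: "zero_set (lin_poly c) = plane c"
  by (simp add: zero_set_def plane_def eval_lin_poly)

lemma lin_eq_zero_imp: "lin c = (\<lambda>_. 0) \<Longrightarrow> c = 0"
proof -
  assume a: "lin c = (\<lambda>_. 0)"
  have "to_ac (c $ i) = 0" for i using lin_axis[of c i 1] a by simp
  then show "c = 0" by (simp add: vec_eq_iff)
qed

lemma is_plane_plane: "c \<noteq> 0 \<Longrightarrow> is_plane (plane c)"
proof -
  assume "c \<noteq> 0"
  then have "lin c \<noteq> (\<lambda>_. 0)" using lin_eq_zero_imp by blast
  moreover have "eval_ac (0 :: 'a poly4) = (\<lambda>_. 0)" by (simp add: fun_eq_iff eval_ac_zero)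
  ultimately have "lin_poly c \<noteq> 0" using eval_lin_poly[of c] by auto
  then show ?thesis unfolding is_plane_def
    using homogeneous_lin_poly[of c] zero_set_lin_poly[of c] by blast
qed

lemma span_in_zero_set_iff:
  fixes F :: "'a::field poly4"
  assumes "z \<noteq> 0" and scale: "\<And>c y. eval_ac F y = 0 \<Longrightarrow> eval_ac F (c *s y) = 0"
  shows "vec.span {z} \<in> zero_set F \<longleftrightarrow> eval_ac F z = 0"
proof
  assume "vec.span {z} \<in> zero_set F"
  then obtain y where y: "vec.span {z} = vec.span {y}" "y \<noteq> 0" "eval_ac F y = 0" by (auto simp: zero_set_def)
  then obtain c where "z = c *s y" using span_single_eq_iff[OF y(2), of z] by metis
  then show "eval_ac F z = 0" using scale y by simp
next
  assume "eval_ac F z = 0" then show "vec.span {z} \<in> zero_set F" using assms(1) by (auto simp: zero_set_def)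
qed

context hermitian_space
begin

lemma eval_hermitian_poly:
  "eval_ac (hermitian_poly q A) z = (\<Sum>i\<in>UNIV. \<Sum>j\<in>UNIV. to_ac (A $ i $ j) * z $ i * z $ j ^ q)"
  by (simp add: hermitian_poly_def eval_ac_sum eval_ac_single lookup_add power_add prod.distrib prod_power_single[unfolded One_nat_def] mult_ac)

lemma eval_hermitian_poly_scale: "eval_ac (hermitian_poly q A) (c *s z) = c * c ^ q * eval_ac (hermitian_poly q A) z"
  by (simp add: eval_hermitian_poly sum_distrib_left power_mult_distrib mult_ac)

lemma eval_hermitian_poly_embed: "eval_ac (hermitian_poly q A) (embed_ac x) = to_ac (herm x x)"
  by (simp add: eval_hermitian_poly herm_def embed_ac_def to_ac_sum)

text \<open>
  Coefficients of the equation \<open>herm x p = 0\<close> of the tangent plane at \<open>p\<close>.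
\<close>

definition tang :: "'a ^ 4 \<Rightarrow> 'a ^ 4" where
  "tang p = (\<chi> i. \<Sum>j\<in>UNIV. A $ i $ j * (p $ j) ^ q)"

lemma lin_tang_embed: "lin (tang p) (embed_ac x) = to_ac (herm x p)"
  by (simp add: lin_embed tang_def herm_def sum_distrib_left sum_distrib_right mult_ac)

lemma tang_nonzero: "p \<noteq> 0 \<Longrightarrow> tang p \<noteq> 0"
proof
  assume "p \<noteq> 0" "tang p = 0"
  obtain y where y: "herm p y = 1" using herm_nondegenerate \<open>p \<noteq> 0\<close> by blast
  have "lin (tang p) (embed_ac y) = 0" by (simp add: \<open>tang p = 0\<close> lin_def)
  then have "herm y p = 0" by (simp add: lin_tang_embed)
  then show False using y herm_sym0[of y p] by simp
qed

text \<open>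
  Only the linear occurrence of the variable \<open>i\<close> contributes, because the derivative of a \<open>q\<close>-th power carries the factor
  \<open>q = 0\<close>.
\<close>

lemma partial_deriv_hermitian:
  "eval_ac (partial_deriv i (hermitian_poly q A)) z = (\<Sum>j\<in>UNIV. to_ac (A $ i $ j) * z $ j ^ q)"
proof -
  have m: "eval_ac (partial_deriv i (Poly_Mapping.single (Poly_Mapping.single k 1 + Poly_Mapping.single j q) (A $ k $ j))) z
     = (if k = i then to_ac (A $ i $ j) * z $ j ^ q else 0)" for k j
  proof (cases "k = i")
    case True
    have "Poly_Mapping.single i (1::nat) + Poly_Mapping.single j q - Poly_Mapping.single i 1 = Poly_Mapping.single j q"
      by simp
    moreover have "of_nat (Poly_Mapping.lookup (Poly_Mapping.single i 1 + Poly_Mapping.single j q) i) = (1::'a)"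
      by (simp add: lookup_add lookup_single when_def)
    ultimately show ?thesis using True
      by (simp only: partial_deriv_single eval_ac_single prod_power_single mult_1 if_True simp_thms)
  next
    case False
    have "(of_nat q :: 'a alg_closure) = to_ac (of_nat q)" by (rule to_ac_of_nat[symmetric])
    also have "\<dots> = 0" by (simp only: of_nat_q to_ac_0)
    finally have "(of_nat q :: 'a alg_closure) = 0" .
    then show ?thesis using False by (simp add: partial_deriv_single eval_ac_single lookup_add lookup_single when_def)
  qed
  have "eval_ac (partial_deriv i (hermitian_poly q A)) z
     = (\<Sum>k\<in>UNIV. \<Sum>j\<in>UNIV. if k = i then to_ac (A $ i $ j) * z $ j ^ q else 0)"
    unfolding hermitian_poly_def by (simp only: partial_deriv_sum eval_ac_sum finite m)
  also have "\<dots> = (\<Sum>k\<in>UNIV. if k = i then (\<Sum>j\<in>UNIV. to_ac (A $ i $ j) * z $ j ^ q) else 0)"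
    by (rule sum.cong) auto
  finally show ?thesis by simp
qed

lemma tangent_space_pt: "tangent_space (hermitian_poly q A) (pt p) = plane (tang p)"
proof -
  have "(\<Sum>i\<in>UNIV. eval_ac (partial_deriv i (hermitian_poly q A)) (c *s embed_ac p) * y $ i) = c ^ q * lin (tang p) y" for c y
    by (simp add: partial_deriv_hermitian lin_def tang_def embed_ac_def to_ac_sum sum_distrib_left sum_distrib_right
        power_mult_distrib mult_ac)
  then have "(\<forall>x\<in>pt p. (\<Sum>i\<in>UNIV. eval_ac (partial_deriv i (hermitian_poly q A)) x * y $ i) = 0) \<longleftrightarrow> lin (tang p) y = 0" for y
    unfolding pt_def vec.span_singleton using q_ge by (auto dest: spec[of _ 1])
  then show ?thesis by (simp add: tangent_space_def plane_def)
qed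

lemma rational_locus:
  assumes "form d (eval_ac F)"
  shows "zero_set F \<inter> zero_set (hermitian_poly q A) \<inter> rational_points = locus (eval_ac F)"
proof -
  have F: "pt x \<in> zero_set F \<longleftrightarrow> eval_ac F (embed_ac x) = 0" if "x \<noteq> 0" for x
    unfolding pt_def using that embed_ac_eq_iff[of x 0]
    by (intro span_in_zero_set_iff) (simp_all add: form_scale[OF assms])
  have H: "pt x \<in> zero_set (hermitian_poly q A) \<longleftrightarrow> herm x x = 0" if "x \<noteq> 0" for x
    unfolding pt_def using that embed_ac_eq_iff[of x 0]
    by (subst span_in_zero_set_iff) (simp_all add: eval_hermitian_poly_scale eval_hermitian_poly_embed)
  have R: "rational_points = {pt x | x :: 'a ^ 4. x \<noteq> 0}" by (simp add: rational_points_def pt_def)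
  show ?thesis
  proof (intro equalityI subsetI)
    fix P assume P: "P \<in> zero_set F \<inter> zero_set (hermitian_poly q A) \<inter> rational_points"
    then obtain x where x: "x \<noteq> 0" "P = pt x" unfolding R by blast
    then show "P \<in> locus (eval_ac F)" using P F[OF x(1)] H[OF x(1)] unfolding locus_def by blast
  next
    fix P assume "P \<in> locus (eval_ac F)"
    then obtain x where x: "x \<noteq> 0" "P = pt x" "herm x x = 0" "eval_ac F (embed_ac x) = 0" unfolding locus_def by blast
    then show "P \<in> zero_set F \<inter> zero_set (hermitian_poly q A) \<inter> rational_points"
      using F[OF x(1)] H[OF x(1)] unfolding R by blast
  qed
qed

lemma locus_tang:
  assumes "p \<noteq> 0" "herm p p = 0"
  shows "locus (lin (tang p)) = perp (pt p)"
proof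
  show "locus (lin (tang p)) \<subseteq> perp (pt p)"
    using in_perp_iff[OF assms] by (auto simp: locus_def lin_tang_embed)
  show "perp (pt p) \<subseteq> locus (lin (tang p))"
  proof
    fix Q assume Q: "Q \<in> perp (pt p)"
    then obtain x where "x \<noteq> 0" "Q = pt x" using perp_subset by (auto simp: points_def)
    then show "Q \<in> locus (lin (tang p))" using Q in_perp_iff[OF assms] by (auto simp: locus_def lin_tang_embed)
  qed
qed

lemma plane_rational:
  assumes "p \<noteq> 0" "herm p p = 0"
  shows "plane (tang p) \<inter> zero_set (hermitian_poly q A) \<inter> rational_points = perp (pt p)"
proof -
  have "form 1 (eval_ac (lin_poly (tang p)))" unfolding eval_lin_poly by (rule form_lin)
  from rational_locus[OF this] show ?thesis
    unfolding eval_lin_poly zero_set_lin_poly locus_tang[OF assms] .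
qed

lemma locus_mult:
  assumes "\<And>x. f x = g x * h x" shows "locus f = locus g \<union> locus h"
proof -
  have "f (embed_ac x) = 0 \<longleftrightarrow> g (embed_ac x) = 0 \<or> h (embed_ac x) = 0" for x by (simp add: assms)
  then show ?thesis unfolding locus_def by blast
qed

lemma tangent_factor:
  assumes f: "form (Suc d) f" "Suc d < CARD('a)" and "\<not> tangent_free f"
  obtains p g where "p \<noteq> 0" "herm p p = 0" "form d g" "\<And>x. f x = lin (tang p) x * g x"
proof -
  obtain p where p: "p \<noteq> 0" "herm p p = 0" "\<And>x. herm x p = 0 \<Longrightarrow> f (embed_ac x) = 0"
    using assms(3) unfolding tangent_free_def by blast
  obtain g where "form d g" "\<And>x. f x = lin (tang p) x * g x"
    by (rule form_factor_lin[OF f tang_nonzero[OF p(1)]]) (use p(3) in \<open>auto simp: lin_tang_embed\<close>)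
  then show thesis using that p by blast
qed

lemma span_pair_iff:
  fixes x y :: "'b::field ^ 4"
  shows "z \<in> vec.span {x, y} \<longleftrightarrow> (\<exists>a b. z = a *s x + b *s y)"
proof -
  have "z \<in> vec.span {x, y} \<longleftrightarrow> (\<exists>a. \<exists>b. z - a *s x = b *s y)"
    by (auto simp: vec.span_breakdown_eq[of z x] vec.span_singleton)
  then show ?thesis by (simp add: diff_eq_eq add.commute)
qed

text \<open>
  If \<open>herm p p'\<close> is not zero, then \<open>p\<close>, \<open>p'\<close> and two independent vectors orthogonal to both form a basis over the small
  field. It remains a generating set over the algebraic closure, since the unit vectors are rational.
\<close>

lemma basis_completion:
  assumes p: "p \<noteq> 0" "herm p p = 0" "p' \<noteq> 0" "herm p' p' = 0" "herm p p' \<noteq> 0"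
    and xy: "indep2 x y" "herm x p = 0" "herm x p' = 0" "herm y p = 0" "herm y p' = 0"
  shows "\<exists>a b c d. z = a *s embed_ac p + b *s embed_ac p' + c *s embed_ac x + d *s embed_ac y"
proof -
  have p'p: "herm p' p \<noteq> 0" using p(5) herm_sym0[of p p'] by simp
  define \<phi> where "\<phi> v = (v $ 1) *s p + (v $ 2) *s p' + (v $ 3) *s x + (v $ 4) *s y" for v :: "'a ^ 4"
  have c: "herm (\<phi> v) p' = v $ 1 * herm p p'" "herm (\<phi> v) p = v $ 2 * herm p' p" for v
    using p xy by (simp_all add: \<phi>_def herm_simps)
  have "inj \<phi>"
  proof (rule injI)
    fix v v' assume e: "\<phi> v = \<phi> v'"
    have 12: "v $ 1 = v' $ 1" "v $ 2 = v' $ 2" using c[of v] c[of v'] e p(5) p'p by simp_all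
    then have "(v $ 3) *s x + (v $ 4) *s y = (v' $ 3) *s x + (v' $ 4) *s y"
      using e by (simp add: \<phi>_def)
    then have "v $ 3 = v' $ 3 \<and> v $ 4 = v' $ 4" by (rule indep2_eq[OF xy(1)])
    then show "v = v'" using 12 by (simp add: vec_eq_iff forall_4)
  qed
  then have "surj \<phi>" by (rule finite_UNIV_inj_surj[rotated]) simp
  let ?B = "{a *s embed_ac p + b *s embed_ac p' + c *s embed_ac x + d *s embed_ac y | a b c d. True}"
  have add: "u + v \<in> ?B" if uv: "u \<in> ?B" "v \<in> ?B" for u v
  proof -
    obtain a b c d a' b' c' d' where "u = a *s embed_ac p + b *s embed_ac p' + c *s embed_ac x + d *s embed_ac y"
       "v = a' *s embed_ac p + b' *s embed_ac p' + c' *s embed_ac x + d' *s embed_ac y" using uv by blast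
    then have "u + v = (a + a') *s embed_ac p + (b + b') *s embed_ac p' + (c + c') *s embed_ac x + (d + d') *s embed_ac y"
      by (simp add: vec_eq_iff algebra_simps)
    then show ?thesis by blast
  qed
  have ax: "e *s embed_ac v \<in> ?B" for e v
  proof -
    obtain w where "v = \<phi> w" using \<open>surj \<phi>\<close> by (metis surjD)
    then have v: "embed_ac v = to_ac (w $ 1) *s embed_ac p + to_ac (w $ 2) *s embed_ac p'
      + to_ac (w $ 3) *s embed_ac x + to_ac (w $ 4) *s embed_ac y"
      by (simp add: \<phi>_def)
    have "e *s embed_ac v = (e * to_ac (w $ 1)) *s embed_ac p + (e * to_ac (w $ 2)) *s embed_ac p'
      + (e * to_ac (w $ 3)) *s embed_ac x + (e * to_ac (w $ 4)) *s embed_ac y"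
      unfolding v by (simp add: vec_eq_iff algebra_simps)
    then show ?thesis by blast
  qed
  have e: "z = z $ 1 *s embed_ac (axis 1 1) + z $ 2 *s embed_ac (axis 2 1) + z $ 3 *s embed_ac (axis 3 1) + z $ 4 *s embed_ac (axis 4 1)"
    by (simp add: vec_eq_iff forall_4 embed_ac_def axis_def)
  have "z \<in> ?B" by (subst e) (intro add ax)
  then show ?thesis by blast
qed

text \<open>
  The two tangent planes have \<open>q + 1\<close> common points on the surface, two of which are used to span the line.
\<close>

lemma planes_meet_in_line:
  assumes p: "p \<noteq> 0" "herm p p = 0" "p' \<noteq> 0" "herm p' p' = 0" and nc: "pt p' \<notin> perp (pt p)"
  shows "is_line (plane (tang p) \<inter> plane (tang p'))"
proof -
  have pp': "herm p p' \<noteq> 0" "herm p' p \<noteq> 0" using nc in_perp_iff[OF p(1,2,3)] p(4) herm_sym0[of p p'] by auto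
  have "pt p \<in> points" "pt p' \<in> points" using p by (auto simp: points_def)
  then have "card (perp (pt p) \<inter> perp (pt p')) = q + 1" using card_perp_Int_noncollinear nc by simp
  then have "\<not> card (perp (pt p) \<inter> perp (pt p')) \<le> 1" using q_ge by simp
  then obtain R S where RS: "R \<in> perp (pt p) \<inter> perp (pt p')" "S \<in> perp (pt p) \<inter> perp (pt p')" "R \<noteq> S"
    using card_le_Suc0_iff_eq[of "perp (pt p) \<inter> perp (pt p')"] by auto
  then have "R \<in> points" "S \<in> points" using perp_subset by blast+
  then obtain x y where xy: "x \<noteq> 0" "R = pt x" "y \<noteq> 0" "S = pt y"
    unfolding points_def by blast
  have h: "herm x p = 0" "herm x p' = 0" "herm y p = 0" "herm y p' = 0"
    using RS xy in_perp_iff[OF p(1,2)] in_perp_iff[OF p(3,4)] by auto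
  have i: "indep2 x y" using indep2_iff_pt[OF xy(1,3)] RS(3) xy by simp
  have iff: "lin (tang p) z = 0 \<and> lin (tang p') z = 0 \<longleftrightarrow> z \<in> vec.span {embed_ac x, embed_ac y}" for z
  proof
    assume z: "lin (tang p) z = 0 \<and> lin (tang p') z = 0"
    obtain a b c d where e: "z = a *s embed_ac p + b *s embed_ac p' + c *s embed_ac x + d *s embed_ac y"
      using basis_completion[OF p pp'(1) i h] by blast
    have "lin (tang p) z = b * to_ac (herm p' p)" "lin (tang p') z = a * to_ac (herm p p')"
      using h p unfolding e by (simp_all add: lin_add lin_scale lin_tang_embed)
    then have "a = 0" "b = 0" using z pp' by auto
    then show "z \<in> vec.span {embed_ac x, embed_ac y}" unfolding span_pair_iff using e by auto
  next
    assume "z \<in> vec.span {embed_ac x, embed_ac y}"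
    then show "lin (tang p) z = 0 \<and> lin (tang p') z = 0"
      unfolding span_pair_iff using h by (auto simp: lin_add lin_scale lin_tang_embed)
  qed
  have "plane (tang p) \<inter> plane (tang p') = {vec.span {z} | z. z \<noteq> 0 \<and> lin (tang p) z = 0 \<and> lin (tang p') z = 0}"
  proof -
    have "lin c y = 0" if "vec.span {z} = vec.span {y}" "z \<noteq> 0" "lin c z = 0" for c :: "'a ^ 4" and y z
      using that span_single_eq_iff[of z y] by (auto simp: lin_scale)
    then have lin0: "lin (tang p') z = 0" if "vec.span {z} = vec.span {y}" "y \<noteq> 0" "lin (tang p') y = 0" for y z
      using that by metis
    show ?thesis unfolding plane_def
    proof (intro equalityI subsetI)
      fix E assume "E \<in> {vec.span {z} |z. z \<noteq> 0 \<and> lin (tang p) z = 0} \<inter> {vec.span {z} |z. z \<noteq> 0 \<and> lin (tang p') z = 0}"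
      then obtain z y where "E = vec.span {z}" "z \<noteq> 0" "lin (tang p) z = 0" "vec.span {z} = vec.span {y}" "y \<noteq> 0" "lin (tang p') y = 0"
        by blast
      then show "E \<in> {vec.span {z} |z. z \<noteq> 0 \<and> lin (tang p) z = 0 \<and> lin (tang p') z = 0}" using lin0 by blast
    qed blast
  qed
  also have "\<dots> = {vec.span {z} | z. z \<noteq> 0 \<and> z \<in> vec.span {embed_ac x, embed_ac y}}" using iff by simp
  finally show ?thesis unfolding is_line_def using xy RS(3) unfolding pt_def by blast
qed

lemma card_locus_cubic_le:
  assumes "form 3 f" "tangent_free f" "generators \<noteq> {}"
  shows "card (locus f) \<le> 3 * (q ^ 3 + q\<^sup>2 - q)"
proof -
  interpret light_set points generators "q\<^sup>2" q "locus f" 3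
    using light_set_locus[OF assms(1) _ _ assms(2)] q_ge by simp
  show ?thesis using card_cubic_le[OF refl refl q_ge assms(3)] .
qed

lemma card_locus_quadric_less:
  assumes "form 2 f" "tangent_free f" "generators \<noteq> {}"
  shows "card (locus f) + 3 * q < 2 * q ^ 3 + 2 * q\<^sup>2"
proof -
  interpret light_set points generators "q\<^sup>2" q "locus f" 2
    using light_set_locus[OF assms(1) _ _ assms(2)] q_ge by simp
  show ?thesis using card_quadric_less[OF refl refl q_ge assms(3)] .
qed

lemma card_locus_plane_le:
  assumes "form 1 f" "tangent_free f" "generators \<noteq> {}"
  shows "card (locus f) \<le> q ^ 3 + q"
proof -
  interpret light_set points generators "q\<^sup>2" q "locus f" 1
    using light_set_locus[OF assms(1) _ _ assms(2)] q_ge by simp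
  show ?thesis using card_hyperplane_le[OF refl refl assms(3)] .
qed

lemma card_tangent_section:
  assumes "P \<in> points" shows "card (perp P) = q ^ 3 + q\<^sup>2 + 1"
  using card_perp[OF assms] by (simp add: algebra_simps power2_eq_square power3_eq_cube)

text \<open>
  Tangent planes split off one at a time. After each step the remaining factor has too few points to do without
  a tangent plane; the overlap of the first two sections is needed in the last step. The constant \<open>b\<close> is not
  zero since otherwise the cubic would contain all points of the surface.
\<close>

theorem cubic_factors_into_tangent_planes:
  assumes f: "form 3 f" and N: "card (locus f) = 3 * (q ^ 3 + q\<^sup>2 - q) + 1"
  obtains p1 p2 p3 b where "p1 \<noteq> 0" "herm p1 p1 = 0" "p2 \<noteq> 0" "herm p2 p2 = 0" "p3 \<noteq> 0" "herm p3 p3 = 0" "b \<noteq> 0"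
    "\<And>x. f x = lin (tang p1) x * (lin (tang p2) x * (lin (tang p3) x * to_ac b))"
proof -
  have q2: "q\<^sup>2 \<ge> 4 * q" using q_ge by (simp add: power2_eq_square)
  have q3: "q ^ 3 \<ge> 4 * q\<^sup>2" using q_ge by (simp add: power2_eq_square power3_eq_cube)
  have N': "card (locus f) + 3 * q = 3 * (q ^ 3 + q\<^sup>2) + 1"
  proof -
    have "q \<le> q ^ 3 + q\<^sup>2" using q2 by simp
    then show ?thesis unfolding N by (simp add: algebra_simps diff_mult_distrib2)
  qed
  have "locus f \<noteq> {}" using N by (intro notI) simp
  then obtain P where "P \<in> points" using locus_subset by blast
  then obtain u where "u \<noteq> 0" "herm u u = 0" by (auto simp: points_def)
  then obtain v where "iso_pair u v" by (rule exists_iso_pair)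
  then have gens: "generators \<noteq> {}" using join_generator by blast
  have dc: "Suc d < CARD('a)" if "d \<le> 3" for d
    using that q_less_card q_ge by simp
  have "\<not> tangent_free f" using card_locus_cubic_le[OF f _ gens] N by auto
  moreover have "form (Suc 2) f" using f by (simp add: numeral_3_eq_3)
  ultimately obtain p1 g where p1: "p1 \<noteq> 0" "herm p1 p1 = 0" and g: "form 2 g" "\<And>x. f x = lin (tang p1) x * g x"
    using tangent_factor[of 2 f] dc[of 2] by auto
  have P1: "pt p1 \<in> points" using p1 by (auto simp: points_def)
  have lf: "locus f = perp (pt p1) \<union> locus g" using locus_mult[of f, OF g(2)] locus_tang[OF p1] by simp
  have "\<not> tangent_free g"
  proof
    assume "tangent_free g"
    then have 1: "card (locus g) + 3 * q < 2 * q ^ 3 + 2 * q\<^sup>2" by (rule card_locus_quadric_less[OF g(1) _ gens])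
    have 2: "card (locus f) \<le> (q ^ 3 + q\<^sup>2 + 1) + card (locus g)"
      unfolding lf using card_Un_le[of "perp (pt p1)" "locus g"] card_tangent_section[OF P1] by simp
    have "\<lbrakk>g + 3 * q < 2 * a + 2 * b; n \<le> (a + b + 1) + g; n + 3 * q = 3 * (a + b) + 1\<rbrakk> \<Longrightarrow> False" for g n a b :: nat
      by (unfold distrib_left; linarith)
    from this[OF 1 2 N'] show False .
  qed
  moreover have "form (Suc 1) g" using g(1) by (simp add: numeral_2_eq_2)
  ultimately obtain p2 h where p2: "p2 \<noteq> 0" "herm p2 p2 = 0" and h: "form 1 h" "\<And>x. g x = lin (tang p2) x * h x"
    using tangent_factor[of 1 g] dc[of 1] by auto
  have P2: "pt p2 \<in> points" using p2 by (auto simp: points_def)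
  have lf2: "locus f = perp (pt p1) \<union> perp (pt p2) \<union> locus h"
    unfolding lf locus_mult[of g, OF h(2)] locus_tang[OF p2] by blast
  have "\<not> tangent_free h"
  proof
    assume "tangent_free h"
    then have 1: "card (locus h) \<le> q ^ 3 + q" by (rule card_locus_plane_le[OF h(1) _ gens])
    have 2: "card (locus f) \<le> card (perp (pt p1) \<union> perp (pt p2)) + card (locus h)"
      unfolding lf2 by (rule card_Un_le)
    have 3: "card (perp (pt p1) \<union> perp (pt p2)) + (q + 1) \<le> 2 * (q ^ 3 + q\<^sup>2 + 1)"
    proof (cases "pt p1 = pt p2")
      case True
      have "q \<le> q ^ 3 + q\<^sup>2" using q2 by simp
      then show ?thesis using True card_tangent_section[OF P1] by simp
    next
      case False
      have "q \<le> q\<^sup>2" by (simp add: power2_eq_square)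
      then show ?thesis using card_perp_Un_le(1)[OF P1 P2 False]
        by (simp add: algebra_simps power2_eq_square power3_eq_cube)
    qed
    have "\<lbrakk>h \<le> a + q; n \<le> c + h; c + (q + 1) \<le> 2 * (a + b + 1); n + 3 * q = 3 * (a + b) + 1; b \<ge> 4 * q\<rbrakk> \<Longrightarrow> False"
      for h n a b c :: nat using q_ge by (unfold distrib_left; linarith)
    from this[OF 1 2 3 N' q2] show False .
  qed
  moreover have "form (Suc 0) h" using h(1) by simp
  ultimately obtain p3 k where p3: "p3 \<noteq> 0" "herm p3 p3 = 0" and k: "form 0 k" "\<And>x. h x = lin (tang p3) x * k x"
    using tangent_factor[of 0 h] dc[of 0] by auto
  obtain b where b: "k = (\<lambda>_. to_ac b)" using form_0_const[OF k(1)] by blast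
  have fx: "f x = lin (tang p1) x * (lin (tang p2) x * (lin (tang p3) x * to_ac b))" for x
    using g(2) h(2) k(2) b by simp
  have "b \<noteq> 0"
  proof
    assume "b = 0"
    then have "f x = 0" for x using fx by simp
    then have "locus f = points" by (auto simp: locus_def points_def)
    moreover obtain l where "l \<in> generators" using gens by blast
    ultimately have "card (locus f) = (q\<^sup>2 + 1) * (q\<^sup>2 * q + 1)" using card_points by simp
    also have "\<dots> = q\<^sup>2 * q ^ 3 + q ^ 3 + q\<^sup>2 + 1" by (simp add: algebra_simps power2_eq_square power3_eq_cube)
    finally have 1: "card (locus f) = q\<^sup>2 * q ^ 3 + q ^ 3 + q\<^sup>2 + 1" .
    have "4 * 4 \<le> q\<^sup>2" using q2 q_ge by linarith
    then have 2: "4 * 4 * q ^ 3 \<le> q\<^sup>2 * q ^ 3" by (intro mult_right_mono) auto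
    have "\<lbrakk>n = e + a + b + 1; 4 * 4 * a \<le> e; n + 3 * q = 3 * (a + b) + 1; b \<ge> 4 * q; a \<ge> 4 * b\<rbrakk> \<Longrightarrow> False"
      for n a b e :: nat using q_ge by (unfold distrib_left; linarith)
    from this[OF 1 2 N' q2 q3] show False .
  qed
  show thesis by (rule that[OF p1 p2 p3 \<open>b \<noteq> 0\<close> fx])
qed

lemma tangent_planes_secant:
  assumes "p \<noteq> 0" "herm p p = 0" "p' \<noteq> 0" "herm p' p' = 0" "pt p' \<notin> perp (pt p)"
  shows "is_secant_line q A (plane (tang p) \<inter> plane (tang p'))"
proof -
  have "plane (tang p) \<inter> plane (tang p') \<inter> zero_set (hermitian_poly q A) \<inter> rational_points
     = perp (pt p) \<inter> perp (pt p')"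
    using plane_rational[OF assms(1,2)] plane_rational[OF assms(3,4)] by blast
  moreover have "pt p \<in> points" "pt p' \<in> points" using assms by (auto simp: points_def)
  ultimately show ?thesis unfolding is_secant_line_def
    using planes_meet_in_line[OF assms] card_perp_Int_noncollinear[of "pt p" "pt p'"] assms(5) by simp
qed

lemma is_tangent_plane_tang:
  assumes "p \<noteq> 0" "herm p p = 0" shows "is_tangent_plane (hermitian_poly q A) (plane (tang p))"
proof -
  have "pt p \<in> zero_set (hermitian_poly q A) \<inter> rational_points"
  proof
    have "eval_ac (hermitian_poly q A) (embed_ac p) = 0" "embed_ac p \<noteq> 0"
      using assms embed_ac_eq_iff[of p 0] by (simp_all add: eval_hermitian_poly_embed)
    then show "pt p \<in> zero_set (hermitian_poly q A)" unfolding zero_set_def pt_def by blast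
    show "pt p \<in> rational_points" unfolding rational_points_def pt_def using assms(1) by blast
  qed
  then show ?thesis unfolding is_tangent_plane_def
    using is_plane_plane[OF tang_nonzero[OF assms(1)]] tangent_space_pt[of p] by blast
qed

end

theorem corollary5p5:
  fixes q :: nat
    and A :: "'a::{field,finite} ^ 4 ^ 4"
    and F :: "'a poly4"
  assumes "primepow q" and "q \<ge> 4"
    and "CARD('a) = q ^ 2"
    and "invertible A" and "hermitian_matrix q A"
    and "F \<noteq> 0" and "homogeneous 3 F"
    and "card (zero_set F \<inter> zero_set (hermitian_poly q A) \<inter> rational_points) = 3 * (q ^ 3 + q ^ 2 - q) + 1"
  shows "\<exists>E :: nat \<Rightarrow> 'a point3 set.
    inj_on E {1..3} \<and>
    (\<forall>i\<in>{1..3}. is_tangent_plane (hermitian_poly q A) (E i)) \<and>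
    zero_set F = (\<Union>i\<in>{1..3}. E i) \<and>
    (\<forall>i\<in>{1..3}. \<forall>j\<in>{1..3}. i \<noteq> j \<longrightarrow> is_secant_line q A (E i \<inter> E j)) \<and>
    card (E 1 \<inter> E 2 \<inter> E 3 \<inter> zero_set (hermitian_poly q A) \<inter> rational_points) = 1"
proof -
  interpret hermitian_space q A using assms by unfold_locales
  have f: "form 3 (eval_ac F)" using assms(7) by (rule form_eval_ac)
  have N: "card (locus (eval_ac F)) = 3 * (q ^ 3 + q\<^sup>2 - q) + 1"
    using assms(8) rational_locus[OF f] by simp
  obtain p1 p2 p3 b where p: "p1 \<noteq> 0" "herm p1 p1 = 0" "p2 \<noteq> 0" "herm p2 p2 = 0" "p3 \<noteq> 0" "herm p3 p3 = 0"
    and b: "b \<noteq> 0" and F: "\<And>x. eval_ac F x = lin (tang p1) x * (lin (tang p2) x * (lin (tang p3) x * to_ac b))"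
    by (rule cubic_factors_into_tangent_planes[OF f N]) (rule that)
  have P: "pt p1 \<in> points" "pt p2 \<in> points" "pt p3 \<in> points" using p by (auto simp: points_def)
  have "locus (eval_ac F) = perp (pt p1) \<union> perp (pt p2) \<union> perp (pt p3)"
  proof -
    have "eval_ac F x = 0 \<longleftrightarrow> lin (tang p1) x = 0 \<or> lin (tang p2) x = 0 \<or> lin (tang p3) x = 0" for x
      using b by (simp add: F)
    then have "locus (eval_ac F) = locus (lin (tang p1)) \<union> locus (lin (tang p2)) \<union> locus (lin (tang p3))"
      unfolding locus_def by blast
    then show ?thesis unfolding locus_tang[OF p(1,2)] locus_tang[OF p(3,4)] locus_tang[OF p(5,6)] .
  qed
  moreover have "q \<le> q ^ 3 + q\<^sup>2" by (simp add: power2_eq_square trans_le_add2)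
  ultimately have N': "card (perp (pt p1) \<union> perp (pt p2) \<union> perp (pt p3)) + 3 * q = 3 * (q ^ 3 + q\<^sup>2) + 1"
    using N by (simp add: algebra_simps diff_mult_distrib2)
  note three = three_perps[OF refl assms(2) P N']
  define E where "E i = plane (tang (if i = 1 then p1 else if i = 2 then p2 else p3))" for i :: nat
  have E: "E 1 = plane (tang p1)" "E 2 = plane (tang p2)" "E 3 = plane (tang p3)" by (simp_all add: E_def)
  have I: "{1..3::nat} = {1, 2, 3}" by auto
  have sec: "is_secant_line q A (E 1 \<inter> E 2)" "is_secant_line q A (E 1 \<inter> E 3)" "is_secant_line q A (E 2 \<inter> E 3)"
    unfolding E by (rule tangent_planes_secant; rule p three)+
  have rat: "E 1 \<inter> zero_set (hermitian_poly q A) \<inter> rational_points = perp (pt p1)"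
    "E 2 \<inter> zero_set (hermitian_poly q A) \<inter> rational_points = perp (pt p2)"
    "E 3 \<inter> zero_set (hermitian_poly q A) \<inter> rational_points = perp (pt p3)"
    unfolding E by (rule plane_rational; rule p)+
  have self: "pt p2 \<in> perp (pt p2)" "pt p3 \<in> perp (pt p3)"
    using in_perp_iff[OF p(3,4,3)] in_perp_iff[OF p(5,6,5)] p by auto
  have "E 1 \<noteq> E 2" "E 1 \<noteq> E 3" "E 2 \<noteq> E 3" using rat self three(1-3) by auto
  then have inj: "inj_on E {1..3}" unfolding I by (auto simp: inj_on_def)
  have tan: "\<forall>i\<in>{1..3}. is_tangent_plane (hermitian_poly q A) (E i)"
    unfolding I using is_tangent_plane_tang[OF p(1,2)] is_tangent_plane_tang[OF p(3,4)] is_tangent_plane_tang[OF p(5,6)]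
    by (simp add: E[unfolded One_nat_def] E)
  have Z: "zero_set F = (\<Union>i\<in>{1..3}. E i)"
  proof -
    have "eval_ac F x = 0 \<longleftrightarrow> lin (tang p1) x = 0 \<or> lin (tang p2) x = 0 \<or> lin (tang p3) x = 0" for x
      using b by (simp add: F)
    then have "zero_set F = E 1 \<union> E 2 \<union> E 3" unfolding zero_set_def E plane_def by blast
    then show ?thesis unfolding I by blast
  qed
  have S: "\<forall>i\<in>{1..3}. \<forall>j\<in>{1..3}. i \<noteq> j \<longrightarrow> is_secant_line q A (E i \<inter> E j)"
    unfolding I using sec by (auto simp: Int_commute)
  have "E 1 \<inter> E 2 \<inter> E 3 \<inter> zero_set (hermitian_poly q A) \<inter> rational_points
    = perp (pt p1) \<inter> perp (pt p2) \<inter> perp (pt p3)" using rat by blast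
  then have "card (E 1 \<inter> E 2 \<inter> E 3 \<inter> zero_set (hermitian_poly q A) \<inter> rational_points) = 1"
    using three(4) by simp
  with inj tan Z S show ?thesis by blast
qed

end
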